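(* Let $(\mathfrak g,\varphi_i,\xi_i,\eta_i,g)$ be an almost $3$-contact metric Lie algebra with a parallel canonical abelian structure such that $\delta=0$. Then $\mathfrak v\subset\mathfrak z(\mathfrak g)$ and $\mathfrak g$ is the central extension $\mathfrak g=\mathfrak v\oplus_\theta\mathfrak h$ of a Lie algebra $\mathfrak h$ carrying an abelian hypercomplex structure $J_i$, $i=1,2,3$, for the $J_i$-invariant $\mathfrak v$-valued $2$-cocycle $\theta$ on $\mathfrak h$ given by $$\theta(X,Y)=-\sum_{i=1}^3d\eta_i(X,Y)\xi_i.$$ If $G$ is any Lie group with Lie algebra $\mathfrak g$, endowed with left invariant structure $(\varphi_i,\xi_i,\eta_i,g)$, the canonical connection of $G$ is the connection with skew torsion $$T=c+\sum_{i=1}^3\eta_i\wedge d\eta_i,$$ where $c$ is the $3$-form defined on $\mathfrak h$ by $c(X,Y,Z)=-g([X,Y],Z)-g([Y,Z],X)-g([Z,X],Y)$.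
   Context: An almost contact structure on a real Lie algebra $\mathfrak g$ is a triple $(\varphi,\xi,\eta)$, $\varphi\in\mathrm{End}(\mathfrak g)$, $\xi\in\mathfrak g$, $\eta\in\mathfrak g^*$, with $\varphi^2=-I+\eta\otimes\xi$ and $\eta(\xi)=1$. It is abelian if $\mathrm{ad}_\xi\circ\varphi=\varphi\circ\mathrm{ad}_\xi$ and $[\varphi X,\varphi Y]=[X,Y]$ for all $X,Y\in\operatorname{Ker}\eta$. An almost $3$-contact metric Lie algebra is a real Lie algebra $\mathfrak g$ of dimension $4n+3$ with three almost contact structures $(\varphi_i,\xi_i,\eta_i)$, $i=1,2,3$, such that for every even permutation $(i,j,k)$ of $(1,2,3)$: $\varphi_k=\varphi_i\varphi_j-\eta_j\otimes\xi_i=-\varphi_j\varphi_i+\eta_i\otimes\xi_j$, $\xi_k=\varphi_i\xi_j=-\varphi_j\xi_i$, $\eta_k=\eta_i\circ\varphi_j=-\eta_j\circ\varphi_i$, together with an inner product $g$ satisfying $g(\varphi_iX,\varphi_iY)=g(X,Y)-\eta_i(X)\eta_i(Y)$ for all $X,Y,i$. It is abelian if each $(\varphi_i,\xi_i,\eta_i)$ is abelian. Set $\mathfrak h=\bigcap_i\operatorname{Ker}\eta_i$, $\mathfrak v=\langle\xi_1,\xi_2,\xi_3\rangle$; $\mathfrak z(\mathfrak g)$ is the center. For an abelian structure the following are well defined: $\mathcal Z:=\varphi_i([\xi_j,\xi_k])\in\mathfrak h$ and $\delta\in\mathbb R$ with $2\delta=\eta_i([\xi_j,\xi_k])$ (independent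 of the even permutation $(i,j,k)$ of $(1,2,3)$); and $\psi:=(\mathrm{ad}_{\xi_i}\circ\varphi_i)|_{\mathfrak h}=(\varphi_i\circ\mathrm{ad}_{\xi_i})|_{\mathfrak h}$ (independent of $i$). An abelian structure is parallel canonical if $\mathcal Z=0$ and $\psi=0$. In that case the canonical connection of $G$ is the unique metric connection $\nabla$ with totally skew-symmetric torsion (i.e. $T(X,Y,Z)=g(T(X,Y),Z)$ is a $3$-form) such that $\nabla\varphi_i=0$ for $i=1,2,3$ (it then also satisfies $\nabla\xi_i=0$, $\nabla\eta_i=0$). An abelian hypercomplex structure on a Lie algebra is a triple $J_1,J_2,J_3$ of endomorphisms with $J_i^2=-I$, $J_1J_2=-J_2J_1=J_3$ and $[J_iX,J_iY]=[X,Y]$ for all $X,Y,i$. A $\mathfrak v$-valued $2$-cocycle on a Lie algebra $\mathfrak h$ is a closed $\theta\in\bigwedge^2\mathfrak h^*\otimes\mathfrak v$; $J_i$-invariance means $\theta(J_iX,J_iY)=\theta(X,Y)$ for all $i$. $\mathfrak v\oplus_\theta\mathfrak h$ is $\mathfrak v\oplus\mathfrak h$ with $\mathfrak v$ central and bracket of $X,Y\in\mathfrak h$ equal to $\theta(X,Y)+[X,Y]_{\mathfrak h}$. Here the Lie bracket $[\cdot,\cdot]_{\mathfrak h}$ on the horizontal subspace $\mathfrak h$ is the $\mathfrak h$-component of the bracket of $\mathfrak g$, and $J_i=\varphi_i|_{\mathfrak h}$. Conventions: $d\eta(X,Y)=-\eta([X,Y])$; $(\eta\wedge\omega)(X,Y,Z)$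 is the cyclic sum of $\eta(X)\omega(Y,Z)$; $c$ is extended to $\mathfrak g$ by zero on $\mathfrak v$. *)

theory Defs
  imports "HOL-Analysis.Analysis"
begin

section \<open>Lie algebras\<close>

text \<open>Real Lie algebras carried by a linear subspace of a real vector space, so that the horizontal
  subspace of a Lie algebra can be a Lie algebra for a bracket of its own.\<close>

definition linear_on_sub :: "'a::real_vector set \<Rightarrow> 'b::real_vector set \<Rightarrow> ('a \<Rightarrow> 'b) \<Rightarrow> bool" where
  "linear_on_sub V W f \<longleftrightarrow>
     (\<forall>x\<in>V. f x \<in> W) \<and>
     (\<forall>x\<in>V. \<forall>y\<in>V. \<forall>a b. f (a *\<^sub>R x + b *\<^sub>R y) = a *\<^sub>R f x + b *\<^sub>R f y)"

definition alternating_bilinear_on ::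
    "'a::real_vector set \<Rightarrow> 'b::real_vector set \<Rightarrow> ('a \<Rightarrow> 'a \<Rightarrow> 'b) \<Rightarrow> bool" where
  "alternating_bilinear_on V W B \<longleftrightarrow>
     (\<forall>x\<in>V. linear_on_sub V W (B x)) \<and>
     (\<forall>y\<in>V. linear_on_sub V W (\<lambda>x. B x y)) \<and>
     (\<forall>x\<in>V. B x x = 0)"

definition lie_algebra_on :: "'a::real_vector set \<Rightarrow> ('a \<Rightarrow> 'a \<Rightarrow> 'a) \<Rightarrow> bool" where
  "lie_algebra_on V br \<longleftrightarrow>
     subspace V \<and> alternating_bilinear_on V V br \<and>
     (\<forall>x\<in>V. \<forall>y\<in>V. \<forall>z\<in>V. br x (br y z) + br y (br z x) + br z (br x y) = 0)"

definition lie_center :: "('a::real_vector \<Rightarrow> 'a \<Rightarrow> 'a) \<Rightarrow> 'a set" where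
  "lie_center br = {x. \<forall>y. br x y = 0}"

definition lie_algebra_iso ::
    "'a::real_vector set \<Rightarrow> ('a \<Rightarrow> 'a \<Rightarrow> 'a) \<Rightarrow> 'b::real_vector set \<Rightarrow> ('b \<Rightarrow> 'b \<Rightarrow> 'b) \<Rightarrow>
     ('a \<Rightarrow> 'b) \<Rightarrow> bool" where
  "lie_algebra_iso V br W br' f \<longleftrightarrow>
     lie_algebra_on V br \<and> lie_algebra_on W br' \<and>
     linear_on_sub V W f \<and> bij_betw f V W \<and>
     (\<forall>x\<in>V. \<forall>y\<in>V. f (br x y) = br' (f x) (f y))"

text \<open>A \<open>W\<close>-valued 2-cocycle on the Lie algebra \<open>(V, br)\<close>; \<open>W\<close> is a trivial module, so closedness
  is the vanishing of the cyclic sum.\<close>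

definition lie_two_cocycle ::
    "'a::real_vector set \<Rightarrow> ('a \<Rightarrow> 'a \<Rightarrow> 'a) \<Rightarrow> 'b::real_vector set \<Rightarrow> ('a \<Rightarrow> 'a \<Rightarrow> 'b) \<Rightarrow> bool" where
  "lie_two_cocycle V br W \<theta> \<longleftrightarrow>
     alternating_bilinear_on V W \<theta> \<and>
     (\<forall>x\<in>V. \<forall>y\<in>V. \<forall>z\<in>V. \<theta> (br x y) z + \<theta> (br y z) x + \<theta> (br z x) y = 0)"

text \<open>The bracket of the central extension of \<open>(V, br)\<close> by \<open>W\<close> defined by \<open>\<theta>\<close>, on the carrier
  \<open>W \<times> V\<close>.\<close>

definition central_ext_bracket ::
    "('a \<Rightarrow> 'a \<Rightarrow> 'b) \<Rightarrow> ('a \<Rightarrow> 'a \<Rightarrow> 'a) \<Rightarrow> 'b \<times> 'a \<Rightarrow> 'b \<times> 'a \<Rightarrow> 'b \<times> 'a" where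
  "central_ext_bracket \<theta> br p q = (\<theta> (snd p) (snd q), br (snd p) (snd q))"

definition abelian_hypercomplex ::
    "'a::real_vector set \<Rightarrow> ('a \<Rightarrow> 'a \<Rightarrow> 'a) \<Rightarrow> (nat \<Rightarrow> 'a \<Rightarrow> 'a) \<Rightarrow> bool" where
  "abelian_hypercomplex V br J \<longleftrightarrow>
     (\<forall>i\<in>{1,2,3}. linear_on_sub V V (J i)) \<and>
     (\<forall>i\<in>{1,2,3}. \<forall>x\<in>V. J i (J i x) = - x) \<and>
     (\<forall>x\<in>V. J 1 (J 2 x) = J 3 x \<and> J 2 (J 1 x) = - J 3 x) \<and>
     (\<forall>i\<in>{1,2,3}. \<forall>x\<in>V. \<forall>y\<in>V. br (J i x) (J i y) = br x y)"

section \<open>Almost contact structures\<close>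

definition almost_contact :: "('a::real_vector \<Rightarrow> 'a) \<Rightarrow> 'a \<Rightarrow> ('a \<Rightarrow> real) \<Rightarrow> bool" where
  "almost_contact \<phi> \<xi> \<eta> \<longleftrightarrow>
     linear \<phi> \<and> linear \<eta> \<and> (\<forall>x. \<phi> (\<phi> x) = - x + \<eta> x *\<^sub>R \<xi>) \<and> \<eta> \<xi> = 1"

definition abelian_almost_contact ::
    "('a::real_vector \<Rightarrow> 'a \<Rightarrow> 'a) \<Rightarrow> ('a \<Rightarrow> 'a) \<Rightarrow> 'a \<Rightarrow> ('a \<Rightarrow> real) \<Rightarrow> bool" where
  "abelian_almost_contact br \<phi> \<xi> \<eta> \<longleftrightarrow>
     (\<forall>x. br \<xi> (\<phi> x) = \<phi> (br \<xi> x)) \<and>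
     (\<forall>x y. \<eta> x = 0 \<longrightarrow> \<eta> y = 0 \<longrightarrow> br (\<phi> x) (\<phi> y) = br x y)"

definition inner_product :: "('a::real_vector \<Rightarrow> 'a \<Rightarrow> real) \<Rightarrow> bool" where
  "inner_product g \<longleftrightarrow>
     (\<forall>x. linear (g x)) \<and> (\<forall>x y. g x y = g y x) \<and> (\<forall>x. x \<noteq> 0 \<longrightarrow> g x x > 0)"

definition even_perms3 :: "(nat \<times> nat \<times> nat) set" where
  "even_perms3 = {(1,2,3), (2,3,1), (3,1,2)}"

text \<open>The structures are families indexed by \<open>1, 2, 3\<close>; other indices carry no meaning.
  Since \<open>dim\<close> is 0 for an infinite-dimensional space, the dimension equation entails finite
  dimension.\<close>

definition almost_3_contact_metric_lie_algebra ::
    "nat \<Rightarrow> ('a::real_vector \<Rightarrow> 'a \<Rightarrow> 'a) \<Rightarrow> (nat \<Rightarrow> 'a \<Rightarrow> 'a) \<Rightarrow> (nat \<Rightarrow> 'a) \<Rightarrow>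
     (nat \<Rightarrow> 'a \<Rightarrow> real) \<Rightarrow> ('a \<Rightarrow> 'a \<Rightarrow> real) \<Rightarrow> bool" where
  "almost_3_contact_metric_lie_algebra n br \<phi> \<xi> \<eta> g \<longleftrightarrow>
     lie_algebra_on UNIV br \<and> dim (UNIV :: 'a set) = 4 * n + 3 \<and>
     (\<forall>i\<in>{1,2,3}. almost_contact (\<phi> i) (\<xi> i) (\<eta> i)) \<and>
     (\<forall>(i,j,k)\<in>even_perms3.
        (\<forall>x. \<phi> k x = \<phi> i (\<phi> j x) - \<eta> j x *\<^sub>R \<xi> i \<and>
             \<phi> k x = - \<phi> j (\<phi> i x) + \<eta> i x *\<^sub>R \<xi> j) \<and>
        \<xi> k = \<phi> i (\<xi> j) \<and> \<xi> k = - \<phi> j (\<xi> i) \<and>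
        (\<forall>x. \<eta> k x = \<eta> i (\<phi> j x) \<and> \<eta> k x = - \<eta> j (\<phi> i x))) \<and>
     inner_product g \<and>
     (\<forall>i\<in>{1,2,3}. \<forall>x y. g (\<phi> i x) (\<phi> i y) = g x y - \<eta> i x * \<eta> i y)"

definition abelian_3_contact ::
    "('a::real_vector \<Rightarrow> 'a \<Rightarrow> 'a) \<Rightarrow> (nat \<Rightarrow> 'a \<Rightarrow> 'a) \<Rightarrow> (nat \<Rightarrow> 'a) \<Rightarrow> (nat \<Rightarrow> 'a \<Rightarrow> real) \<Rightarrow> bool" where
  "abelian_3_contact br \<phi> \<xi> \<eta> \<longleftrightarrow>
     (\<forall>i\<in>{1,2,3}. abelian_almost_contact br (\<phi> i) (\<xi> i) (\<eta> i))"

definition horizontal :: "(nat \<Rightarrow> 'a::real_vector \<Rightarrow> real) \<Rightarrow> 'a set" where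
  "horizontal \<eta> = {x. \<forall>i\<in>{1,2,3}. \<eta> i x = 0}"

definition vertical :: "(nat \<Rightarrow> 'a::real_vector) \<Rightarrow> 'a set" where
  "vertical \<xi> = span {\<xi> 1, \<xi> 2, \<xi> 3}"

text \<open>The projection onto the horizontal subspace along the vertical one; it is that projection
  because \<open>\<eta> i (\<xi> j)\<close> is 1 for \<open>i = j\<close> and 0 otherwise.\<close>

definition hor_proj ::
    "(nat \<Rightarrow> 'a::real_vector) \<Rightarrow> (nat \<Rightarrow> 'a \<Rightarrow> real) \<Rightarrow> 'a \<Rightarrow> 'a" where
  "hor_proj \<xi> \<eta> x = x - (\<Sum>i\<in>{1,2,3}. \<eta> i x *\<^sub>R \<xi> i)"

definition hor_bracket ::
    "('a::real_vector \<Rightarrow> 'a \<Rightarrow> 'a) \<Rightarrow> (nat \<Rightarrow> 'a) \<Rightarrow> (nat \<Rightarrow> 'a \<Rightarrow> real) \<Rightarrow> 'a \<Rightarrow> 'a \<Rightarrow> 'a" where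
  "hor_bracket br \<xi> \<eta> x y = hor_proj \<xi> \<eta> (br x y)"

text \<open>The vector \<open>\<Z>\<close>, the number \<open>\<delta>\<close> and the operator \<open>\<psi>\<close> on the horizontal subspace of an
  abelian structure, computed from the permutation (1,2,3), respectively the index 1. For abelian
  structures any other even permutation, respectively index, gives the same result.\<close>

definition contact_Z ::
    "('a::real_vector \<Rightarrow> 'a \<Rightarrow> 'a) \<Rightarrow> (nat \<Rightarrow> 'a \<Rightarrow> 'a) \<Rightarrow> (nat \<Rightarrow> 'a) \<Rightarrow> 'a" where
  "contact_Z br \<phi> \<xi> = \<phi> 1 (br (\<xi> 2) (\<xi> 3))"

definition contact_delta ::
    "('a::real_vector \<Rightarrow> 'a \<Rightarrow> 'a) \<Rightarrow> (nat \<Rightarrow> 'a) \<Rightarrow> (nat \<Rightarrow> 'a \<Rightarrow> real) \<Rightarrow> real" where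
  "contact_delta br \<xi> \<eta> = \<eta> 1 (br (\<xi> 2) (\<xi> 3)) / 2"

definition contact_psi ::
    "('a::real_vector \<Rightarrow> 'a \<Rightarrow> 'a) \<Rightarrow> (nat \<Rightarrow> 'a \<Rightarrow> 'a) \<Rightarrow> (nat \<Rightarrow> 'a) \<Rightarrow> 'a \<Rightarrow> 'a" where
  "contact_psi br \<phi> \<xi> x = br (\<xi> 1) (\<phi> 1 x)"

definition parallel_canonical ::
    "('a::real_vector \<Rightarrow> 'a \<Rightarrow> 'a) \<Rightarrow> (nat \<Rightarrow> 'a \<Rightarrow> 'a) \<Rightarrow> (nat \<Rightarrow> 'a) \<Rightarrow> (nat \<Rightarrow> 'a \<Rightarrow> real) \<Rightarrow> bool" where
  "parallel_canonical br \<phi> \<xi> \<eta> \<longleftrightarrow>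
     contact_Z br \<phi> \<xi> = 0 \<and> (\<forall>x\<in>horizontal \<eta>. contact_psi br \<phi> \<xi> x = 0)"

section \<open>Invariant forms on the Lie algebra\<close>

definition lie_d ::
    "('a::real_vector \<Rightarrow> 'a \<Rightarrow> 'a) \<Rightarrow> ('a \<Rightarrow> real) \<Rightarrow> 'a \<Rightarrow> 'a \<Rightarrow> real" where
  "lie_d br \<alpha> x y = - \<alpha> (br x y)"

definition wedge12 :: "('a \<Rightarrow> real) \<Rightarrow> ('a \<Rightarrow> 'a \<Rightarrow> real) \<Rightarrow> 'a \<Rightarrow> 'a \<Rightarrow> 'a \<Rightarrow> real" where
  "wedge12 \<alpha> \<omega> x y z = \<alpha> x * \<omega> y z + \<alpha> y * \<omega> z x + \<alpha> z * \<omega> x y"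

definition theta ::
    "('a::real_vector \<Rightarrow> 'a \<Rightarrow> 'a) \<Rightarrow> (nat \<Rightarrow> 'a) \<Rightarrow> (nat \<Rightarrow> 'a \<Rightarrow> real) \<Rightarrow> 'a \<Rightarrow> 'a \<Rightarrow> 'a" where
  "theta br \<xi> \<eta> x y = - (\<Sum>i\<in>{1,2,3}. lie_d br (\<eta> i) x y *\<^sub>R \<xi> i)"

definition c_form ::
    "('a::real_vector \<Rightarrow> 'a \<Rightarrow> 'a) \<Rightarrow> ('a \<Rightarrow> 'a \<Rightarrow> real) \<Rightarrow> 'a \<Rightarrow> 'a \<Rightarrow> 'a \<Rightarrow> real" where
  "c_form br g x y z = - g (br x y) z - g (br y z) x - g (br z x) y"

text \<open>The horizontal form \<open>c\<close> is extended by zero on the vertical subspace by precomposing with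
  the horizontal projection.\<close>

definition skew_torsion_T ::
    "('a::real_vector \<Rightarrow> 'a \<Rightarrow> 'a) \<Rightarrow> (nat \<Rightarrow> 'a) \<Rightarrow> (nat \<Rightarrow> 'a \<Rightarrow> real) \<Rightarrow> ('a \<Rightarrow> 'a \<Rightarrow> real) \<Rightarrow>
     'a \<Rightarrow> 'a \<Rightarrow> 'a \<Rightarrow> real" where
  "skew_torsion_T br \<xi> \<eta> g x y z =
     c_form br g (hor_proj \<xi> \<eta> x) (hor_proj \<xi> \<eta> y) (hor_proj \<xi> \<eta> z) +
     (\<Sum>i\<in>{1,2,3}. wedge12 (\<eta> i) (lie_d br (\<eta> i)) x y z)"

section \<open>Lie groups\<close>

text \<open>\<open>C^k\<close> and smooth maps on an open set \<open>S\<close> of a Euclidean space (the definitions are meant for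
  open \<open>S\<close> only): all iterated directional derivatives up to order \<open>k\<close> exist and are continuous.\<close>

primrec Ck_on :: "nat \<Rightarrow> ('a::euclidean_space \<Rightarrow> 'b::real_normed_vector) \<Rightarrow> 'a set \<Rightarrow> bool" where
  "Ck_on 0 f S \<longleftrightarrow> continuous_on S f"
| "Ck_on (Suc k) f S \<longleftrightarrow>
     f differentiable_on S \<and> (\<forall>v. Ck_on k (\<lambda>x. frechet_derivative f (at x) v) S)"

definition smooth_on :: "'a::euclidean_space set \<Rightarrow> ('a \<Rightarrow> 'b::real_normed_vector) \<Rightarrow> bool" where
  "smooth_on S f \<longleftrightarrow> (\<forall>k. Ck_on k f S)"

text \<open>A chart is a pair \<open>(U, c)\<close> of an open domain and a coordinate map, of which only the values on
  \<open>U\<close> matter.\<close>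

definition chart_on :: "'g::topological_space set \<Rightarrow> ('g \<Rightarrow> 'e::euclidean_space) \<Rightarrow> bool" where
  "chart_on U c \<longleftrightarrow> open U \<and> open (c ` U) \<and> homeomorphism U (c ` U) c (inv_into U c)"

definition smooth_atlas ::
    "('g::{t2_space,second_countable_topology} set \<times> ('g \<Rightarrow> 'e::euclidean_space)) set \<Rightarrow> bool" where
  "smooth_atlas A \<longleftrightarrow>
     (\<forall>(U,c)\<in>A. chart_on U c) \<and> (\<Union>(U,c)\<in>A. U) = UNIV \<and>
     (\<forall>(U,c)\<in>A. \<forall>(V,d)\<in>A. smooth_on (c ` (U \<inter> V)) (d \<circ> inv_into U c))"

text \<open>A Lie group structure on a (Hausdorff, second countable) topological group. The group is
  written additively, as in the class \<^class>\<open>group_add\<close>, but is not assumed to be commutative.\<close>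

definition lie_group ::
    "('g::{topological_group_add,t2_space,second_countable_topology} set
       \<times> ('g \<Rightarrow> 'e::euclidean_space)) set \<Rightarrow> bool" where
  "lie_group A \<longleftrightarrow>
     smooth_atlas A \<and>
     (\<forall>(U,c)\<in>A. \<forall>(V,d)\<in>A. \<forall>(W,e)\<in>A.
        smooth_on {(x, y). x \<in> c ` U \<and> y \<in> d ` V \<and> inv_into U c x + inv_into V d y \<in> W}
          (\<lambda>(x, y). e (inv_into U c x + inv_into V d y))) \<and>
     (\<forall>(U,c)\<in>A. \<forall>(W,e)\<in>A.
        smooth_on {x. x \<in> c ` U \<and> - inv_into U c x \<in> W} (\<lambda>x. e (- inv_into U c x)))"

definition smooth_functions ::
    "('g::{t2_space,second_countable_topology} set \<times> ('g \<Rightarrow> 'e::euclidean_space)) set \<Rightarrow>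
     ('g \<Rightarrow> real) set" where
  "smooth_functions A = {f. \<forall>(U,c)\<in>A. smooth_on (c ` U) (f \<circ> inv_into U c)}"

text \<open>Smooth vector fields are derivations of the algebra of smooth functions. To make equality of
  vector fields equality in HOL, a derivation is required to vanish on functions that are not
  smooth.\<close>

type_synonym 'g vfield = "('g \<Rightarrow> real) \<Rightarrow> 'g \<Rightarrow> real"

definition vector_fields ::
    "('g::{t2_space,second_countable_topology} set \<times> ('g \<Rightarrow> 'e::euclidean_space)) set \<Rightarrow>
     'g vfield set" where
  "vector_fields A = {X.
     (\<forall>f\<in>smooth_functions A. X f \<in> smooth_functions A) \<and>
     (\<forall>f. f \<notin> smooth_functions A \<longrightarrow> X f = (\<lambda>_. 0)) \<and>
     (\<forall>f\<in>smooth_functions A. \<forall>h\<in>smooth_functions A.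
        (\<forall>a b. X (\<lambda>p. a * f p + b * h p) = (\<lambda>p. a * X f p + b * X h p)) \<and>
        X (\<lambda>p. f p * h p) = (\<lambda>p. f p * X h p + h p * X f p))}"

definition vf_zero :: "'g vfield" where
  "vf_zero = (\<lambda>f p. 0)"

definition vf_add :: "'g vfield \<Rightarrow> 'g vfield \<Rightarrow> 'g vfield" where
  "vf_add X Y = (\<lambda>f p. X f p + Y f p)"

definition vf_diff :: "'g vfield \<Rightarrow> 'g vfield \<Rightarrow> 'g vfield" where
  "vf_diff X Y = (\<lambda>f p. X f p - Y f p)"

definition vf_mult :: "('g \<Rightarrow> real) \<Rightarrow> 'g vfield \<Rightarrow> 'g vfield" where
  "vf_mult h X = (\<lambda>f p. h p * X f p)"

definition vf_bracket :: "'g vfield \<Rightarrow> 'g vfield \<Rightarrow> 'g vfield" where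
  "vf_bracket X Y = (\<lambda>f p. X (Y f) p - Y (X f) p)"

definition left_invariant_fields ::
    "('g::{topological_group_add,t2_space,second_countable_topology} set
       \<times> ('g \<Rightarrow> 'e::euclidean_space)) set \<Rightarrow> 'g vfield set" where
  "left_invariant_fields A = {X \<in> vector_fields A.
     \<forall>f\<in>smooth_functions A. \<forall>a. X (\<lambda>p. f (a + p)) = (\<lambda>p. X f (a + p))}"

text \<open>An identification \<open>\<iota>\<close> of the Lie algebra of the Lie group, i.e. the Lie algebra of left
  invariant vector fields, with the given Lie algebra.\<close>

definition lie_algebra_of_group ::
    "('g::{topological_group_add,t2_space,second_countable_topology} set
       \<times> ('g \<Rightarrow> 'e::euclidean_space)) set \<Rightarrow>
     ('a::real_vector \<Rightarrow> 'a \<Rightarrow> 'a) \<Rightarrow> ('a \<Rightarrow> 'g vfield) \<Rightarrow> bool" where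
  "lie_algebra_of_group A br \<iota> \<longleftrightarrow>
     bij_betw \<iota> UNIV (left_invariant_fields A) \<and>
     (\<forall>x y a b. \<iota> (a *\<^sub>R x + b *\<^sub>R y) = vf_add (vf_mult (\<lambda>_. a) (\<iota> x)) (vf_mult (\<lambda>_. b) (\<iota> y))) \<and>
     (\<forall>x y. \<iota> (br x y) = vf_bracket (\<iota> x) (\<iota> y))"

section \<open>Left invariant tensor fields\<close>

text \<open>The Maurer-Cartan form: \<open>maurer_cartan A \<iota> X p\<close> is the unique element of the Lie algebra
  whose left invariant field agrees with \<open>X\<close> at the point \<open>p\<close>. The left invariant tensor field
  induced by a tensor on the Lie algebra is obtained by applying the latter pointwise to the values
  of the Maurer-Cartan form.\<close>

definition maurer_cartan ::
    "('g::{topological_group_add,t2_space,second_countable_topology} set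
       \<times> ('g \<Rightarrow> 'e::euclidean_space)) set \<Rightarrow>
     ('a::real_vector \<Rightarrow> 'g vfield) \<Rightarrow> 'g vfield \<Rightarrow> 'g \<Rightarrow> 'a" where
  "maurer_cartan A \<iota> X p = (THE x. \<forall>f\<in>smooth_functions A. X f p = \<iota> x f p)"

definition left_inv_endo ::
    "('g::{topological_group_add,t2_space,second_countable_topology} set
       \<times> ('g \<Rightarrow> 'e::euclidean_space)) set \<Rightarrow>
     ('a::real_vector \<Rightarrow> 'g vfield) \<Rightarrow> ('a \<Rightarrow> 'a) \<Rightarrow> 'g vfield \<Rightarrow> 'g vfield" where
  "left_inv_endo A \<iota> \<phi> X = (\<lambda>f p. \<iota> (\<phi> (maurer_cartan A \<iota> X p)) f p)"

definition left_inv_2tensor ::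
    "('g::{topological_group_add,t2_space,second_countable_topology} set
       \<times> ('g \<Rightarrow> 'e::euclidean_space)) set \<Rightarrow>
     ('a::real_vector \<Rightarrow> 'g vfield) \<Rightarrow> ('a \<Rightarrow> 'a \<Rightarrow> real) \<Rightarrow> 'g vfield \<Rightarrow> 'g vfield \<Rightarrow> 'g \<Rightarrow> real" where
  "left_inv_2tensor A \<iota> b X Y = (\<lambda>p. b (maurer_cartan A \<iota> X p) (maurer_cartan A \<iota> Y p))"

definition left_inv_3tensor ::
    "('g::{topological_group_add,t2_space,second_countable_topology} set
       \<times> ('g \<Rightarrow> 'e::euclidean_space)) set \<Rightarrow>
     ('a::real_vector \<Rightarrow> 'g vfield) \<Rightarrow> ('a \<Rightarrow> 'a \<Rightarrow> 'a \<Rightarrow> real) \<Rightarrow>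
     'g vfield \<Rightarrow> 'g vfield \<Rightarrow> 'g vfield \<Rightarrow> 'g \<Rightarrow> real" where
  "left_inv_3tensor A \<iota> t X Y Z =
     (\<lambda>p. t (maurer_cartan A \<iota> X p) (maurer_cartan A \<iota> Y p) (maurer_cartan A \<iota> Z p))"

section \<open>Connections\<close>

text \<open>Linear connections on the tangent bundle as covariant derivatives \<open>D X Y\<close> of vector fields.
  As for vector fields, the value outside the domain is fixed to be zero. Homogeneity over the reals
  in \<open>Y\<close> is the Leibniz rule for constant functions.\<close>

definition connection ::
    "('g::{t2_space,second_countable_topology} set \<times> ('g \<Rightarrow> 'e::euclidean_space)) set \<Rightarrow>
     ('g vfield \<Rightarrow> 'g vfield \<Rightarrow> 'g vfield) \<Rightarrow> bool" where
  "connection A D \<longleftrightarrow>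
     (\<forall>X Y. X \<notin> vector_fields A \<or> Y \<notin> vector_fields A \<longrightarrow> D X Y = vf_zero) \<and>
     (\<forall>X\<in>vector_fields A. \<forall>Y\<in>vector_fields A. D X Y \<in> vector_fields A) \<and>
     (\<forall>X\<in>vector_fields A. \<forall>X'\<in>vector_fields A. \<forall>Y\<in>vector_fields A.
        D (vf_add X X') Y = vf_add (D X Y) (D X' Y) \<and>
        D Y (vf_add X X') = vf_add (D Y X) (D Y X')) \<and>
     (\<forall>f\<in>smooth_functions A. \<forall>X\<in>vector_fields A. \<forall>Y\<in>vector_fields A.
        D (vf_mult f X) Y = vf_mult f (D X Y) \<and>
        D X (vf_mult f Y) = vf_add (vf_mult (X f) Y) (vf_mult f (D X Y)))"

definition metric_connection ::
    "('g::{t2_space,second_countable_topology} set \<times> ('g \<Rightarrow> 'e::euclidean_space)) set \<Rightarrow>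
     ('g vfield \<Rightarrow> 'g vfield \<Rightarrow> 'g \<Rightarrow> real) \<Rightarrow>
     ('g vfield \<Rightarrow> 'g vfield \<Rightarrow> 'g vfield) \<Rightarrow> bool" where
  "metric_connection A gG D \<longleftrightarrow>
     connection A D \<and>
     (\<forall>X\<in>vector_fields A. \<forall>Y\<in>vector_fields A. \<forall>Z\<in>vector_fields A.
        X (gG Y Z) = (\<lambda>p. gG (D X Y) Z p + gG Y (D X Z) p))"

definition torsion ::
    "('g vfield \<Rightarrow> 'g vfield \<Rightarrow> 'g vfield) \<Rightarrow> 'g vfield \<Rightarrow> 'g vfield \<Rightarrow> 'g vfield" where
  "torsion D X Y = vf_diff (vf_diff (D X Y) (D Y X)) (vf_bracket X Y)"

definition torsion_form ::
    "('g vfield \<Rightarrow> 'g vfield \<Rightarrow> 'g \<Rightarrow> real) \<Rightarrow> ('g vfield \<Rightarrow> 'g vfield \<Rightarrow> 'g vfield) \<Rightarrow>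
     'g vfield \<Rightarrow> 'g vfield \<Rightarrow> 'g vfield \<Rightarrow> 'g \<Rightarrow> real" where
  "torsion_form gG D X Y Z = gG (torsion D X Y) Z"

text \<open>Differential 3-forms as skew-symmetric maps that are linear over the smooth functions;
  by skew-symmetry, linearity in the first argument suffices.\<close>

definition three_form ::
    "('g::{t2_space,second_countable_topology} set \<times> ('g \<Rightarrow> 'e::euclidean_space)) set \<Rightarrow>
     ('g vfield \<Rightarrow> 'g vfield \<Rightarrow> 'g vfield \<Rightarrow> 'g \<Rightarrow> real) \<Rightarrow> bool" where
  "three_form A \<tau> \<longleftrightarrow>
     (\<forall>X\<in>vector_fields A. \<forall>Y\<in>vector_fields A. \<forall>Z\<in>vector_fields A.
        \<tau> X Y Z \<in> smooth_functions A \<and>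
        \<tau> Y X Z = (\<lambda>p. - \<tau> X Y Z p) \<and> \<tau> X Z Y = (\<lambda>p. - \<tau> X Y Z p) \<and>
        (\<forall>X'\<in>vector_fields A. \<tau> (vf_add X X') Y Z = (\<lambda>p. \<tau> X Y Z p + \<tau> X' Y Z p)) \<and>
        (\<forall>f\<in>smooth_functions A. \<tau> (vf_mult f X) Y Z = (\<lambda>p. f p * \<tau> X Y Z p)))"

definition canonical_connection ::
    "('g::{t2_space,second_countable_topology} set \<times> ('g \<Rightarrow> 'e::euclidean_space)) set \<Rightarrow>
     (nat \<Rightarrow> 'g vfield \<Rightarrow> 'g vfield) \<Rightarrow> ('g vfield \<Rightarrow> 'g vfield \<Rightarrow> 'g \<Rightarrow> real) \<Rightarrow>
     ('g vfield \<Rightarrow> 'g vfield \<Rightarrow> 'g vfield) \<Rightarrow> bool" where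
  "canonical_connection A \<Phi> gG D \<longleftrightarrow>
     metric_connection A gG D \<and> three_form A (torsion_form gG D) \<and>
     (\<forall>i\<in>{1,2,3}. \<forall>X\<in>vector_fields A. \<forall>Y\<in>vector_fields A. D X (\<Phi> i Y) = \<Phi> i (D X Y))"

definition metric_connection_with_torsion ::
    "('g::{t2_space,second_countable_topology} set \<times> ('g \<Rightarrow> 'e::euclidean_space)) set \<Rightarrow>
     ('g vfield \<Rightarrow> 'g vfield \<Rightarrow> 'g \<Rightarrow> real) \<Rightarrow>
     ('g vfield \<Rightarrow> 'g vfield \<Rightarrow> 'g vfield \<Rightarrow> 'g \<Rightarrow> real) \<Rightarrow>
     ('g vfield \<Rightarrow> 'g vfield \<Rightarrow> 'g vfield) \<Rightarrow> bool" where
  "metric_connection_with_torsion A gG \<tau> D \<longleftrightarrow>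
     metric_connection A gG D \<and>
     (\<forall>X\<in>vector_fields A. \<forall>Y\<in>vector_fields A. \<forall>Z\<in>vector_fields A.
        torsion_form gG D X Y Z = \<tau> X Y Z)"

end

theory Submission
  imports Defs
begin

text \<open>Centrality of the vertical space is linear algebra: \<open>\<phi> 2\<close> and \<open>\<phi> 3\<close> carry \<open>ad \<xi> 1\<close> to \<open>ad \<xi> 3\<close> and
  \<open>ad \<xi> 2\<close>, and \<open>ad \<xi> 1\<close> vanishes. Once it is known, \<open>c + \<Sum>i. \<eta> i \<and> d (\<eta> i)\<close> is the cyclic form
  \<open>-g([X,Y],Z) - g([Y,Z],X) - g([Z,X],Y)\<close> on the whole Lie algebra, and Koszul's formula for this
  torsion collapses to \<open>g(\<nabla>X Y, Z) = -g([Y,Z],X)\<close>. As every \<open>\<phi> i\<close> satisfies \<open>[\<phi> Y, Z] = -[Y, \<phi> Z]\<close>,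
  this connection is parallel for \<open>\<phi> i\<close>. Uniqueness is checked on left invariant fields.

  On the group, vector fields are derivations of the algebra of smooth functions. Hadamard's lemma
  with bump functions expresses them in charts by partial derivatives. Hence a derivation acting on
  one variable of a smooth function of two variables leaves it smooth in both. This makes the
  translates of a tangent vector a smooth left invariant field, and makes the Maurer-Cartan form
  smooth, so that the left invariant fields are a global frame.\<close>

section \<open>Calculus of \<open>C^k\<close> maps\<close>

text \<open>Vector fields are known only through their action on global smooth functions,
  \<open>\<iota>\<close> supplies only the left invariant ones, and the model space
  \<open>'e\<close> of the charts has no prior relation to \<open>'a\<close>. The link is made
  pointwise: by translation, \<open>\<iota> x\<close> with x nonzero vanishes nowhere, and the value
  of any field at a point agrees with that of some \<open>\<iota> x\<close>. So fields correspond to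
  maps into \<open>'a\<close> without any dimension count. Since \<open>'a\<close> has no norm,
  smoothness of such maps is tested by linear functionals; a finite basis exists because the
  dimension 4n + 3 is positive.

  In this trivialisation the connection sought is d + \<open>\<Gamma>\<close> for one bilinear
  \<open>\<Gamma>\<close>, so existence becomes a list of algebraic identities. Both uniqueness
  claims become statements about the trilinear form g(D' x y - \<open>\<Gamma>\<close> x y, z) at a
  point. Metricity makes it skew in y and z. A prescribed torsion makes it symmetric in x and y; for
  the canonical connection the torsion is only known to be skew, and the missing information comes
  from \<open>\<phi>\<close>.\<close>

declare Ck_on.simps(2)[simp del]

lemma Ck_on_Suc_open:
  assumes "open S"
  shows "Ck_on (Suc k) f S \<longleftrightarrow>
    (\<forall>x\<in>S. f differentiable (at x)) \<and> (\<forall>v. Ck_on k (\<lambda>x. frechet_derivative f (at x) v) S)"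
  using assms by (simp add: Ck_on.simps(2) differentiable_on_def at_within_open[of _ S])

text \<open>On an open set the derivative at a point depends only on nearby values, so agreement on
  \<open>S\<close> passes to all directional derivatives.\<close>

lemma Ck_on_cong:
  assumes "open S" "\<And>x. x \<in> S \<Longrightarrow> f x = g x"
  shows "Ck_on k f S \<longleftrightarrow> Ck_on k g S"
  using assms(2)
proof (induction k arbitrary: f g)
  case 0
  then show ?case by (simp cong: continuous_on_cong)
next
  case (Suc k)
  have iff: "(f has_derivative d) (at x) \<longleftrightarrow> (g has_derivative d) (at x)" if "x \<in> S" for x d
    using Suc.prems that
      has_derivative_transform_within_open[of f d x UNIV S g, OF _ assms(1)]
      has_derivative_transform_within_open[of g d x UNIV S f, OF _ assms(1)] by metis
  then have "frechet_derivative f (at x) v = frechet_derivative g (at x) v" if "x \<in> S" for x v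
    using that unfolding frechet_derivative_def by simp
  then have "Ck_on k (\<lambda>x. frechet_derivative f (at x) v) S \<longleftrightarrow>
      Ck_on k (\<lambda>x. frechet_derivative g (at x) v) S" for v
    by (intro Suc.IH)
  moreover have "f differentiable (at x) \<longleftrightarrow> g differentiable (at x)" if "x \<in> S" for x
    using iff[OF that] by (simp add: differentiable_def)
  ultimately show ?case unfolding Ck_on_Suc_open[OF assms(1)] by blast
qed

text \<open>\<open>frechet_derivative\<close> is a choice operator; uniqueness of derivatives allows
  an explicit candidate \<open>f'\<close> in its place. Most closure rules below are inductions
  through this rule.\<close>

lemma Ck_on_SucI:
  assumes "open S" "\<And>x. x \<in> S \<Longrightarrow> (f has_derivative f' x) (at x)" "\<And>v. Ck_on k (\<lambda>x. f' x v) S"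
  shows "Ck_on (Suc k) f S"
proof -
  have "frechet_derivative f (at x) v = f' x v" if "x \<in> S" for x v
    by (rule fun_cong[OF frechet_derivative_at[OF assms(2)[OF that], symmetric]])
  then have "Ck_on k (\<lambda>x. frechet_derivative f (at x) v) S" for v
    using assms(3)[of v] by (subst Ck_on_cong[OF assms(1)])
  then show ?thesis
    unfolding Ck_on_Suc_open[OF assms(1)] using differentiableI[OF assms(2)] by blast
qed

lemma Ck_on_SucD:
  assumes "open S" "Ck_on (Suc k) f S"
  shows "x \<in> S \<Longrightarrow> (f has_derivative frechet_derivative f (at x)) (at x)"
    and "Ck_on k (\<lambda>x. frechet_derivative f (at x) v) S"
  using assms unfolding Ck_on_Suc_open[OF assms(1)] by (auto simp: frechet_derivative_works)

lemma Ck_on_imp_continuous_on: "Ck_on k f S \<Longrightarrow> continuous_on S f"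
  by (cases k) (auto intro: differentiable_imp_continuous_on simp: Ck_on.simps(2))

lemma Ck_on_pred: "Ck_on (Suc k) f S \<Longrightarrow> Ck_on k f S"
proof (induction k arbitrary: f)
  case 0
  then show ?case using Ck_on_imp_continuous_on[of "Suc 0" f S] by simp
next
  case (Suc k)
  have "Ck_on k (\<lambda>x. frechet_derivative f (at x) v) S" for v
    using Suc.prems by (intro Suc.IH) (simp only: Ck_on.simps(2)[of "Suc k"])
  moreover have "f differentiable_on S"
    using Suc.prems by (simp only: Ck_on.simps(2)[of "Suc k"])
  ultimately show ?case unfolding Ck_on.simps(2)[of k] by blast
qed

lemma Ck_on_subset: "Ck_on k f S \<Longrightarrow> T \<subseteq> S \<Longrightarrow> Ck_on k f T"
proof (induction k arbitrary: f)
  case 0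
  then show ?case by (auto intro: continuous_on_subset)
next
  case (Suc k)
  then show ?case by (auto simp: Ck_on.simps(2) intro: differentiable_on_subset)
qed

text \<open>Charts give only local formulas, and this rule glues them: continuity and
  differentiability at a point of an open set are local.\<close>

lemma Ck_on_local:
  assumes "open S" "\<And>x. x \<in> S \<Longrightarrow> \<exists>T. open T \<and> x \<in> T \<and> Ck_on k f T"
  shows "Ck_on k f S"
  using assms(2)
proof (induction k arbitrary: f)
  case 0
  have "continuous (at x) f" if "x \<in> S" for x
    using 0[OF that] continuous_on_eq_continuous_at by auto
  then show ?case using continuous_at_imp_continuous_on by auto
next
  case (Suc k)
  have "f differentiable (at x)" if "x \<in> S" for x
    using Suc.prems[OF that] Ck_on_SucD(1) differentiableI by blast
  moreover have "Ck_on k (\<lambda>x. frechet_derivative f (at x) v) S" for v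
  proof (rule Suc.IH)
    fix x assume "x \<in> S"
    then obtain T where "open T" "x \<in> T" "Ck_on (Suc k) f T"
      using Suc.prems by blast
    then show "\<exists>T. open T \<and> x \<in> T \<and> Ck_on k (\<lambda>x. frechet_derivative f (at x) v) T"
      by (intro exI[of _ T] conjI Ck_on_SucD(2))
  qed
  ultimately show ?case unfolding Ck_on_Suc_open[OF assms(1)] by blast
qed

lemma Ck_on_const [simp]: "Ck_on k (\<lambda>x. c) S"
proof (induction k arbitrary: c)
  case (Suc k)
  then show ?case by (simp add: Ck_on.simps(2))
qed simp

lemma Ck_on_bounded_linear_self:
  assumes "bounded_linear L"
  shows "Ck_on k L S"
proof -
  have "Ck_on k L UNIV"
  proof (cases k)
    case 0
    then show ?thesis using linear_continuous_on[OF assms] by (simp only: Ck_on.simps)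
  next
    case (Suc j)
    have "Ck_on (Suc j) L UNIV"
      by (rule Ck_on_SucI[where f' = "\<lambda>x. L"]) (rule open_UNIV bounded_linear_imp_has_derivative[OF assms] Ck_on_const)+
    then show ?thesis by (simp only: Suc)
  qed
  then show ?thesis by (rule Ck_on_subset) (rule subset_UNIV)
qed

lemma Ck_on_bounded_linear:
  assumes "open S" "bounded_linear L" "Ck_on k f S"
  shows "Ck_on k (\<lambda>x. L (f x)) S"
  using assms(3)
proof (induction k arbitrary: f)
  case 0
  then show ?case unfolding Ck_on.simps by (rule bounded_linear.continuous_on[OF assms(2)])
next
  case (Suc k)
  show ?case
    by (rule Ck_on_SucI[where f' = "\<lambda>x v. L (frechet_derivative f (at x) v)"])
      (rule assms(1) bounded_linear.has_derivative[OF assms(2)] Suc.IH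
        Ck_on_SucD[OF assms(1) Suc.prems] | assumption)+
qed

lemma Ck_on_add:
  assumes "open S" "Ck_on k f S" "Ck_on k g S"
  shows "Ck_on k (\<lambda>x. f x + g x) S"
  using assms(2,3)
proof (induction k arbitrary: f g)
  case 0
  then show ?case unfolding Ck_on.simps by (rule continuous_on_add)
next
  case (Suc k)
  show ?case
    by (rule Ck_on_SucI[where f' = "\<lambda>x v. frechet_derivative f (at x) v + frechet_derivative g (at x) v"])
      (rule assms(1) has_derivative_add Suc.IH Ck_on_SucD[OF assms(1) Suc.prems(1)]
        Ck_on_SucD[OF assms(1) Suc.prems(2)] | assumption)+
qed

lemma Ck_on_sum:
  assumes "open S" "\<And>i. i \<in> I \<Longrightarrow> Ck_on k (f i) S"
  shows "Ck_on k (\<lambda>x. \<Sum>i\<in>I. f i x) S"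
  using assms(2)
proof (induction I rule: infinite_finite_induct)
  case (insert i I)
  then have "Ck_on k (f i) S" "Ck_on k (\<lambda>x. \<Sum>i\<in>I. f i x) S"
    by blast+
  then have "Ck_on k (\<lambda>x. f i x + (\<Sum>i\<in>I. f i x)) S"
    by (rule Ck_on_add[OF assms(1)])
  with insert.hyps show ?case by simp
qed simp_all

text \<open>Leibniz rule: each term keeps one factor undifferentiated, so the induction needs both
  factors at the lower order as well, which \<open>Ck_on_pred\<close> supplies.\<close>

lemma Ck_on_bilinear:
  assumes "open S" "bounded_bilinear pr" "Ck_on k f S" "Ck_on k g S"
  shows "Ck_on k (\<lambda>x. pr (f x) (g x)) S"
  using assms(3,4)
proof (induction k arbitrary: f g)
  case 0
  then show ?case unfolding Ck_on.simps by (rule bounded_bilinear.continuous_on[OF assms(2)])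
next
  case (Suc k)
  show ?case
    by (rule Ck_on_SucI[where f' = "\<lambda>x v. pr (f x) (frechet_derivative g (at x) v) +
          pr (frechet_derivative f (at x) v) (g x)"])
      (rule assms(1) bounded_bilinear.FDERIV[OF assms(2)] Ck_on_add Suc.IH
        Ck_on_SucD[OF assms(1) Suc.prems(1)] Ck_on_SucD[OF assms(1) Suc.prems(2)]
        Ck_on_pred[OF Suc.prems(1)] Ck_on_pred[OF Suc.prems(2)] | assumption)+
qed

lemmas Ck_on_mult = Ck_on_bilinear[OF _ bounded_bilinear_mult]
  and Ck_on_scaleR = Ck_on_bilinear[OF _ bounded_bilinear_scaleR]

lemma Ck_on_Pair:
  assumes "open S" "Ck_on k f S" "Ck_on k g S"
  shows "Ck_on k (\<lambda>x. (f x, g x)) S"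
  using assms(2,3)
proof (induction k arbitrary: f g)
  case 0
  then show ?case unfolding Ck_on.simps by (rule continuous_on_Pair)
next
  case (Suc k)
  show ?case
    by (rule Ck_on_SucI[where f' = "\<lambda>x v. (frechet_derivative f (at x) v, frechet_derivative g (at x) v)"])
      (rule assms(1) has_derivative_Pair Suc.IH Ck_on_SucD[OF assms(1) Suc.prems(1)]
        Ck_on_SucD[OF assms(1) Suc.prems(2)] | assumption)+
qed

text \<open>\<open>Ck_on\<close> controls derivatives in fixed directions only. The expansion trades
  a direction that varies with the point for scalar coefficients and fixed directions, as the chain
  rule requires.\<close>

lemma frechet_derivative_basis:
  fixes f :: "'a::euclidean_space \<Rightarrow> 'b::real_normed_vector"
  assumes "f differentiable (at x)"
  shows "frechet_derivative f (at x) w = (\<Sum>b\<in>Basis. (w \<bullet> b) *\<^sub>R frechet_derivative f (at x) b)"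
proof -
  interpret linear "frechet_derivative f (at x)"
    by (rule linear_frechet_derivative[OF assms])
  show ?thesis
    by (subst euclidean_representation[of w, symmetric]) (simp only: sum scale)
qed

text \<open>Only \<open>f\<close> is generalised in the induction: the chain rule produces
  derivatives of \<open>f\<close> composed with the same \<open>g\<close>, times coordinates of the
  derivative of \<open>g\<close>.\<close>

lemma Ck_on_compose:
  fixes f :: "'b::euclidean_space \<Rightarrow> 'c::real_normed_vector" and g :: "'a::euclidean_space \<Rightarrow> 'b"
  assumes "open S" "open T" "\<And>x. x \<in> S \<Longrightarrow> g x \<in> T" "Ck_on k f T" "Ck_on k g S"
  shows "Ck_on k (\<lambda>x. f (g x)) S"
  using assms(4,5)
proof (induction k arbitrary: f)
  case 0
  then show ?case using assms(3) by (auto intro: continuous_on_compose2)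
next
  case (Suc k)
  let ?D = "\<lambda>x v. \<Sum>b\<in>Basis. (frechet_derivative g (at x) v \<bullet> b) *\<^sub>R frechet_derivative f (at (g x)) b"
  show ?case
  proof (rule Ck_on_SucI[where f' = ?D])
    show "open S" by fact
    fix x assume x: "x \<in> S"
    have g: "(g has_derivative frechet_derivative g (at x)) (at x)"
      and f: "(f has_derivative frechet_derivative f (at (g x))) (at (g x))"
      using Ck_on_SucD(1)[OF assms(1) Suc.prems(2) x] Ck_on_SucD(1)[OF assms(2) Suc.prems(1) assms(3)[OF x]] .
    have "frechet_derivative f (at (g x)) (frechet_derivative g (at x) v) = ?D x v" for v
      by (rule frechet_derivative_basis) (rule differentiableI[OF f])
    then show "((\<lambda>x. f (g x)) has_derivative ?D x) (at x)"
      using has_derivative_compose[OF g f] by (simp only:)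
  next
    fix v
    have "Ck_on k (\<lambda>x. frechet_derivative f (at (g x)) b) S" for b
      by (rule Suc.IH) (rule Ck_on_SucD(2)[OF assms(2) Suc.prems(1)] Ck_on_pred[OF Suc.prems(2)])+
    moreover have "Ck_on k (\<lambda>x. frechet_derivative g (at x) v \<bullet> b) S" for b
      by (intro Ck_on_bounded_linear[OF assms(1) bounded_linear_inner_left] Ck_on_SucD[OF assms(1)] Suc.prems)
    ultimately show "Ck_on k (\<lambda>x. ?D x v) S"
      by (intro Ck_on_sum Ck_on_scaleR assms(1)) auto
  qed
qed

text \<open>The derivative of the inverse is a polynomial in the inverse, so each order gives the
  next.\<close>

lemma Ck_on_inverse: "Ck_on k (inverse :: real \<Rightarrow> real) (- {0})"
proof (induction k)
  case 0
  then show ?case by (auto intro!: continuous_intros)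
next
  case (Suc k)
  have o: "open (- {0::real})" by auto
  show ?case
    by (rule Ck_on_SucI[where f' = "\<lambda>x v. - (inverse x * v * inverse x)"])
      (simp_all only: o has_derivative_inverse' Ck_on_mult[OF o] Suc Ck_on_const ComplD
        Ck_on_bounded_linear[OF o bounded_linear_minus[OF bounded_linear_ident]] not_False_eq_True singleton_iff
        Compl_iff)
qed

text \<open>Repeated differentiation under the integral sign. \<open>W\<close> is an open set around
  the strip because the derivatives are two-sided even at the ends of the interval; convexity of
  \<open>U\<close> is what the Leibniz rule asks for.\<close>

lemma Ck_on_param_integral:
  fixes F :: "'a::euclidean_space \<times> real \<Rightarrow> real"
  assumes "open W" "open U" "convex U" "U \<times> {0..1} \<subseteq> W" "Ck_on k F W"
  shows "Ck_on k (\<lambda>x. integral {0..1} (\<lambda>t. F (x, t))) U"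
  using assms(5)
proof (induction k arbitrary: F)
  case 0
  have c: "continuous_on (U \<times> cbox 0 1) (\<lambda>(x, t). F (x, t))"
    unfolding case_prod_eta cbox_interval
    by (rule continuous_on_subset[OF Ck_on_imp_continuous_on[OF 0] assms(4)])
  show ?case using integral_continuous_on_param[OF c] unfolding Ck_on.simps cbox_interval .
next
  case (Suc k)
  let ?d = "\<lambda>x t v. frechet_derivative F (at (x, t)) (v, 0)"
  \<comment> \<open>The Leibniz rule wants the derivative as a continuous family of bounded linear
    operators; its continuity is checked on basis vectors.\<close>
  let ?fx = "\<lambda>x t. Blinfun (?d x t)"
  have D: "(F has_derivative frechet_derivative F (at (x, t))) (at (x, t))" if "x \<in> U" "t \<in> cbox 0 1" for x t
    by (rule Ck_on_SucD[OF assms(1) Suc.prems]) (use that assms(4) in auto)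
  have Dp: "((\<lambda>x. F (x, t)) has_derivative ?d x t) (at x)" if "x \<in> U" "t \<in> cbox 0 1" for x t
    by (rule has_derivative_compose[OF has_derivative_Pair[OF has_derivative_ident has_derivative_const] D[OF that]])
  then have bl: "bounded_linear (?d x t)" if "x \<in> U" "t \<in> cbox 0 1" for x t
    using that has_derivative_bounded_linear by blast
  have cont: "continuous_on (U \<times> cbox 0 1) (\<lambda>(x, t). ?d x t v)" for v
    using continuous_on_subset[OF Ck_on_imp_continuous_on
        [OF Ck_on_SucD(2)[OF assms(1) Suc.prems, of "(v, 0)"]] assms(4)]
    by (simp add: case_prod_unfold)
  have contb: "continuous_on (U \<times> cbox 0 1) (\<lambda>(x, t). ?fx x t)"
  proof (rule continuous_on_blinfun_componentwise)
    fix i :: 'a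
    show "continuous_on (U \<times> cbox 0 1) (\<lambda>xt. blinfun_apply (case xt of (x, t) \<Rightarrow> ?fx x t) i)"
    proof (rule continuous_on_cong[THEN iffD1, OF refl _ cont[of i]])
      fix z assume "z \<in> U \<times> cbox (0::real) 1"
      then show "(case z of (x, t) \<Rightarrow> ?d x t i) = blinfun_apply (case z of (x, t) \<Rightarrow> ?fx x t) i"
        by (auto simp: bounded_linear_Blinfun_apply[OF bl])
    qed
  qed
  have cF: "continuous_on (U \<times> cbox 0 1) (\<lambda>(x, t). F (x, t))"
    unfolding case_prod_eta cbox_interval
    by (rule continuous_on_subset[OF Ck_on_imp_continuous_on[OF Suc.prems] assms(4)])
  have int: "h x integrable_on cbox 0 1"
    if "continuous_on (U \<times> cbox 0 1) (\<lambda>(x, t). h x t)" "x \<in> U" for x and h :: "'a \<Rightarrow> real \<Rightarrow> 'd::banach"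
  proof (rule integrable_continuous)
    have "continuous_on (cbox 0 1) (\<lambda>t. case (x, t) of (x, t) \<Rightarrow> h x t)"
      by (rule continuous_on_compose2[OF that(1), where f = "\<lambda>t. (x, t)"])
        (use that(2) in \<open>auto intro: continuous_on_Pair continuous_on_const continuous_on_id\<close>)
    then show "continuous_on (cbox 0 1) (h x)" by simp
  qed
  show ?case
  proof (rule Ck_on_SucI[where f' = "\<lambda>x v. integral {0..1} (\<lambda>t. ?d x t v)"])
    show "open U" by fact
    fix x assume x: "x \<in> U"
    have D': "((\<lambda>x. integral (cbox 0 1) (\<lambda>t. F (x, t))) has_derivative integral (cbox 0 1) (?fx x)) (at x within U)"
    proof (rule leibniz_rule[OF _ _ contb x assms(3)])
      show "((\<lambda>x. F (x, t)) has_derivative blinfun_apply (?fx x t)) (at x within U)"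
        if "x \<in> U" "t \<in> cbox 0 1" for x t
        using has_derivative_at_withinI[OF Dp[OF that]] bounded_linear_Blinfun_apply[OF bl[OF that]] by simp
      show "(\<lambda>t. F (x, t)) integrable_on cbox 0 1" if "x \<in> U" for x
        by (rule int[OF cF that])
    qed
    have bf: "blinfun_apply (integral (cbox 0 1) (?fx x)) = (\<lambda>v. integral (cbox 0 1) (\<lambda>t. ?d x t v))"
    proof
      fix v
      have "?fx x integrable_on cbox 0 1"
        by (rule int[OF contb x])
      from blinfun_apply_integral[OF this, of v]
      show "blinfun_apply (integral (cbox 0 1) (?fx x)) v = integral (cbox 0 1) (\<lambda>t. ?d x t v)"
        by (rule trans) (rule integral_cong, rule fun_cong[OF bounded_linear_Blinfun_apply], rule bl[OF x])
    qed
    show "((\<lambda>x. integral {0..1} (\<lambda>t. F (x, t))) has_derivative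
        (\<lambda>v. integral {0..1} (\<lambda>t. ?d x t v))) (at x)"
      using D' unfolding bf at_within_open[OF x assms(2)] by simp
  next
    fix v
    show "Ck_on k (\<lambda>x. integral {0..1} (\<lambda>t. ?d x t v)) U"
      by (rule Suc.IH[OF Ck_on_SucD(2)[OF assms(1) Suc.prems]])
  qed
qed

lemma smooth_onD: "smooth_on S f \<Longrightarrow> Ck_on k f S"
  by (simp add: smooth_on_def)

lemma smooth_on_has_derivative:
  assumes "open S" "smooth_on S f" "x \<in> S"
  shows "(f has_derivative frechet_derivative f (at x)) (at x)"
  by (rule Ck_on_SucD(1)[OF assms(1) smooth_onD[OF assms(2)] assms(3)])

lemma smooth_on_frechet_derivative:
  assumes "open S" "smooth_on S f"
  shows "smooth_on S (\<lambda>x. frechet_derivative f (at x) v)"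
  unfolding smooth_on_def using Ck_on_SucD(2)[OF assms(1) smooth_onD[OF assms(2)]] by blast

lemma smooth_on_cong:
  assumes "open S" "\<And>x. x \<in> S \<Longrightarrow> f x = g x"
  shows "smooth_on S f \<longleftrightarrow> smooth_on S g"
  by (simp add: smooth_on_def Ck_on_cong[OF assms(1), of f g] assms(2))

lemma smooth_on_imp_continuous_on: "smooth_on S f \<Longrightarrow> continuous_on S f"
  using Ck_on_imp_continuous_on smooth_onD by blast

lemma smooth_on_subset: "smooth_on S f \<Longrightarrow> T \<subseteq> S \<Longrightarrow> smooth_on T f"
  unfolding smooth_on_def using Ck_on_subset by blast

lemma smooth_on_local:
  assumes "open S" "\<And>x. x \<in> S \<Longrightarrow> \<exists>T. open T \<and> x \<in> T \<and> smooth_on T f"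
  shows "smooth_on S f"
  unfolding smooth_on_def
proof (intro allI Ck_on_local[OF assms(1)])
  show "\<exists>T. open T \<and> x \<in> T \<and> Ck_on k f T" if "x \<in> S" for x k
    using assms(2)[OF that] smooth_onD by blast
qed

lemma smooth_on_const [simp]: "smooth_on S (\<lambda>x. c)"
  by (simp add: smooth_on_def)

lemma smooth_on_bounded_linear_self: "bounded_linear L \<Longrightarrow> smooth_on S L"
  by (simp add: smooth_on_def Ck_on_bounded_linear_self)

lemmas smooth_on_ident = smooth_on_bounded_linear_self[OF bounded_linear_ident]
  and smooth_on_fst = smooth_on_bounded_linear_self[OF bounded_linear_fst]
  and smooth_on_snd = smooth_on_bounded_linear_self[OF bounded_linear_snd]

lemma smooth_on_add: "open S \<Longrightarrow> smooth_on S f \<Longrightarrow> smooth_on S g \<Longrightarrow> smooth_on S (\<lambda>x. f x + g x)"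
  by (simp add: smooth_on_def Ck_on_add)

lemma smooth_on_sum:
  "open S \<Longrightarrow> (\<And>i. i \<in> I \<Longrightarrow> smooth_on S (f i)) \<Longrightarrow> smooth_on S (\<lambda>x. \<Sum>i\<in>I. f i x)"
  by (simp add: smooth_on_def Ck_on_sum)

lemma smooth_on_bilinear:
  "open S \<Longrightarrow> bounded_bilinear pr \<Longrightarrow> smooth_on S f \<Longrightarrow> smooth_on S g \<Longrightarrow> smooth_on S (\<lambda>x. pr (f x) (g x))"
  by (simp add: smooth_on_def Ck_on_bilinear)

lemmas smooth_on_mult = smooth_on_bilinear[OF _ bounded_bilinear_mult]
  and smooth_on_scaleR = smooth_on_bilinear[OF _ bounded_bilinear_scaleR]
  and smooth_on_inner = smooth_on_bilinear[OF _ bounded_bilinear_inner]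

lemma smooth_on_minus:
  assumes "open S" "smooth_on S f"
  shows "smooth_on S (\<lambda>x. - f x)"
  using smooth_on_scaleR[OF assms(1) smooth_on_const assms(2), of "-1"] by simp

lemma smooth_on_diff:
  assumes "open S" "smooth_on S f" "smooth_on S g"
  shows "smooth_on S (\<lambda>x. f x - g x)"
  using smooth_on_add[OF assms(1,2) smooth_on_minus[OF assms(1,3)]] by simp

lemma smooth_on_Pair:
  "open S \<Longrightarrow> smooth_on S f \<Longrightarrow> smooth_on S g \<Longrightarrow> smooth_on S (\<lambda>x. (f x, g x))"
  by (simp add: smooth_on_def Ck_on_Pair)

lemma smooth_on_compose:
  assumes "open S" "open T" "smooth_on T f" "smooth_on S g" "\<And>x. x \<in> S \<Longrightarrow> g x \<in> T"
  shows "smooth_on S (\<lambda>x. f (g x))"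
  unfolding smooth_on_def
proof
  show "Ck_on k (\<lambda>x. f (g x)) S" for k
    by (rule Ck_on_compose[OF assms(1,2,5)]) (use assms smooth_onD in auto)
qed

lemma smooth_on_inverse:
  fixes f :: "'a::euclidean_space \<Rightarrow> real"
  assumes "open S" "smooth_on S f" "\<And>x. x \<in> S \<Longrightarrow> f x \<noteq> 0"
  shows "smooth_on S (\<lambda>x. inverse (f x))"
proof (rule smooth_on_compose[of S "- {0}" inverse f])
  show "smooth_on (- {0}) (inverse :: real \<Rightarrow> real)"
    unfolding smooth_on_def using Ck_on_inverse by blast
qed (use assms in auto)

section \<open>Bump functions and Hadamard's lemma\<close>

text \<open>\<open>flat 0\<close> is the classical exp(-1/t). Its derivatives are combinations of
  the functions with higher \<open>n\<close>, so the family is closed under differentiation and one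
  induction proves all of them smooth.\<close>

definition flat :: "nat \<Rightarrow> real \<Rightarrow> real" where
  "flat n t = (if t > 0 then inverse t ^ n * exp (- inverse t) else 0)"

text \<open>From the right, s = 1/t turns the claim into the decay of s^n / exp s at infinity; from
  the left the function is 0.\<close>

lemma flat_tendsto_0: "(flat n \<longlongrightarrow> 0) (at 0)"
proof -
  have "((\<lambda>s. s ^ n / exp s) \<longlongrightarrow> 0) (at_top :: real filter)"
    by (rule tendsto_power_div_exp_0)
  then have "((\<lambda>t. inverse t ^ n / exp (inverse t)) \<longlongrightarrow> (0::real)) (at_right 0)"
    by (rule filterlim_compose) (rule filterlim_inverse_at_top_right)
  then have "(flat n \<longlongrightarrow> 0) (at_right 0)"
    by (rule Lim_transform_eventually)
      (auto simp: eventually_at_right_less flat_def exp_minus divide_inverse intro: eventually_mono[OF eventually_at_right_less])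
  moreover have "(flat n \<longlongrightarrow> 0) (at_left 0)"
    by (rule Lim_transform_eventually[OF tendsto_const])
      (auto simp: flat_def eventually_at_filter)
  ultimately show ?thesis by (simp add: filterlim_at_split)
qed

text \<open>At 0 the difference quotient of \<open>flat n\<close> is \<open>flat (n + 1)\<close>
  itself, so the derivative there is the limit just computed.\<close>

lemma flat_has_derivative:
  "(flat n has_real_derivative flat (n + 2) t - real n * flat (n + 1) t) (at t)"
proof (cases "t = 0")
  case True
  have "flat n h / h = flat (n + 1) h" for h
    by (simp add: flat_def divide_inverse)
  then have "((\<lambda>h. (flat n (0 + h) - flat n 0) / h) \<longlongrightarrow> 0) (at 0)"
    using flat_tendsto_0[of "n + 1"] by (simp add: flat_def[of n 0])
  then show ?thesis unfolding True DERIV_def by (simp add: flat_def[of _ 0])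
next
  case False
  show ?thesis
  proof (cases "t > 0")
    case True
    \<comment> \<open>For n = 0 the exponent \<open>n - 1\<close> is truncated to 0, harmlessly,
      since the factor \<open>real n\<close> kills the term.\<close>
    have "((\<lambda>t. inverse t ^ n * exp (- inverse t)) has_real_derivative
        inverse t ^ n * (exp (- inverse t) * inverse t ^ 2) -
        real n * (inverse t ^ (n - 1) * inverse t ^ 2) * exp (- inverse t)) (at t)"
      using True by (auto intro!: derivative_eq_intros simp: power2_eq_square algebra_simps)
    moreover have "inverse t ^ n * (exp (- inverse t) * inverse t ^ 2) -
        real n * (inverse t ^ (n - 1) * inverse t ^ 2) * exp (- inverse t) =
        flat (n + 2) t - real n * flat (n + 1) t"
      using True by (cases n) (simp_all add: flat_def power2_eq_square algebra_simps)
    ultimately have "((\<lambda>t. inverse t ^ n * exp (- inverse t)) has_real_derivative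
        flat (n + 2) t - real n * flat (n + 1) t) (at t)"
      by (rule DERIV_cong)
    then show ?thesis
      by (rule has_field_derivative_transform_within_open[of _ _ _ "{0<..}"])
        (use True in \<open>auto simp: flat_def\<close>)
  next
    case f: False
    show ?thesis
      by (rule has_field_derivative_transform_within_open[of "\<lambda>_. 0" _ _ "{..<0}"])
        (use f False in \<open>auto simp: flat_def\<close>)
  qed
qed

lemma smooth_on_flat: "smooth_on UNIV (flat n)"
proof -
  have "Ck_on k (flat n) UNIV" for k
  proof (induction k arbitrary: n)
    case 0
    show ?case
      unfolding Ck_on.simps
      by (rule DERIV_continuous_on) (rule has_field_derivative_at_within[OF flat_has_derivative])
  next
    case (Suc k)
    show ?case
    proof (rule Ck_on_SucI[where f' = "\<lambda>t v. (flat (n + 2) t + (- real n) * flat (n + 1) t) * v"])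
      show "(flat n has_derivative (\<lambda>v. (flat (n + 2) t + (- real n) * flat (n + 1) t) * v)) (at t)" for t
        using flat_has_derivative[of n t] by (simp add: has_field_derivative_def)
      show "Ck_on k (\<lambda>t. (flat (n + 2) t + (- real n) * flat (n + 1) t) * v) UNIV" for v
        by (intro Ck_on_mult Ck_on_add Ck_on_const Suc open_UNIV)
    qed simp
  qed
  then show ?thesis by (simp add: smooth_on_def)
qed

text \<open>The function is \<open>flat 0\<close> of r^2 - |x - a|^2, which is smooth and positive
  exactly on the ball. Nonvanishing on the ball replaces the usual plateau because the bump will be
  divided out again.\<close>

lemma bump_exists:
  fixes a :: "'a::euclidean_space"
  obtains \<beta> :: "'a \<Rightarrow> real" where "smooth_on UNIV \<beta>" "\<And>x. x \<in> ball a r \<Longrightarrow> \<beta> x \<noteq> 0"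
    "\<And>x. x \<notin> ball a r \<Longrightarrow> \<beta> x = 0"
proof (cases "r > 0")
  case True
  let ?\<beta> = "\<lambda>x. flat 0 (r\<^sup>2 - (x - a) \<bullet> (x - a))"
  have s: "smooth_on UNIV ?\<beta>"
    by (rule smooth_on_compose[OF open_UNIV open_UNIV smooth_on_flat])
      (auto intro!: smooth_on_diff smooth_on_inner smooth_on_ident)
  have "r\<^sup>2 - (x - a) \<bullet> (x - a) > 0 \<longleftrightarrow> x \<in> ball a r" for x
  proof -
    have "(x - a) \<bullet> (x - a) = (dist a x)\<^sup>2"
      by (simp add: dist_norm power2_norm_eq_inner inner_diff_left inner_diff_right)
    then show ?thesis
      using True by (simp add: not_le[symmetric] power_mono_iff)
  qed
  then show ?thesis by (intro that[of ?\<beta>] s) (auto simp: flat_def)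
next
  case False
  then have "x \<notin> ball a r" for x using zero_le_dist[of a x] by (auto simp del: zero_le_dist)
  then show ?thesis by (intro that[of "\<lambda>_. 0"]) (simp_all del: mem_ball)
qed

text \<open>f(x) - f(q) is the integral of the derivative along the segment from q to x, which stays
  in the convex set; \<open>h b\<close> is the average of the b-th partial derivative over that
  segment.\<close>

lemma hadamard_lemma:
  fixes f :: "'a::euclidean_space \<Rightarrow> real"
  assumes "open U" "convex U" "smooth_on U f" "q \<in> U"
  obtains h where "\<And>b. smooth_on U (h b)" "\<And>b. h b q = frechet_derivative f (at q) b"
    "\<And>x. x \<in> U \<Longrightarrow> f x = f q + (\<Sum>b\<in>Basis. ((x - q) \<bullet> b) * h b x)"
proof
  let ?\<gamma> = "\<lambda>(x, t). q + t *\<^sub>R (x - q)"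
  let ?h = "\<lambda>b x. integral {0..1} (\<lambda>t. frechet_derivative f (at (?\<gamma> (x, t))) b)"
  \<comment> \<open>All (x, t) for which the point of the segment lies in \<open>U\<close>: an open
    set containing the strip over \<open>U\<close>, as \<open>Ck_on_param_integral\<close>
    requires.\<close>
  define W where "W = ?\<gamma> -` U"
  have W: "open W" unfolding W_def
    by (intro open_vimage assms(1)) (auto intro!: continuous_intros simp: case_prod_unfold)
  have \<gamma>: "smooth_on W ?\<gamma>"
    unfolding case_prod_unfold
    by (intro smooth_on_add smooth_on_scaleR smooth_on_diff smooth_on_fst smooth_on_snd smooth_on_const W)
  have inU: "q + t *\<^sub>R (x - q) \<in> U" if "x \<in> U" "0 \<le> t" "t \<le> 1" for x t
    using convexD_alt[OF assms(2,4) that(1) that(2,3)] by (simp add: algebra_simps)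
  show "smooth_on U (?h b)" for b
  proof -
    have F: "smooth_on W (\<lambda>z. frechet_derivative f (at (?\<gamma> z)) b)"
      by (rule smooth_on_compose[OF W assms(1) smooth_on_frechet_derivative[OF assms(1,3)] \<gamma>])
        (simp add: W_def)
    have "U \<times> {0..1} \<subseteq> W" using inU by (auto simp: W_def)
    then show ?thesis unfolding smooth_on_def
      using Ck_on_param_integral[OF W assms(1,2) _ smooth_onD[OF F]] by blast
  qed
  show "?h b q = frechet_derivative f (at q) b" for b
    by simp
  fix x assume x: "x \<in> U"
  let ?d = "\<lambda>t. frechet_derivative f (at (?\<gamma> (x, t)))"
  have D: "(f has_derivative ?d t) (at (?\<gamma> (x, t)))" if "0 \<le> t" "t \<le> 1" for t
    by (rule smooth_on_has_derivative[OF assms(1,3)]) (use inU[OF x that] in simp)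
  have "((\<lambda>t. f (?\<gamma> (x, t))) has_vector_derivative ?d t (x - q)) (at t within {0..1})"
    if "0 \<le> t" "t \<le> 1" for t
  proof -
    have "((\<lambda>t. ?\<gamma> (x, t)) has_vector_derivative (x - q)) (at t within {0..1})"
      by (auto intro!: derivative_eq_intros simp: has_vector_derivative_def)
    from vector_derivative_diff_chain_within[OF this, of f "?d t"] show ?thesis
      using has_derivative_at_withinI[OF D[OF that]] by (simp add: o_def)
  qed
  then have "((\<lambda>t. ?d t (x - q)) has_integral f (?\<gamma> (x, 1)) - f (?\<gamma> (x, 0))) {0..1}"
    by (intro fundamental_theorem_of_calculus) auto
  then have "f x - f q = integral {0..1} (\<lambda>t. ?d t (x - q))"
    by (simp add: integral_unique)
  also have "\<dots> = integral {0..1} (\<lambda>t. \<Sum>b\<in>Basis. ((x - q) \<bullet> b) * ?d t b)"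
  proof (rule integral_cong)
    show "?d t (x - q) = (\<Sum>b\<in>Basis. ((x - q) \<bullet> b) * ?d t b)" if "t \<in> {0..1}" for t
      using frechet_derivative_basis[OF differentiableI[OF D], of t "x - q"] that by simp
  qed
  also have "\<dots> = (\<Sum>b\<in>Basis. ((x - q) \<bullet> b) * ?h b x)"
  proof -
    have "(\<lambda>t. ?d t b) integrable_on {0..1}" for b
    proof (rule integrable_continuous_real)
      show "continuous_on {0..1} (\<lambda>t. ?d t b)"
        by (rule continuous_on_compose2[OF smooth_on_imp_continuous_on
              [OF smooth_on_frechet_derivative[OF assms(1,3), of b]], where f = "\<lambda>t. ?\<gamma> (x, t)"])
          (use inU[OF x] in \<open>auto intro!: continuous_intros\<close>)
    qed
    then have "(\<lambda>t. ((x - q) \<bullet> b) * ?d t b) integrable_on {0..1}" for b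
      using integrable_cmul[of "\<lambda>t. ?d t b" "{0..1}" "(x - q) \<bullet> b"] by simp
    then show ?thesis
      by (subst integral_sum) auto
  qed
  finally show "f x = f q + (\<Sum>b\<in>Basis. ((x - q) \<bullet> b) * ?h b x)" by simp
qed

section \<open>Vector fields as derivations\<close>

lemma chart_onD:
  assumes "chart_on U c"
  shows "open U" "open (c ` U)" "continuous_on U c" "continuous_on (c ` U) (inv_into U c)"
    "x \<in> U \<Longrightarrow> inv_into U c (c x) = x"
    "y \<in> c ` U \<Longrightarrow> inv_into U c y \<in> U" "y \<in> c ` U \<Longrightarrow> c (inv_into U c y) = y"
  using assms unfolding chart_on_def homeomorphism_def by (auto intro: inv_into_into f_inv_into_f)

lemma chart_on_open_image:
  assumes "chart_on U c" "open S"
  shows "open (c ` (U \<inter> S))"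
proof -
  have "c ` (U \<inter> S) = c ` U \<inter> inv_into U c -` S"
    using chart_onD(5,6,7)[OF assms(1)] by (auto simp: image_iff)
  then show ?thesis
    using continuous_open_preimage[OF chart_onD(4,2)[OF assms(1)] assms(2)] by simp
qed

lemma chart_on_open_preimage:
  assumes "chart_on U c" "open S"
  shows "open (U \<inter> c -` S)"
  by (rule continuous_open_preimage[OF chart_onD(3,1)[OF assms(1)] assms(2)])

locale smooth_manifold =
  fixes A :: "('g::{t2_space,second_countable_topology} set \<times> ('g \<Rightarrow> 'e::euclidean_space)) set"
  assumes smooth_atlas: "smooth_atlas A"
begin

lemma chart: "(U, c) \<in> A \<Longrightarrow> chart_on U c"
  using smooth_atlas by (auto simp: smooth_atlas_def)

lemmas chartD = chart_onD[OF chart]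

lemma chart_at: obtains U c where "(U, c) \<in> A" "p \<in> U"
  using smooth_atlas unfolding smooth_atlas_def by blast

lemma smooth_transition:
  "(U, c) \<in> A \<Longrightarrow> (V, d) \<in> A \<Longrightarrow> smooth_on (c ` (U \<inter> V)) (\<lambda>x. d (inv_into U c x))"
  using smooth_atlas by (force simp: smooth_atlas_def o_def)

lemma smooth_functions_iff:
  "f \<in> smooth_functions A \<longleftrightarrow> (\<forall>(U,c)\<in>A. smooth_on (c ` U) (\<lambda>x. f (inv_into U c x)))"
  by (simp add: smooth_functions_def o_def)

lemma smooth_functionsD:
  "f \<in> smooth_functions A \<Longrightarrow> (U, c) \<in> A \<Longrightarrow> smooth_on (c ` U) (\<lambda>x. f (inv_into U c x))"
  by (auto simp: smooth_functions_iff)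

lemma smooth_functionsI:
  assumes "\<And>U c. (U, c) \<in> A \<Longrightarrow> smooth_on (c ` U) (\<lambda>x. f (inv_into U c x))"
  shows "f \<in> smooth_functions A"
  using assms by (auto simp: smooth_functions_iff)

lemma smooth_const: "(\<lambda>_. k) \<in> smooth_functions A"
  by (rule smooth_functionsI) simp

lemma smooth_add:
  "f \<in> smooth_functions A \<Longrightarrow> h \<in> smooth_functions A \<Longrightarrow> (\<lambda>p. f p + h p) \<in> smooth_functions A"
  by (rule smooth_functionsI) (rule smooth_on_add[OF chartD(2) smooth_functionsD smooth_functionsD])

lemma smooth_mult:
  "f \<in> smooth_functions A \<Longrightarrow> h \<in> smooth_functions A \<Longrightarrow> (\<lambda>p. f p * h p) \<in> smooth_functions A"
  by (rule smooth_functionsI) (rule smooth_on_mult[OF chartD(2) smooth_functionsD smooth_functionsD])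

lemma smooth_sum:
  "(\<And>i. i \<in> I \<Longrightarrow> f i \<in> smooth_functions A) \<Longrightarrow> (\<lambda>p. \<Sum>i\<in>I. f i p) \<in> smooth_functions A"
  by (rule smooth_functionsI) (rule smooth_on_sum[OF chartD(2) smooth_functionsD])

lemma smooth_minus: "f \<in> smooth_functions A \<Longrightarrow> (\<lambda>p. - f p) \<in> smooth_functions A"
  by (rule smooth_functionsI) (rule smooth_on_minus[OF chartD(2) smooth_functionsD])

lemma smooth_diff:
  "f \<in> smooth_functions A \<Longrightarrow> h \<in> smooth_functions A \<Longrightarrow> (\<lambda>p. f p - h p) \<in> smooth_functions A"
  by (rule smooth_functionsI) (rule smooth_on_diff[OF chartD(2) smooth_functionsD smooth_functionsD])

lemma smooth_comb:
  assumes "f \<in> smooth_functions A" "h \<in> smooth_functions A"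
  shows "(\<lambda>p. r * f p + s * h p) \<in> smooth_functions A"
  by (intro smooth_add smooth_mult smooth_const assms)

text \<open>Near a point over \<open>W\<close> the function is \<open>h\<close> composed with a
  transition map. Near any other point it vanishes, because the image of the compact
  \<open>K\<close> is closed in a Hausdorff space and its complement is a neighbourhood.\<close>

lemma smooth_extension:
  assumes V: "(V, d) \<in> A" and W: "open W" "W \<subseteq> d ` V" and h: "smooth_on W h"
    and K: "compact K" "K \<subseteq> W" and zero: "\<And>y. y \<notin> K \<Longrightarrow> h y = 0"
  shows "(\<lambda>p. if p \<in> V then h (d p) else 0) \<in> smooth_functions A"
proof (rule smooth_functionsI)
  fix U c assume U: "(U, c) \<in> A"
  let ?f = "\<lambda>p. if p \<in> V then h (d p) else 0"
  let ?K = "inv_into V d ` K"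
  have "compact ?K"
    using K W by (intro compact_continuous_image continuous_on_subset[OF chartD(4)[OF V]]) auto
  then have clK: "closed ?K" by (rule compact_imp_closed)
  show "smooth_on (c ` U) (\<lambda>x. ?f (inv_into U c x))"
  proof (rule smooth_on_local[OF chartD(2)[OF U]])
    fix x assume x: "x \<in> c ` U"
    then have p: "inv_into U c x \<in> U" "c (inv_into U c x) = x" using chartD(6,7)[OF U] by auto
    let ?V = "V \<inter> d -` W"
    have oV: "open ?V" by (rule chart_on_open_preimage[OF chart[OF V] W(1)])
    show "\<exists>T. open T \<and> x \<in> T \<and> smooth_on T (\<lambda>x. ?f (inv_into U c x))"
    proof (cases "inv_into U c x \<in> ?V")
      case True
      let ?T = "c ` (U \<inter> ?V)"
      have oT: "open ?T" by (rule chart_on_open_image[OF chart[OF U] oV])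
      have inV: "inv_into U c y \<in> ?V" if "y \<in> ?T" for y
        using that chartD(5)[OF U] by auto
      have "smooth_on ?T (\<lambda>x. d (inv_into U c x))"
        by (rule smooth_on_subset[OF smooth_transition[OF U V]]) auto
      then have "smooth_on ?T (\<lambda>x. h (d (inv_into U c x)))"
        using inV by (intro smooth_on_compose[OF oT W(1) h]) auto
      then have "smooth_on ?T (\<lambda>x. ?f (inv_into U c x))"
        by (rule smooth_on_cong[OF oT, THEN iffD1, rotated]) (use inV in auto)
      moreover have "x \<in> ?T" using p True by (metis IntI imageI)
      ultimately show ?thesis using oT by blast
    next
      case False
      let ?T = "c ` (U \<inter> - ?K)"
      have oT: "open ?T" by (rule chart_on_open_image[OF chart[OF U]]) (use clK in auto)
      have "?f (inv_into U c y) = 0" if y: "y \<in> ?T" for y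
      proof (cases "inv_into U c y \<in> V")
        case True
        have "inv_into U c y \<notin> ?K" using y chartD(5)[OF U] by auto
        then have "d (inv_into U c y) \<notin> K" using chartD(5)[OF V True] by (metis imageI)
        then show ?thesis using zero by simp
      qed simp
      then have "smooth_on ?T (\<lambda>x. ?f (inv_into U c x))"
        using smooth_on_cong[OF oT, of "\<lambda>x. ?f (inv_into U c x)" "\<lambda>_. 0"] by simp
      moreover have "?K \<subseteq> ?V" using K W chartD(6,7)[OF V] by (auto simp: subset_iff)
      then have "x \<in> ?T" using p False by (metis ComplI IntI imageI subsetD)
      ultimately show ?thesis using oT by blast
    qed
  qed
qed

lemma vector_fieldsD:
  assumes "X \<in> vector_fields A"
  shows "f \<in> smooth_functions A \<Longrightarrow> X f \<in> smooth_functions A"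
    "f \<notin> smooth_functions A \<Longrightarrow> X f p = 0"
    "f \<in> smooth_functions A \<Longrightarrow> h \<in> smooth_functions A \<Longrightarrow>
       X (\<lambda>p. a * f p + b * h p) p = a * X f p + b * X h p"
    "f \<in> smooth_functions A \<Longrightarrow> h \<in> smooth_functions A \<Longrightarrow>
       X (\<lambda>p. f p * h p) p = f p * X h p + h p * X f p"
  using assms by (auto simp: vector_fields_def fun_eq_iff)

lemma vf_apply_add:
  assumes "X \<in> vector_fields A" "f \<in> smooth_functions A" "h \<in> smooth_functions A"
  shows "X (\<lambda>p. f p + h p) p = X f p + X h p"
  using vector_fieldsD(3)[OF assms, of 1 1] by simp

lemma vf_apply_scale:
  assumes "X \<in> vector_fields A" "f \<in> smooth_functions A"
  shows "X (\<lambda>p. a * f p) p = a * X f p"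
  using vector_fieldsD(3)[OF assms assms(2), of a 0] by simp

lemma vf_apply_diff:
  assumes "X \<in> vector_fields A" "f \<in> smooth_functions A" "h \<in> smooth_functions A"
  shows "X (\<lambda>p. f p - h p) p = X f p - X h p"
  using vector_fieldsD(3)[OF assms, of 1 "-1"] by simp

text \<open>The Leibniz rule for 1 = 1 * 1 gives X 1 = 2 X 1.\<close>

lemma vf_apply_const:
  assumes "X \<in> vector_fields A"
  shows "X (\<lambda>_. k) p = 0"
proof -
  have "X (\<lambda>_. 1) p = 0"
    using vector_fieldsD(4)[OF assms smooth_const smooth_const, of 1 1 p] by simp
  then show ?thesis using vf_apply_scale[OF assms smooth_const, of k 1 p] by simp
qed

lemma vf_apply_sum:
  assumes "X \<in> vector_fields A" "\<And>i. i \<in> I \<Longrightarrow> f i \<in> smooth_functions A"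
  shows "X (\<lambda>p. \<Sum>i\<in>I. f i p) p = (\<Sum>i\<in>I. X (f i) p)"
  using assms(2)
proof (induction I rule: infinite_finite_induct)
  case (insert i I)
  then show ?case using vf_apply_add[OF assms(1), of "f i" "\<lambda>p. \<Sum>i\<in>I. f i p" p] smooth_sum[of I f]
    by simp
qed (simp_all add: vf_apply_const[OF assms(1)])

text \<open>The obstacle is that \<open>X\<close> acts only on global functions, while coordinates
  and Hadamard factors live in a chart. All of them are multiplied by a bump, extended by 0, and the
  bump is divided out at the end. The coefficients do not depend on \<open>f\<close>; this is what
  later allows a parameter in \<open>f\<close>.\<close>

lemma vector_field_local:
  assumes X: "X \<in> vector_fields A" and V: "(V, d) \<in> A" and y0: "y0 \<in> d ` V"
  obtains T a where "open T" "y0 \<in> T" "T \<subseteq> d ` V" "\<And>b. smooth_on T (a b)"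
    "\<And>f y. f \<in> smooth_functions A \<Longrightarrow> y \<in> T \<Longrightarrow>
      X f (inv_into V d y) = (\<Sum>b\<in>Basis. a b y * frechet_derivative (\<lambda>y. f (inv_into V d y)) (at y) b)"
proof -
  obtain R where R: "R > 0" "cball y0 R \<subseteq> d ` V"
    using chartD(2)[OF V] y0 open_contains_cball by blast
  \<comment> \<open>The bump lives on the half-size ball, so its compact support lies inside the
    open ball on which the functions to be cut off are smooth.\<close>
  define r where "r = R / 2"
  obtain \<beta> :: "'e \<Rightarrow> real" where \<beta>: "smooth_on UNIV \<beta>" "\<And>x. x \<in> ball y0 r \<Longrightarrow> \<beta> x \<noteq> 0"
    "\<And>x. x \<notin> ball y0 r \<Longrightarrow> \<beta> x = 0"
    using bump_exists by blast
  let ?B = "ball y0 R" and ?T = "ball y0 r"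
  have TB: "?T \<subseteq> ?B" "?B \<subseteq> d ` V" "cball y0 r \<subseteq> ?B" "y0 \<in> ?T"
    using R by (auto simp: r_def)
  define ext where "ext h p = (if p \<in> V then h (d p) else 0 :: real)" for h p
  have ext: "ext (\<lambda>y. h y * \<beta> y) \<in> smooth_functions A" if "smooth_on ?B h" for h
    unfolding ext_def
    by (rule smooth_extension[OF V, of ?B _ "cball y0 r"])
      (use TB \<beta> that in \<open>auto intro: smooth_on_mult smooth_on_subset[OF \<beta>(1)]\<close>)
  define \<phi> where "\<phi> = ext (\<lambda>y. 1 * \<beta> y)"
  define Y where "Y b = ext (\<lambda>y. (y \<bullet> b) * \<beta> y)" for b
  have \<phi>: "\<phi> \<in> smooth_functions A" unfolding \<phi>_def by (rule ext) simp
  have Y: "Y b \<in> smooth_functions A" for b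
    unfolding Y_def by (rule ext) (rule smooth_on_bounded_linear_self[OF bounded_linear_inner_left])
  let ?p = "inv_into V d"
  \<comment> \<open>The Leibniz rule would give X(y_b \<beta>) = y_b X(\<beta>) + \<beta> X(y_b) if
    the coordinate y_b were a global function; this is the equation solved for X(y_b).\<close>
  let ?a = "\<lambda>b y. (X (Y b) (?p y) - (y \<bullet> b) * X \<phi> (?p y)) * inverse (\<beta> y)"
  show ?thesis
  proof (rule that[of ?T ?a])
    show "smooth_on ?T (?a b)" for b
    proof (intro smooth_on_mult smooth_on_diff smooth_on_inverse open_ball)
      have "smooth_on ?T (\<lambda>y. X f (?p y))" if "f \<in> smooth_functions A" for f
        by (rule smooth_on_subset[OF smooth_functionsD[OF vector_fieldsD(1)[OF X that] V] order_trans[OF TB(1,2)]])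
      from this[OF Y] this[OF \<phi>]
      show "smooth_on ?T (\<lambda>y. X (Y b) (?p y))" "smooth_on ?T (\<lambda>y. X \<phi> (?p y))" .
    qed (use \<beta> in \<open>auto intro: smooth_on_subset[OF \<beta>(1)] smooth_on_bounded_linear_self bounded_linear_inner_left\<close>)
    fix f q assume f: "f \<in> smooth_functions A" and q: "q \<in> ?T"
    let ?F = "\<lambda>y. f (?p y)"
    have FB: "smooth_on ?B ?F" by (rule smooth_on_subset[OF smooth_functionsD[OF f V] TB(2)])
    have qB: "q \<in> ?B" using q TB by blast
    obtain h where h: "\<And>b. smooth_on ?B (h b)"
      "\<And>b. h b q = frechet_derivative ?F (at q) b"
      "\<And>y. y \<in> ?B \<Longrightarrow> ?F y = ?F q + (\<Sum>b\<in>Basis. ((y - q) \<bullet> b) * h b y)"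
      using hadamard_lemma[OF open_ball convex_ball FB qB] by blast
    define H where "H b = ext (\<lambda>y. h b y * \<beta> y)" for b
    have H: "H b \<in> smooth_functions A" for b unfolding H_def by (rule ext[OF h(1)])
    have "q \<in> d ` V" using q TB by blast
    note pq = chartD(6)[OF V this] chartD(7)[OF V this]
    \<comment> \<open>Hadamard's expansion times the square of the bump: one bump makes y - q
      global, the other makes \<open>h\<close> global. Off the ball both sides are 0.\<close>
    have id: "\<phi> p * \<phi> p * f p = f (?p q) * (\<phi> p * \<phi> p) + (\<Sum>b\<in>Basis. (Y b p - (q \<bullet> b) * \<phi> p) * H b p)" for p
    proof (cases "p \<in> V \<and> d p \<in> ?T")
      case True
      then have "?p (d p) = p" "d p \<in> ?B" using chartD(5)[OF V] TB by auto
      then have "f p = f (?p q) + (\<Sum>b\<in>Basis. ((d p - q) \<bullet> b) * h b (d p))"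
        using h(3)[of "d p"] by simp
      then have "\<phi> p * \<phi> p * f p = \<phi> p * \<phi> p * (f (?p q) + (\<Sum>b\<in>Basis. ((d p - q) \<bullet> b) * h b (d p)))"
        by (rule arg_cong)
      also have "\<dots> = f (?p q) * (\<phi> p * \<phi> p) + (\<Sum>b\<in>Basis. \<phi> p * \<phi> p * (((d p - q) \<bullet> b) * h b (d p)))"
        by (simp only: distrib_left sum_distrib_left mult.commute[of "f (?p q)"])
      also have "(\<Sum>b\<in>Basis. \<phi> p * \<phi> p * (((d p - q) \<bullet> b) * h b (d p))) =
          (\<Sum>b\<in>Basis. (Y b p - (q \<bullet> b) * \<phi> p) * H b p)"
        using True by (intro sum.cong refl)
          (simp add: \<phi>_def Y_def H_def ext_def inner_diff_left left_diff_distrib right_diff_distrib mult_ac)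
      finally show ?thesis .
    next
      case False
      then have "\<phi> p = 0" "Y b p = 0" for b using \<beta>(3) by (auto simp: \<phi>_def Y_def ext_def)
      then show ?thesis by simp
    qed
    have \<phi>2: "(\<lambda>p. \<phi> p * \<phi> p) \<in> smooth_functions A" by (rule smooth_mult[OF \<phi> \<phi>])
    have Yq: "(\<lambda>p. Y b p - (q \<bullet> b) * \<phi> p) \<in> smooth_functions A" for b
      by (intro smooth_diff Y smooth_mult \<phi> smooth_const)
    have sumX: "X (\<lambda>p. \<Sum>b\<in>Basis. (Y b p - (q \<bullet> b) * \<phi> p) * H b p) (?p q) =
        (\<Sum>b\<in>Basis. X (\<lambda>p. (Y b p - (q \<bullet> b) * \<phi> p) * H b p) (?p q))"
      by (rule vf_apply_sum[OF X]) (intro smooth_mult Yq H)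
    have "X (\<lambda>p. \<phi> p * \<phi> p * f p) (?p q) =
        X (\<lambda>p. f (?p q) * (\<phi> p * \<phi> p) + (\<Sum>b\<in>Basis. (Y b p - (q \<bullet> b) * \<phi> p) * H b p)) (?p q)"
      by (simp only: id)
    also have "\<dots> = f (?p q) * X (\<lambda>p. \<phi> p * \<phi> p) (?p q) +
        (\<Sum>b\<in>Basis. X (\<lambda>p. (Y b p - (q \<bullet> b) * \<phi> p) * H b p) (?p q))"
      by (subst vf_apply_add[OF X])
        (auto intro!: smooth_mult smooth_const \<phi> smooth_sum Yq H simp: vf_apply_scale[OF X \<phi>2] sumX)
    also have "(\<Sum>b\<in>Basis. X (\<lambda>p. (Y b p - (q \<bullet> b) * \<phi> p) * H b p) (?p q)) =
        (\<Sum>b\<in>Basis. h b q * \<beta> q * (X (Y b) (?p q) - (q \<bullet> b) * X \<phi> (?p q)))"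
    proof (rule sum.cong[OF refl])
      fix b :: 'e
      have "X (\<lambda>p. Y b p - (q \<bullet> b) * \<phi> p) (?p q) = X (Y b) (?p q) - (q \<bullet> b) * X \<phi> (?p q)"
        by (subst vf_apply_diff[OF X Y]) (auto intro: smooth_mult \<phi> smooth_const simp: vf_apply_scale[OF X \<phi>])
      \<comment> \<open>The first factor vanishes at q, so only the term in which \<open>X\<close>
        differentiates it survives.\<close>
      moreover have "Y b (?p q) - (q \<bullet> b) * \<phi> (?p q) = 0" "H b (?p q) = h b q * \<beta> q"
        using pq by (simp_all add: Y_def \<phi>_def H_def ext_def)
      ultimately show "X (\<lambda>p. (Y b p - (q \<bullet> b) * \<phi> p) * H b p) (?p q) =
          h b q * \<beta> q * (X (Y b) (?p q) - (q \<bullet> b) * X \<phi> (?p q))"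
        using vector_fieldsD(4)[OF X Yq H, of b b "?p q"] by simp
    qed
    also have "X (\<lambda>p. \<phi> p * \<phi> p * f p) (?p q) =
        \<phi> (?p q) * \<phi> (?p q) * X f (?p q) + f (?p q) * X (\<lambda>p. \<phi> p * \<phi> p) (?p q)"
      by (rule vector_fieldsD(4)[OF X \<phi>2 f])
    finally have "\<phi> (?p q) * \<phi> (?p q) * X f (?p q) =
        (\<Sum>b\<in>Basis. h b q * \<beta> q * (X (Y b) (?p q) - (q \<bullet> b) * X \<phi> (?p q)))"
      by simp
    moreover have "\<phi> (?p q) = \<beta> q"
      using pq by (simp add: \<phi>_def ext_def)
    ultimately have "\<beta> q * \<beta> q * X f (?p q) =
        (\<Sum>b\<in>Basis. h b q * \<beta> q * (X (Y b) (?p q) - (q \<bullet> b) * X \<phi> (?p q)))"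
      by (simp only:)
    also have "\<dots> = \<beta> q * \<beta> q * (\<Sum>b\<in>Basis. ?a b q * h b q)"
      unfolding sum_distrib_left using \<beta>(2)[OF q] by (intro sum.cong refl) (simp add: field_simps)
    finally have "X f (?p q) = (\<Sum>b\<in>Basis. ?a b q * h b q)"
      using \<beta>(2)[OF q] by simp
    then show "X f (?p q) = (\<Sum>b\<in>Basis. ?a b q * frechet_derivative ?F (at q) b)"
      by (simp only: h(2))
  qed (use TB in auto)
qed

section \<open>Smooth functions of two points of the manifold\<close>

definition smooth2 :: "('g \<Rightarrow> 'g \<Rightarrow> real) \<Rightarrow> bool" where
  "smooth2 F \<longleftrightarrow> (\<forall>(U,c)\<in>A. \<forall>(V,d)\<in>A.
     smooth_on (c ` U \<times> d ` V) (\<lambda>z. F (inv_into U c (fst z)) (inv_into V d (snd z))))"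

lemma smooth2D:
  "smooth2 F \<Longrightarrow> (U, c) \<in> A \<Longrightarrow> (V, d) \<in> A \<Longrightarrow>
    smooth_on (c ` U \<times> d ` V) (\<lambda>z. F (inv_into U c (fst z)) (inv_into V d (snd z)))"
  unfolding smooth2_def by blast

lemma smooth2I:
  assumes "\<And>U c V d. (U, c) \<in> A \<Longrightarrow> (V, d) \<in> A \<Longrightarrow>
    smooth_on (c ` U \<times> d ` V) (\<lambda>z. F (inv_into U c (fst z)) (inv_into V d (snd z)))"
  shows "smooth2 F"
  unfolding smooth2_def using assms by blast

lemma open_chart_Times: "(U, c) \<in> A \<Longrightarrow> (V, d) \<in> A \<Longrightarrow> open (c ` U \<times> d ` V)"
  by (intro open_Times chartD)

lemma smooth2_left:
  assumes "smooth2 F"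
  shows "F a \<in> smooth_functions A"
proof (rule smooth_functionsI)
  fix V d assume V: "(V, d) \<in> A"
  obtain U c where U: "(U, c) \<in> A" "a \<in> U" by (rule chart_at)
  have "smooth_on (d ` V) (\<lambda>y. (\<lambda>z. F (inv_into U c (fst z)) (inv_into V d (snd z))) (c a, y))"
    using U by (intro smooth_on_compose[OF chartD(2)[OF V] open_chart_Times[OF U(1) V] smooth2D[OF assms U(1) V]]
        smooth_on_Pair chartD(2)[OF V] smooth_on_const smooth_on_ident) auto
  then show "smooth_on (d ` V) (\<lambda>y. F a (inv_into V d y))"
    using chartD(5)[OF U] by simp
qed

lemma smooth2_right:
  assumes "smooth2 F"
  shows "(\<lambda>a. F a b) \<in> smooth_functions A"
proof (rule smooth_functionsI)
  fix V d assume V: "(V, d) \<in> A"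
  obtain U c where U: "(U, c) \<in> A" "b \<in> U" by (rule chart_at)
  have "smooth_on (d ` V) (\<lambda>y. (\<lambda>z. F (inv_into V d (fst z)) (inv_into U c (snd z))) (y, c b))"
    using U by (intro smooth_on_compose[OF chartD(2)[OF V] open_chart_Times[OF V U(1)] smooth2D[OF assms V U(1)]]
        smooth_on_Pair chartD(2)[OF V] smooth_on_const smooth_on_ident) auto
  then show "smooth_on (d ` V) (\<lambda>y. F (inv_into V d y) b)"
    using chartD(5)[OF U] by simp
qed

lemma smooth2_diagonal:
  assumes "smooth2 F"
  shows "(\<lambda>a. F a a) \<in> smooth_functions A"
proof (rule smooth_functionsI)
  fix V d assume V: "(V, d) \<in> A"
  have "smooth_on (d ` V) (\<lambda>y. (\<lambda>z. F (inv_into V d (fst z)) (inv_into V d (snd z))) (y, y))"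
    by (intro smooth_on_compose[OF chartD(2)[OF V] open_chart_Times[OF V V] smooth2D[OF assms V V]]
        smooth_on_Pair chartD(2)[OF V] smooth_on_ident) auto
  then show "smooth_on (d ` V) (\<lambda>y. F (inv_into V d y) (inv_into V d y))" by simp
qed

text \<open>In a chart \<open>X\<close> is a sum of coefficients times partial derivatives. The
  coefficients depend on the second point alone and are the same for all \<open>F a\<close>, and a
  partial derivative in the second variable is the full derivative in the direction (0, b), hence
  jointly smooth.\<close>

lemma smooth2_vector_field:
  assumes X: "X \<in> vector_fields A" and F: "smooth2 F"
  shows "smooth2 (\<lambda>a. X (F a))"
proof (rule smooth2I)
  fix U c V d assume U: "(U, c) \<in> A" and V: "(V, d) \<in> A"
  let ?S = "c ` U \<times> d ` V"
  let ?F = "\<lambda>z. F (inv_into U c (fst z)) (inv_into V d (snd z))"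
  have oS: "open ?S" by (rule open_chart_Times[OF U V])
  show "smooth_on ?S (\<lambda>z. X (F (inv_into U c (fst z))) (inv_into V d (snd z)))"
  proof (rule smooth_on_local[OF oS])
    fix z assume z: "z \<in> ?S"
    then have "snd z \<in> d ` V" by auto
    from vector_field_local[OF X V this] obtain T a where T: "open T" "snd z \<in> T" "T \<subseteq> d ` V"
      "\<And>b. smooth_on T (a b)"
      "\<And>f y. f \<in> smooth_functions A \<Longrightarrow> y \<in> T \<Longrightarrow>
        X f (inv_into V d y) = (\<Sum>b\<in>Basis. a b y * frechet_derivative (\<lambda>y. f (inv_into V d y)) (at y) b)"
      by blast
    let ?T = "c ` U \<times> T"
    have oT: "open ?T" using T(1) chartD(2)[OF U] by (rule open_Times[rotated])
    have sub: "?T \<subseteq> ?S" using T by auto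
    have "X (F (inv_into U c (fst w))) (inv_into V d (snd w)) =
        (\<Sum>b\<in>Basis. a b (snd w) * frechet_derivative ?F (at w) (0, b))" if w: "w \<in> ?T" for w
    proof -
      obtain x y where xy: "w = (x, y)" "x \<in> c ` U" "y \<in> T" using w by auto
      have "(?F has_derivative frechet_derivative ?F (at (x, y))) (at (x, y))"
        by (rule smooth_on_has_derivative[OF oS smooth2D[OF F U V]]) (use xy T in auto)
      from has_derivative_compose[OF has_derivative_Pair[OF has_derivative_const has_derivative_ident] this]
      have "((\<lambda>y. F (inv_into U c x) (inv_into V d y)) has_derivative
          (\<lambda>v. frechet_derivative ?F (at (x, y)) (0, v))) (at y)" by simp
      from frechet_derivative_at[OF this]
      have "frechet_derivative (\<lambda>y. F (inv_into U c x) (inv_into V d y)) (at y) b =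
          frechet_derivative ?F (at (x, y)) (0, b)" for b
        by (metis (no_types, lifting))
      then show ?thesis
        using T(5)[OF smooth2_left[OF F, of "inv_into U c x"] xy(3)] xy by simp
    qed
    moreover have "smooth_on ?T (\<lambda>w. \<Sum>b\<in>Basis. a b (snd w) * frechet_derivative ?F (at w) (0, b))"
    proof (intro smooth_on_sum smooth_on_mult oT)
      show "smooth_on ?T (\<lambda>w. a b (snd w))" for b
        by (rule smooth_on_compose[OF oT T(1,4) smooth_on_snd]) auto
      show "smooth_on ?T (\<lambda>w. frechet_derivative ?F (at w) (0, b))" for b
        by (rule smooth_on_subset[OF smooth_on_frechet_derivative[OF oS smooth2D[OF F U V]] sub])
    qed
    ultimately have "smooth_on ?T (\<lambda>z. X (F (inv_into U c (fst z))) (inv_into V d (snd z)))"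
      by (subst smooth_on_cong[OF oT])
    then show "\<exists>T. open T \<and> z \<in> T \<and> smooth_on T (\<lambda>z. X (F (inv_into U c (fst z))) (inv_into V d (snd z)))"
      using oT z T(2) by (intro exI[of _ ?T]) auto
  qed
qed

end

section \<open>Smoothness of translations on the group\<close>

locale lie_group_manifold =
  fixes A :: "('g::{topological_group_add,t2_space,second_countable_topology} set
    \<times> ('g \<Rightarrow> 'e::euclidean_space)) set"
  assumes lie_group: "lie_group A"
begin

sublocale smooth_manifold A
  by unfold_locales (use lie_group in \<open>simp add: lie_group_def\<close>)

lemma smooth2_plus:
  assumes f: "f \<in> smooth_functions A"
  shows "smooth2 (\<lambda>a b. f (a + b))"
proof (rule smooth2I)
  fix U c V d assume U: "(U, c) \<in> A" and V: "(V, d) \<in> A"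
  let ?S = "c ` U \<times> d ` V"
  let ?m = "\<lambda>z. inv_into U c (fst z) + inv_into V d (snd z)"
  have oS: "open ?S" by (rule open_chart_Times[OF U V])
  show "smooth_on ?S (\<lambda>z. f (?m z))"
  proof (rule smooth_on_local[OF oS])
    fix z assume z: "z \<in> ?S"
    obtain W e where W: "(W, e) \<in> A" "?m z \<in> W" by (rule chart_at)
    let ?T = "?S \<inter> ?m -` W"
    have "continuous_on ?S ?m"
      by (intro continuous_on_add continuous_on_compose2[OF chartD(4)[OF U]]
          continuous_on_compose2[OF chartD(4)[OF V]] continuous_on_fst continuous_on_snd continuous_on_id) auto
    then have oT: "open ?T" by (rule continuous_open_preimage[OF _ oS chartD(1)[OF W(1)]])
    have "?T = {(x, y). x \<in> c ` U \<and> y \<in> d ` V \<and> inv_into U c x + inv_into V d y \<in> W}"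
      by auto
    moreover have "smooth_on {(x, y). x \<in> c ` U \<and> y \<in> d ` V \<and> inv_into U c x + inv_into V d y \<in> W}
        (\<lambda>(x, y). e (inv_into U c x + inv_into V d y))"
      using lie_group U V W(1) unfolding lie_group_def by blast
    ultimately have m: "smooth_on ?T (\<lambda>z. e (?m z))" by (simp add: case_prod_unfold)
    have "smooth_on ?T (\<lambda>z. f (inv_into W e (e (?m z))))"
      by (rule smooth_on_compose[OF oT chartD(2)[OF W(1)] smooth_functionsD[OF f W(1)] m]) auto
    then have "smooth_on ?T (\<lambda>z. f (?m z))"
      by (rule smooth_on_cong[OF oT, THEN iffD1, rotated]) (use chartD(5)[OF W(1)] in auto)
    then show "\<exists>T. open T \<and> z \<in> T \<and> smooth_on T (\<lambda>z. f (?m z))"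
      using oT z W by (intro exI[of _ ?T]) auto
  qed
qed

text \<open>Serves translates by - p in which the base point p itself varies, as in the smoothness
  of the Maurer-Cartan form.\<close>

lemma smooth2_uminus:
  assumes F: "smooth2 F"
  shows "smooth2 (\<lambda>a b. F (- a) b)"
proof (rule smooth2I)
  fix U c V d assume U: "(U, c) \<in> A" and V: "(V, d) \<in> A"
  let ?S = "c ` U \<times> d ` V"
  let ?F = "\<lambda>z. F (- inv_into U c (fst z)) (inv_into V d (snd z))"
  have oS: "open ?S" by (rule open_chart_Times[OF U V])
  show "smooth_on ?S ?F"
  proof (rule smooth_on_local[OF oS])
    fix z assume z: "z \<in> ?S"
    obtain W e where W: "(W, e) \<in> A" "- inv_into U c (fst z) \<in> W" by (rule chart_at)
    let ?W = "c ` U \<inter> (\<lambda>x. - inv_into U c x) -` W"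
    let ?T = "?W \<times> d ` V"
    have oW: "open ?W"
      by (rule continuous_open_preimage[OF continuous_on_minus[OF chartD(4)[OF U]] chartD(2)[OF U] chartD(1)[OF W(1)]])
    have oT: "open ?T" by (rule open_Times[OF oW chartD(2)[OF V]])
    have "?W = {x. x \<in> c ` U \<and> - inv_into U c x \<in> W}" by auto
    moreover have "smooth_on {x. x \<in> c ` U \<and> - inv_into U c x \<in> W} (\<lambda>x. e (- inv_into U c x))"
      using lie_group U W(1) unfolding lie_group_def by blast
    ultimately have "smooth_on ?W (\<lambda>x. e (- inv_into U c x))" by simp
    then have "smooth_on ?T (\<lambda>z. e (- inv_into U c (fst z)))"
      by (rule smooth_on_compose[OF oT oW _ smooth_on_fst]) auto
    then have "smooth_on ?T (\<lambda>z. (e (- inv_into U c (fst z)), snd z))"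
      by (rule smooth_on_Pair[OF oT _ smooth_on_snd])
    from smooth_on_compose[OF oT open_chart_Times[OF W(1) V] smooth2D[OF F W(1) V] this]
    have "smooth_on ?T (\<lambda>z. F (inv_into W e (e (- inv_into U c (fst z)))) (inv_into V d (snd z)))"
      by auto
    then have "smooth_on ?T ?F"
      by (rule smooth_on_cong[OF oT, THEN iffD1, rotated]) (use chartD(5)[OF W(1)] in auto)
    then show "\<exists>T. open T \<and> z \<in> T \<and> smooth_on T ?F"
      using oT z W by (intro exI[of _ ?T]) auto
  qed
qed

lemma smooth_translate:
  assumes "f \<in> smooth_functions A"
  shows "(\<lambda>p. f (a + p)) \<in> smooth_functions A"
  by (rule smooth2_left[OF smooth2_plus[OF assms]])

end

section \<open>The frame of left invariant fields\<close>

text \<open>A dual family is built inside \<open>E\<close> by adding one vector at a time, in the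
  manner of Gram-Schmidt. Only linear combinations of members of \<open>E\<close> are formed, so
  nothing leaves \<open>E\<close>.\<close>

lemma separating_functionals_dual:
  fixes E :: "('a::real_vector \<Rightarrow> real) set"
  assumes lin: "\<And>e. e \<in> E \<Longrightarrow> linear e"
    and comb: "\<And>e e' r s. e \<in> E \<Longrightarrow> e' \<in> E \<Longrightarrow> (\<lambda>x. r * e x + s * e' x) \<in> E"
    and sep: "\<And>x. x \<noteq> 0 \<Longrightarrow> \<exists>e\<in>E. e x \<noteq> 0"
    and B: "finite B" "independent B"
  shows "\<exists>\<epsilon>. \<forall>b\<in>B. \<epsilon> b \<in> E \<and> (\<forall>b'\<in>B. \<epsilon> b b' = (if b = b' then 1 else 0))"
  using B
proof (induction B rule: finite_induct)
  case (insert b B)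
  then have indep: "independent B" "b \<notin> span B" by (auto simp: independent_insert)
  then obtain \<epsilon> where \<epsilon>: "\<And>c. c \<in> B \<Longrightarrow> \<epsilon> c \<in> E"
    "\<And>c c'. c \<in> B \<Longrightarrow> c' \<in> B \<Longrightarrow> \<epsilon> c c' = (if c = c' then 1 else 0)"
    using insert.IH by blast
  \<comment> \<open>The part of b left after removing its components along \<open>B\<close>; it is
    nonzero by independence, so some member of \<open>E\<close> detects it.\<close>
  define z where "z = b - (\<Sum>c\<in>B. \<epsilon> c b *\<^sub>R c)"
  have "z \<noteq> 0"
  proof
    assume "z = 0"
    then have "b = (\<Sum>c\<in>B. \<epsilon> c b *\<^sub>R c)" by (simp add: z_def)
    then show False using indep(2) span_sum[of B "\<lambda>c. \<epsilon> c b *\<^sub>R c" B] span_scale span_base by metis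
  qed
  then obtain e where e: "e \<in> E" "e z \<noteq> 0" using sep by blast
  have E_sum: "(\<lambda>x. e x - (\<Sum>c\<in>C. e c * \<epsilon> c x)) \<in> E" if "finite C" "C \<subseteq> B" for C
    using that
  proof (induction C rule: finite_induct)
    case (insert c C)
    then have "(\<lambda>x. 1 * (e x - (\<Sum>c\<in>C. e c * \<epsilon> c x)) + (- e c) * \<epsilon> c x) \<in> E"
      using \<epsilon>(1) by (intro comb) auto
    then show ?case using insert.hyps by (simp add: algebra_simps)
  qed (use e in simp)
  \<comment> \<open>Corrected so as to vanish on \<open>B\<close>; its value at b is then e(z),
    which is nonzero.\<close>
  define e1 where "e1 = (\<lambda>x. e x - (\<Sum>c\<in>B. e c * \<epsilon> c x))"
  have e1: "e1 \<in> E" unfolding e1_def by (rule E_sum) (use insert.hyps in auto)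
  have e1_B: "e1 c' = 0" if "c' \<in> B" for c'
  proof -
    have "(\<Sum>c\<in>B. e c * \<epsilon> c c') = (\<Sum>c\<in>B. if c = c' then e c else 0)"
      using \<epsilon>(2) that by (intro sum.cong) auto
    then show ?thesis using that insert.hyps by (simp add: e1_def)
  qed
  have e1_b: "e1 b = e z"
    using lin[OF e(1)] by (simp add: e1_def z_def linear_diff linear_sum linear_scale mult.commute)
  \<comment> \<open>The normalisation e2(b) = 1; the summand with coefficient 0 only fits the shape
    of \<open>comb\<close>.\<close>
  define e2 where "e2 = (\<lambda>x. inverse (e z) * e1 x + 0 * e1 x)"
  have e2_E: "e2 \<in> E" unfolding e2_def by (rule comb[OF e1 e1])
  have e2: "e2 b = 1" "\<And>c. c \<in> B \<Longrightarrow> e2 c = 0"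
    using e1_B e1_b e by (simp_all add: e2_def)
  \<comment> \<open>The earlier functionals are modified by multiples of \<open>e2\<close> to vanish
    at b; on \<open>B\<close> they are unchanged, since \<open>e2\<close> is 0 there.\<close>
  define \<epsilon>' where "\<epsilon>' c = (if c = b then e2 else (\<lambda>x. 1 * \<epsilon> c x + (- \<epsilon> c b) * e2 x))" for c
  have "\<epsilon>' c \<in> E" if "c \<in> insert b B" for c
  proof (cases "c = b")
    case False
    then show ?thesis using that comb[OF \<epsilon>(1) e2_E, of c 1 "- \<epsilon> c b"] by (simp only: \<epsilon>'_def if_False) blast
  qed (simp add: \<epsilon>'_def e2_E)
  moreover have "\<epsilon>' c c' = (if c = c' then 1 else 0)" if "c \<in> insert b B" "c' \<in> insert b B" for c c'
    using that e2 \<epsilon>(2) insert.hyps by (auto simp: \<epsilon>'_def)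
  ultimately show ?case by blast
qed simp

text \<open>In finite dimension a subspace of the dual that separates points is the whole dual. Used
  twice: for the functionals \<open>\<iota> x f 0\<close> with \<open>f\<close> smooth, and for the
  functionals \<open>g x\<close>, where it is the Riesz theorem.\<close>

lemma separating_functionals_full:
  fixes E :: "('a::real_vector \<Rightarrow> real) set" and B :: "'a set"
  assumes "\<And>e. e \<in> E \<Longrightarrow> linear e"
    and comb: "\<And>e e' r s. e \<in> E \<Longrightarrow> e' \<in> E \<Longrightarrow> (\<lambda>x. r * e x + s * e' x) \<in> E"
    and "\<And>x. x \<noteq> 0 \<Longrightarrow> \<exists>e\<in>E. e x \<noteq> 0" and E0: "(\<lambda>_. 0) \<in> E"
    and B: "finite B" "independent B" "span B = UNIV"
    and l: "linear l"
  shows "l \<in> E"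
proof -
  obtain \<epsilon> where \<epsilon>: "\<And>c. c \<in> B \<Longrightarrow> \<epsilon> c \<in> E"
    "\<And>c c'. c \<in> B \<Longrightarrow> c' \<in> B \<Longrightarrow> \<epsilon> c c' = (if c = c' then 1 else 0)"
    using separating_functionals_dual[OF assms(1-3) B(1,2)] by blast
  have E_sum: "(\<lambda>x. \<Sum>c\<in>C. l c * \<epsilon> c x) \<in> E" if "finite C" "C \<subseteq> B" for C
    using that
  proof (induction C rule: finite_induct)
    case (insert c C)
    then have "(\<lambda>x. l c * \<epsilon> c x + 1 * (\<Sum>c\<in>C. l c * \<epsilon> c x)) \<in> E"
      using \<epsilon>(1) by (intro comb) auto
    then show ?case using insert.hyps by simp
  qed (use E0 in simp)
  let ?l = "\<lambda>x. \<Sum>c\<in>B. l c * \<epsilon> c x"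
  have lE: "?l \<in> E" by (rule E_sum) (use B in auto)
  have "l x = ?l x" for x
  proof (rule linear_eq_on[OF l assms(1)[OF lE]])
    show "x \<in> span B" using B by simp
    fix b assume b: "b \<in> B"
    have "(\<Sum>c\<in>B. l c * \<epsilon> c b) = (\<Sum>c\<in>B. if c = b then l c else 0)"
      using \<epsilon>(2) b by (intro sum.cong) auto
    then show "l b = (\<Sum>c\<in>B. l c * \<epsilon> c b)" using b B by simp
  qed
  then have "l = ?l" by (rule ext)
  show ?thesis by (subst \<open>l = ?l\<close>) (rule lE)
qed

text \<open>The inverse of the Maurer-Cartan form; see \<open>mc_fld\<close> and
  \<open>fld_mc\<close>.\<close>

definition vf_of_map :: "('a \<Rightarrow> 'g vfield) \<Rightarrow> ('g \<Rightarrow> 'a) \<Rightarrow> 'g vfield" where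
  "vf_of_map \<iota> m = (\<lambda>f p. \<iota> (m p) f p)"

locale lie_group_frame = lie_group_manifold A
  for A :: "('g::{topological_group_add,t2_space,second_countable_topology} set
    \<times> ('g \<Rightarrow> 'e::euclidean_space)) set" +
  fixes br :: "'a::real_vector \<Rightarrow> 'a \<Rightarrow> 'a" and \<iota> :: "'a \<Rightarrow> 'g vfield" and B :: "'a set"
  assumes lie_algebra_of_group: "lie_algebra_of_group A br \<iota>"
    and finite_B: "finite B" and independent_B: "independent B" and span_B: "span B = UNIV"
begin

abbreviation "mc \<equiv> maurer_cartan A \<iota>"

lemma \<iota>_left_invariant: "\<iota> x \<in> left_invariant_fields A"
  using lie_algebra_of_group unfolding lie_algebra_of_group_def bij_betw_def by blast

lemma \<iota>_vf: "\<iota> x \<in> vector_fields A"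
  using \<iota>_left_invariant by (simp add: left_invariant_fields_def)

lemma \<iota>_translate: "f \<in> smooth_functions A \<Longrightarrow> \<iota> x (\<lambda>p. f (a + p)) p = \<iota> x f (a + p)"
  using \<iota>_left_invariant[of x] by (simp add: left_invariant_fields_def)

lemma \<iota>_comb: "\<iota> (a *\<^sub>R x + b *\<^sub>R y) f p = a * \<iota> x f p + b * \<iota> y f p"
  using lie_algebra_of_group by (simp add: lie_algebra_of_group_def vf_add_def vf_mult_def)

lemma \<iota>_bracket: "\<iota> (br x y) f p = \<iota> x (\<iota> y f) p - \<iota> y (\<iota> x f) p"
  using lie_algebra_of_group by (simp add: lie_algebra_of_group_def vf_bracket_def)

lemma linear_\<iota>: "linear (\<lambda>x. \<iota> x f p)"
  by (rule linearI) (use \<iota>_comb[of 1 _ 1] \<iota>_comb[of _ _ 0] in simp_all)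

text \<open>Left translation by q - p carries the vanishing at p to every q; then injectivity of
  \<open>\<iota>\<close> applies.\<close>

lemma \<iota>_eq_0:
  assumes "\<And>f. f \<in> smooth_functions A \<Longrightarrow> \<iota> x f p = 0"
  shows "x = 0"
proof -
  have "\<iota> x f q = \<iota> 0 f q" for f q
  proof (cases "f \<in> smooth_functions A")
    case True
    have "\<iota> x f q = \<iota> x (\<lambda>r. f ((q - p) + r)) p"
      by (subst \<iota>_translate[OF True]) simp
    also have "\<dots> = 0" by (rule assms) (rule smooth_translate[OF True])
    finally show ?thesis using linear_0[OF linear_\<iota>] by simp
  qed (simp add: vector_fieldsD(2)[OF \<iota>_vf])
  then have "\<iota> x = \<iota> 0" by (intro ext)
  then show ?thesis
    using lie_algebra_of_group by (auto simp: lie_algebra_of_group_def bij_betw_def dest: injD)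
qed

lemma \<iota>_eqD:
  assumes "\<And>f. f \<in> smooth_functions A \<Longrightarrow> \<iota> x f p = \<iota> y f p"
  shows "x = y"
proof -
  have "x - y = 0"
    by (rule \<iota>_eq_0[of _ p]) (simp add: linear_diff[OF linear_\<iota>] assms)
  then show ?thesis by simp
qed

text \<open>This is the push-forward of \<open>X\<close> under left translation by - a, which moves
  the value of \<open>X\<close> at a to the identity.\<close>

lemma vector_field_translate:
  assumes X: "X \<in> vector_fields A"
  shows "(\<lambda>f q. if f \<in> smooth_functions A then X (\<lambda>r. f (- a + r)) (a + q) else 0) \<in> vector_fields A"
proof -
  have "(\<lambda>q. X (\<lambda>r. f (- a + r)) (a + q)) \<in> smooth_functions A" if "f \<in> smooth_functions A" for f
    by (rule smooth_translate[OF vector_fieldsD(1)[OF X smooth_translate[OF that]]])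
  moreover note smooth_comb
  moreover have "(\<lambda>p. f p * h p) \<in> smooth_functions A"
    if "f \<in> smooth_functions A" "h \<in> smooth_functions A" for f h
    using that by (rule smooth_mult)
  moreover have "- a + (a + q) = q" for q by (simp add: add.assoc[symmetric])
  ultimately show ?thesis
    unfolding vector_fields_def
    by (simp add: fun_eq_iff vector_fieldsD(3,4)[OF X smooth_translate smooth_translate])
qed

text \<open>The field \<open>Y\<close> consists of all left translates of one tangent vector at the
  identity. Its smoothness is that of Z (f (a + r)) as a function of a, with the second point frozen
  at 0. Being left invariant, \<open>Y\<close> is some \<open>\<iota> x\<close>, and at p it gives
  back \<open>X\<close>.\<close>

lemma left_invariant_extension:
  assumes X: "X \<in> vector_fields A"
  shows "\<exists>x. \<forall>f\<in>smooth_functions A. X f p = \<iota> x f p"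
proof -
  \<comment> \<open>The value of \<open>X\<close> at p is moved to the identity first, so that the
    translated functions are f (a + r), the case covered by \<open>smooth2_plus\<close>.\<close>
  define Z where "Z = (\<lambda>f q. if f \<in> smooth_functions A then X (\<lambda>r. f (- p + r)) (p + q) else 0)"
  have Z: "Z \<in> vector_fields A" unfolding Z_def by (rule vector_field_translate[OF X])
  define Y where "Y = (\<lambda>f a. if f \<in> smooth_functions A then Z (\<lambda>r. f (a + r)) 0 else 0)"
  have Y_eq: "Y f a = X (\<lambda>q. f (a + (- p + q))) p" if "f \<in> smooth_functions A" for f a
    using that smooth_translate[OF that, of a] by (simp add: Y_def Z_def)
  have "Y \<in> vector_fields A"
  proof -
    have "(\<lambda>a. Z (\<lambda>r. f (a + r)) 0) \<in> smooth_functions A" if "f \<in> smooth_functions A" for f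
      by (rule smooth2_right[OF smooth2_vector_field[OF Z smooth2_plus[OF that]]])
    moreover note smooth_comb
  moreover have "(\<lambda>p. f p * h p) \<in> smooth_functions A"
      if "f \<in> smooth_functions A" "h \<in> smooth_functions A" for f h
      using that by (rule smooth_mult)
    ultimately show ?thesis
      unfolding vector_fields_def Y_def
      by (simp add: fun_eq_iff vector_fieldsD(3,4)[OF Z smooth_translate smooth_translate])
  qed
  moreover have "Y (\<lambda>p. f (a + p)) q = Y f (a + q)" if "f \<in> smooth_functions A" for f a q
    by (simp add: Y_eq[OF that] Y_eq[OF smooth_translate[OF that]] add.assoc)
  ultimately have "Y \<in> left_invariant_fields A"
    by (simp add: left_invariant_fields_def fun_eq_iff)
  then have "Y \<in> range \<iota>"
    using lie_algebra_of_group by (simp add: lie_algebra_of_group_def bij_betw_def)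
  then obtain x where x: "Y = \<iota> x" by blast
  have "X f p = \<iota> x f p" if "f \<in> smooth_functions A" for f
    using Y_eq[OF that, of p] x by (simp add: add.assoc[symmetric])
  then show ?thesis by blast
qed

lemma mc_eqI:
  assumes "\<And>f. f \<in> smooth_functions A \<Longrightarrow> X f p = \<iota> x f p"
  shows "mc X p = x"
  unfolding maurer_cartan_def
proof (rule the_equality)
  show "\<forall>f\<in>smooth_functions A. X f p = \<iota> x f p" using assms by blast
  show "y = x" if "\<forall>f\<in>smooth_functions A. X f p = \<iota> y f p" for y
    by (rule \<iota>_eqD[of _ p]) (use that assms in simp)
qed

lemma vf_apply_mc:
  assumes "X \<in> vector_fields A"
  shows "X f p = \<iota> (mc X p) f p"
proof (cases "f \<in> smooth_functions A")
  case True
  obtain x where x: "\<forall>f\<in>smooth_functions A. X f p = \<iota> x f p"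
    using left_invariant_extension[OF assms] by blast
  then have "mc X p = x" by (intro mc_eqI) blast
  then show ?thesis using x True by simp
qed (simp add: vector_fieldsD(2)[OF \<iota>_vf] vector_fieldsD(2)[OF assms])

lemma vf_eqI:
  assumes "X \<in> vector_fields A" "Y \<in> vector_fields A" "\<And>p. mc X p = mc Y p"
  shows "X = Y"
  by (intro ext) (simp add: vf_apply_mc[OF assms(1)] vf_apply_mc[OF assms(2)] assms(3))

lemma mc_\<iota> [simp]: "mc (\<iota> x) p = x"
  by (rule mc_eqI) simp

lemma mc_vf_add:
  "X \<in> vector_fields A \<Longrightarrow> Y \<in> vector_fields A \<Longrightarrow> mc (vf_add X Y) p = mc X p + mc Y p"
  by (rule mc_eqI) (simp add: vf_add_def linear_add[OF linear_\<iota>] vf_apply_mc[symmetric])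

lemma mc_vf_diff:
  "X \<in> vector_fields A \<Longrightarrow> Y \<in> vector_fields A \<Longrightarrow> mc (vf_diff X Y) p = mc X p - mc Y p"
  by (rule mc_eqI) (simp add: vf_diff_def linear_diff[OF linear_\<iota>] vf_apply_mc[symmetric])

lemma mc_vf_mult: "X \<in> vector_fields A \<Longrightarrow> mc (vf_mult f X) p = f p *\<^sub>R mc X p"
  by (rule mc_eqI) (simp add: vf_mult_def linear_scale[OF linear_\<iota>] vf_apply_mc[symmetric])

text \<open>The type \<open>'a\<close> is a bare vector space without topology, so
  \<open>smooth_on\<close> does not apply to maps into it; all linear functionals together do the
  same service, independently of a basis.\<close>

definition smooth_map :: "('g \<Rightarrow> 'a) \<Rightarrow> bool" where
  "smooth_map m \<longleftrightarrow> (\<forall>l. linear l \<longrightarrow> (\<lambda>p. l (m p) :: real) \<in> smooth_functions A)"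

lemma smooth_mapD: "smooth_map m \<Longrightarrow> linear l \<Longrightarrow> (\<lambda>p. l (m p) :: real) \<in> smooth_functions A"
  by (simp add: smooth_map_def)

text \<open>Every functional is the evaluation at the identity of a smooth function \<open>f\<close>; its value on the
  Maurer-Cartan form at \<open>p\<close> is then obtained by letting \<open>X\<close> act on \<open>f\<close> translated to \<open>p\<close>.\<close>

lemma smooth_map_mc:
  assumes X: "X \<in> vector_fields A"
  shows "smooth_map (mc X)"
  unfolding smooth_map_def
proof (intro allI impI)
  fix l :: "'a \<Rightarrow> real" assume l: "linear l"
  let ?E = "(\<lambda>f x. \<iota> x f 0) ` smooth_functions A"
  have "l \<in> ?E"
  proof (rule separating_functionals_full[OF _ _ _ _ finite_B independent_B span_B l])
    show "linear e" if "e \<in> ?E" for e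
      using that linear_\<iota> by auto
    show "\<exists>e\<in>?E. e x \<noteq> 0" if "x \<noteq> 0" for x
      using \<iota>_eq_0[of x 0] that by auto
    show "(\<lambda>x. r * e x + s * e' x) \<in> ?E" if "e \<in> ?E" "e' \<in> ?E" for e e' r s
    proof -
      from that(1) obtain f where f: "f \<in> smooth_functions A" "e = (\<lambda>x. \<iota> x f 0)" by (rule imageE)
      from that(2) obtain h where h: "h \<in> smooth_functions A" "e' = (\<lambda>x. \<iota> x h 0)" by (rule imageE)
      note fh = f(1) h(1) f(2) h(2)
      show ?thesis
      proof (rule image_eqI)
        show "(\<lambda>x. r * e x + s * e' x) = (\<lambda>x. \<iota> x (\<lambda>p. r * f p + s * h p) 0)"
          using fh by (simp add: fun_eq_iff vector_fieldsD(3)[OF \<iota>_vf])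
        show "(\<lambda>p. r * f p + s * h p) \<in> smooth_functions A"
          by (rule smooth_comb[OF fh(1,2)])
      qed
    qed
    show "(\<lambda>_. 0) \<in> ?E"
      by (rule image_eqI[OF _ smooth_const[of 0]]) (simp add: vf_apply_const[OF \<iota>_vf])
  qed
  then obtain f where f: "f \<in> smooth_functions A" "\<And>x. l x = \<iota> x f 0" by auto
  have "l (mc X p) = X (\<lambda>q. f (- p + q)) p" for p
    by (simp add: f(2) vf_apply_mc[OF X] \<iota>_translate[OF f(1)])
  moreover have "(\<lambda>p. X (\<lambda>q. f (- p + q)) p) \<in> smooth_functions A"
    by (rule smooth2_diagonal[OF smooth2_vector_field[OF X smooth2_uminus[OF smooth2_plus[OF f(1)]]]])
  ultimately show "(\<lambda>p. l (mc X p)) \<in> smooth_functions A" by simp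
qed

abbreviation co :: "'a \<Rightarrow> 'a \<Rightarrow> real" where
  "co b x \<equiv> representation B x b"

lemma linear_co: "linear (co b)"
  by (rule linearI)
    (simp_all add: real_vector.representation_add[OF independent_B] real_vector.representation_scale[OF independent_B] span_B)

lemma co_expand: "(\<Sum>b\<in>B. co b x *\<^sub>R b) = x"
  by (rule real_vector.sum_representation_eq[OF independent_B _ finite_B]) (simp_all add: span_B)

lemma linear_expand: "linear l \<Longrightarrow> l x = (\<Sum>b\<in>B. co b x *\<^sub>R l b)"
  using arg_cong[OF co_expand, of l x] by (simp add: linear_sum linear_scale)

lemma functional_eqI:
  fixes x y :: 'a
  assumes "\<And>l. linear l \<Longrightarrow> l x = (l y :: real)"
  shows "x = y"
proof -
  have "(\<Sum>b\<in>B. co b x *\<^sub>R b) = (\<Sum>b\<in>B. co b y *\<^sub>R b)"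
    by (simp only: assms[OF linear_co])
  then show ?thesis by (simp only: co_expand)
qed

abbreviation "fld \<equiv> vf_of_map \<iota>"

lemma fld_vf:
  assumes m: "smooth_map m"
  shows "fld m \<in> vector_fields A"
proof -
  have "fld m f = (\<lambda>p. \<Sum>b\<in>B. co b (m p) * \<iota> b f p)" for f
    using linear_expand[OF linear_\<iota>, where x = "m _"] by (intro ext) (simp only: vf_of_map_def real_scaleR_def)
  then have "fld m f \<in> smooth_functions A" if "f \<in> smooth_functions A" for f
    by (simp only:) (intro smooth_sum smooth_mult smooth_mapD[OF m linear_co] vector_fieldsD(1)[OF \<iota>_vf that])
  then show ?thesis
    by (simp add: vector_fields_def vf_of_map_def fun_eq_iff vector_fieldsD(2,3,4)[OF \<iota>_vf])
qed

lemma mc_fld [simp]: "mc (fld m) p = m p"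
  by (rule mc_eqI) (simp add: vf_of_map_def)

lemma fld_mc: "X \<in> vector_fields A \<Longrightarrow> fld (mc X) = X"
  by (intro ext) (simp add: vf_of_map_def vf_apply_mc[symmetric])

end

section \<open>Connections in the frame\<close>

context lie_group_frame begin

lemma vf_add_vf: "X \<in> vector_fields A \<Longrightarrow> Y \<in> vector_fields A \<Longrightarrow> vf_add X Y \<in> vector_fields A"
  and vf_diff_vf: "X \<in> vector_fields A \<Longrightarrow> Y \<in> vector_fields A \<Longrightarrow> vf_diff X Y \<in> vector_fields A"
  and vf_mult_vf: "f \<in> smooth_functions A \<Longrightarrow> X \<in> vector_fields A \<Longrightarrow> vf_mult f X \<in> vector_fields A"
proof -
  have eq: "vf_add X Y = fld (\<lambda>p. mc X p + mc Y p)" "vf_diff X Y = fld (\<lambda>p. mc X p - mc Y p)"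
    "vf_mult f X = fld (\<lambda>p. f p *\<^sub>R mc X p)"
    if "X \<in> vector_fields A" "Y \<in> vector_fields A" for X Y f
    using that by (auto intro!: ext simp: vf_add_def vf_diff_def vf_mult_def vf_of_map_def vf_apply_mc[symmetric]
        linear_add[OF linear_\<iota>] linear_diff[OF linear_\<iota>] linear_scale[OF linear_\<iota>])
  have sm: "(\<lambda>p. l (mc X p)) \<in> smooth_functions A" if "X \<in> vector_fields A" "linear l" for X and l :: "'a \<Rightarrow> real"
    by (rule smooth_mapD[OF smooth_map_mc[OF that(1)] that(2)])
  show "vf_add X Y \<in> vector_fields A" if X: "X \<in> vector_fields A" "Y \<in> vector_fields A"
    unfolding eq(1)[OF X] by (rule fld_vf) (simp add: smooth_map_def linear_add smooth_add sm X)
  show "vf_diff X Y \<in> vector_fields A" if X: "X \<in> vector_fields A" "Y \<in> vector_fields A"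
    unfolding eq(2)[OF X] by (rule fld_vf) (simp add: smooth_map_def linear_diff smooth_diff sm X)
  show "vf_mult f X \<in> vector_fields A" if f: "f \<in> smooth_functions A" and X: "X \<in> vector_fields A"
    unfolding eq(3)[OF X X] by (rule fld_vf) (simp add: smooth_map_def linear_scale smooth_mult f sm X)
qed

lemma smooth_map_const: "smooth_map (\<lambda>_. x)"
  by (simp add: smooth_map_def smooth_const)

lemma smooth_map_add: "smooth_map m \<Longrightarrow> smooth_map n \<Longrightarrow> smooth_map (\<lambda>p. m p + n p)"
  by (simp add: smooth_map_def linear_add smooth_add)

lemma smooth_map_diff: "smooth_map m \<Longrightarrow> smooth_map n \<Longrightarrow> smooth_map (\<lambda>p. m p - n p)"
  by (simp add: smooth_map_def linear_diff smooth_diff)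

lemma smooth_map_scaleR: "f \<in> smooth_functions A \<Longrightarrow> smooth_map m \<Longrightarrow> smooth_map (\<lambda>p. f p *\<^sub>R m p)"
  by (simp add: smooth_map_def linear_scale smooth_mult)

lemma smooth_map_linear: "linear \<phi> \<Longrightarrow> smooth_map m \<Longrightarrow> smooth_map (\<lambda>p. \<phi> (m p))"
  unfolding smooth_map_def using linear_compose by (auto simp: o_def)

lemma bilinear_expand:
  fixes h :: "'a \<Rightarrow> 'a \<Rightarrow> real"
  assumes "bilinear h"
  shows "h x y = (\<Sum>b\<in>B. co b x * h b y)"
  using linear_expand[of "\<lambda>x. h x y" x] assms by (simp add: bilinear_def)

lemma smooth_bilinear:
  fixes h :: "'a \<Rightarrow> 'a \<Rightarrow> real"
  assumes h: "bilinear h" and m: "smooth_map m" and n: "smooth_map n"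
  shows "(\<lambda>p. h (m p) (n p)) \<in> smooth_functions A"
proof -
  have "(\<lambda>p. h (m p) (n p)) = (\<lambda>p. \<Sum>b\<in>B. co b (m p) * h b (n p))"
    by (rule ext) (rule bilinear_expand[OF h])
  moreover have "(\<lambda>p. \<Sum>b\<in>B. co b (m p) * h b (n p)) \<in> smooth_functions A"
    using h by (intro smooth_sum smooth_mult smooth_mapD[OF m linear_co] smooth_mapD[OF n]) (simp add: bilinear_def)
  ultimately show ?thesis by (simp only:)
qed

lemma smooth_map_bilinear:
  fixes \<Gamma> :: "'a \<Rightarrow> 'a \<Rightarrow> 'a"
  assumes \<Gamma>: "bilinear \<Gamma>" and m: "smooth_map m" and n: "smooth_map n"
  shows "smooth_map (\<lambda>p. \<Gamma> (m p) (n p))"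
  unfolding smooth_map_def
proof (intro allI impI)
  fix l :: "'a \<Rightarrow> real" assume "linear l"
  then have "bilinear (\<lambda>x y. l (\<Gamma> x y))"
    using \<Gamma> linear_compose[of _ l] by (auto simp: bilinear_def o_def)
  then show "(\<lambda>p. l (\<Gamma> (m p) (n p))) \<in> smooth_functions A"
    by (rule smooth_bilinear[OF _ m n])
qed

text \<open>The derivative of an \<open>'a\<close>-valued map along \<open>X\<close>, componentwise
  in the basis. By \<open>linear_dmap\<close> it commutes with every functional, so the rules for it
  are proved without coordinates.\<close>

definition dmap :: "'g vfield \<Rightarrow> ('g \<Rightarrow> 'a) \<Rightarrow> 'g \<Rightarrow> 'a" where
  "dmap X m p = (\<Sum>b\<in>B. X (\<lambda>q. co b (m q)) p *\<^sub>R b)"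

lemma linear_dmap:
  fixes l :: "'a \<Rightarrow> real"
  assumes X: "X \<in> vector_fields A" and m: "smooth_map m" and l: "linear l"
  shows "l (dmap X m p) = X (\<lambda>q. l (m q)) p"
proof -
  have "l (m q) = (\<Sum>b\<in>B. l b * co b (m q))" for q
    using linear_expand[OF l, of "m q"] by (simp add: mult.commute)
  then have "X (\<lambda>q. l (m q)) p = X (\<lambda>q. \<Sum>b\<in>B. l b * co b (m q)) p"
    by (simp only:)
  also have "\<dots> = (\<Sum>b\<in>B. X (\<lambda>q. l b * co b (m q)) p)"
    by (rule vf_apply_sum[OF X]) (intro smooth_mult smooth_const smooth_mapD[OF m linear_co])
  also have "\<dots> = l (dmap X m p)"
    by (simp add: dmap_def linear_sum[OF l] linear_scale[OF l] vf_apply_scale[OF X smooth_mapD[OF m linear_co]] mult.commute)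
  finally show ?thesis by simp
qed

lemma dmap_eqI:
  assumes "X \<in> vector_fields A" "smooth_map m" "\<And>l :: 'a \<Rightarrow> real. linear l \<Longrightarrow> X (\<lambda>q. l (m q)) p = l v"
  shows "dmap X m p = v"
  by (rule functional_eqI) (simp add: linear_dmap[OF assms(1,2)] assms(3))

lemma smooth_map_dmap:
  assumes "X \<in> vector_fields A" "smooth_map m"
  shows "smooth_map (dmap X m)"
  unfolding smooth_map_def
  by (simp add: linear_dmap[OF assms] vector_fieldsD(1)[OF assms(1)] smooth_mapD[OF assms(2)])

lemma dmap_const: "X \<in> vector_fields A \<Longrightarrow> dmap X (\<lambda>_. x) p = 0"
  by (simp add: dmap_def vf_apply_const)

lemma dmap_add:
  assumes "X \<in> vector_fields A" "smooth_map m" "smooth_map n"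
  shows "dmap X (\<lambda>p. m p + n p) p = dmap X m p + dmap X n p"
  by (rule dmap_eqI[OF assms(1) smooth_map_add[OF assms(2,3)]])
    (simp add: linear_add linear_dmap assms vf_apply_add[OF assms(1) smooth_mapD[OF assms(2)] smooth_mapD[OF assms(3)]])

lemma dmap_scaleR:
  assumes "X \<in> vector_fields A" "f \<in> smooth_functions A" "smooth_map m"
  shows "dmap X (\<lambda>p. f p *\<^sub>R m p) p = X f p *\<^sub>R m p + f p *\<^sub>R dmap X m p"
  by (rule dmap_eqI[OF assms(1) smooth_map_scaleR[OF assms(2,3)]])
    (simp add: linear_add linear_scale linear_dmap assms
      vector_fieldsD(4)[OF assms(1,2) smooth_mapD[OF assms(3)]])

lemma dmap_linear:
  assumes "X \<in> vector_fields A" "smooth_map m" "linear \<phi>"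
  shows "dmap X (\<lambda>p. \<phi> (m p)) p = \<phi> (dmap X m p)"
proof (rule dmap_eqI[OF assms(1) smooth_map_linear[OF assms(3,2)]])
  fix l :: "'a \<Rightarrow> real" assume "linear l"
  then have "linear (\<lambda>x. l (\<phi> x))" using linear_compose[OF assms(3)] by (simp add: o_def)
  from linear_dmap[OF assms(1,2) this] show "X (\<lambda>q. l (\<phi> (m q))) p = l (\<phi> (dmap X m p))" by simp
qed

lemma dmap_vf_add: "dmap (vf_add X Y) m p = dmap X m p + dmap Y m p"
  by (simp add: dmap_def vf_add_def scaleR_add_left sum.distrib)

lemma dmap_vf_mult: "dmap (vf_mult f X) m p = f p *\<^sub>R dmap X m p"
  by (simp add: dmap_def vf_mult_def scaleR_sum_right)

lemma vf_apply_bilinear: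
  fixes h :: "'a \<Rightarrow> 'a \<Rightarrow> real"
  assumes X: "X \<in> vector_fields A" and h: "bilinear h" and m: "smooth_map m" and n: "smooth_map n"
  shows "X (\<lambda>q. h (m q) (n q)) p = h (dmap X m p) (n p) + h (m p) (dmap X n p)"
proof -
  have lh: "linear (h b)" for b using h by (simp add: bilinear_def)
  have sm: "(\<lambda>p. co b (m p)) \<in> smooth_functions A" "(\<lambda>p. h b (n p)) \<in> smooth_functions A" for b
    by (rule smooth_mapD[OF m linear_co] smooth_mapD[OF n lh])+
  have "X (\<lambda>q. h (m q) (n q)) p = X (\<lambda>q. \<Sum>b\<in>B. co b (m q) * h b (n q)) p"
    by (rule arg_cong[where f = "\<lambda>f. X f p"]) (rule ext, rule bilinear_expand[OF h])
  also have "\<dots> = (\<Sum>b\<in>B. X (\<lambda>q. co b (m q) * h b (n q)) p)"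
    by (rule vf_apply_sum[OF X]) (intro smooth_mult sm)
  also have "\<dots> = (\<Sum>b\<in>B. co b (dmap X m p) * h b (n p)) + (\<Sum>b\<in>B. co b (m p) * h b (dmap X n p))"
    unfolding sum.distrib[symmetric]
    by (rule sum.cong[OF refl])
      (simp add: vector_fieldsD(4)[OF X sm] linear_dmap[OF X m linear_co] linear_dmap[OF X n lh])
  also have "\<dots> = h (dmap X m p) (n p) + h (m p) (dmap X n p)"
    by (simp only: bilinear_expand[OF h, of "dmap X m p" "n p"] bilinear_expand[OF h, of "m p" "dmap X n p"])
  finally show ?thesis .
qed

text \<open>Leibniz rule for the frame expansion of \<open>Y\<close>: one term freezes the
  coefficients of \<open>Y\<close> at p, the other differentiates them. The first is a pure
  second-order term in left invariant fields.\<close>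

lemma vf_apply_vf:
  assumes X: "X \<in> vector_fields A" and Y: "Y \<in> vector_fields A" and f: "f \<in> smooth_functions A"
  shows "X (Y f) p = \<iota> (mc X p) (\<iota> (mc Y p) f) p + \<iota> (dmap X (mc Y) p) f p"
proof -
  note n = smooth_map_mc[OF Y]
  let ?m = "mc X p"
  have sm: "(\<lambda>q. co b (mc Y q)) \<in> smooth_functions A" "\<iota> b f \<in> smooth_functions A" for b
    by (rule smooth_mapD[OF n linear_co] vector_fieldsD(1)[OF \<iota>_vf f])+
  have lin: "linear (\<lambda>y. \<iota> ?m (\<iota> y f) p)"
  proof (rule linearI)
    show "\<iota> ?m (\<iota> (y + y') f) p = \<iota> ?m (\<iota> y f) p + \<iota> ?m (\<iota> y' f) p" for y y'
      using vf_apply_add[OF \<iota>_vf sm(2) sm(2), of ?m y y' p]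
      by (simp add: linear_add[OF linear_\<iota>, symmetric])
    show "\<iota> ?m (\<iota> (r *\<^sub>R y) f) p = r *\<^sub>R \<iota> ?m (\<iota> y f) p" for r y
      using vf_apply_scale[OF \<iota>_vf sm(2), of ?m r y p]
      by (simp add: linear_scale[OF linear_\<iota>, symmetric, unfolded real_scaleR_def])
  qed
  have "Y f q = (\<Sum>b\<in>B. co b (mc Y q) * \<iota> b f q)" for q
    using linear_expand[OF linear_\<iota>, where x = "mc Y q"] by (simp add: vf_apply_mc[OF Y])
  then have "X (Y f) p = X (\<lambda>q. \<Sum>b\<in>B. co b (mc Y q) * \<iota> b f q) p"
    by (intro arg_cong[where f = "\<lambda>f. X f p"] ext)
  also have "\<dots> = (\<Sum>b\<in>B. X (\<lambda>q. co b (mc Y q) * \<iota> b f q) p)"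
    by (rule vf_apply_sum[OF X]) (intro smooth_mult sm)
  also have "\<dots> = (\<Sum>b\<in>B. co b (mc Y p) *\<^sub>R \<iota> ?m (\<iota> b f) p) +
      (\<Sum>b\<in>B. co b (dmap X (mc Y) p) *\<^sub>R \<iota> b f p)"
    unfolding sum.distrib[symmetric]
    by (rule sum.cong[OF refl])
      (simp add: vector_fieldsD(4)[OF X sm] linear_dmap[OF X n linear_co] vf_apply_mc[OF X, symmetric])
  also have "\<dots> = \<iota> ?m (\<iota> (mc Y p) f) p + \<iota> (dmap X (mc Y) p) f p"
    by (simp only: linear_expand[OF lin, symmetric] linear_expand[OF linear_\<iota>, symmetric])
  finally show ?thesis .
qed

text \<open>The Maurer-Cartan structure equation. Antisymmetrising \<open>vf_apply_vf\<close> turns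
  the second-order terms into the bracket of \<open>'a\<close> by
  \<open>\<iota>_bracket\<close>.\<close>

lemma vf_bracket_mc:
  assumes X: "X \<in> vector_fields A" and Y: "Y \<in> vector_fields A"
  shows "mc (vf_bracket X Y) p = dmap X (mc Y) p - dmap Y (mc X) p + br (mc X p) (mc Y p)"
  by (rule mc_eqI)
    (simp add: vf_bracket_def vf_apply_vf[OF X Y] vf_apply_vf[OF Y X] linear_add[OF linear_\<iota>]
      linear_diff[OF linear_\<iota>] \<iota>_bracket)

lemma vf_bracket_vf:
  assumes X: "X \<in> vector_fields A" and Y: "Y \<in> vector_fields A" and br: "bilinear br"
  shows "vf_bracket X Y \<in> vector_fields A"
proof -
  let ?m = "\<lambda>p. dmap X (mc Y) p - dmap Y (mc X) p + br (mc X p) (mc Y p)"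
  have "vf_bracket X Y f p = fld ?m f p" for f p
  proof (cases "f \<in> smooth_functions A")
    case True
    then show ?thesis
      by (simp add: vf_of_map_def vf_bracket_def vf_apply_vf[OF X Y] vf_apply_vf[OF Y X]
          linear_add[OF linear_\<iota>] linear_diff[OF linear_\<iota>] \<iota>_bracket)
  next
    case False
    \<comment> \<open>Fields are 0 on non-smooth functions by convention; the bracket inherits this
      because a derivation annihilates the constant 0.\<close>
    then have "X f = (\<lambda>_. 0)" "Y f = (\<lambda>_. 0)" using vector_fieldsD(2)[OF X] vector_fieldsD(2)[OF Y] by auto
    then show ?thesis using False
      by (simp add: vf_of_map_def vf_bracket_def vf_apply_const[OF X] vf_apply_const[OF Y] vector_fieldsD(2)[OF \<iota>_vf])
  qed
  then have "vf_bracket X Y = fld ?m" by (intro ext)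
  moreover have "smooth_map ?m"
    by (intro smooth_map_add smooth_map_diff smooth_map_dmap smooth_map_bilinear[OF br] smooth_map_mc X Y)
  ultimately show ?thesis by (simp only: fld_vf)
qed

text \<open>The connection d + \<open>\<Gamma>\<close> in the left invariant trivialisation, that
  is, with constant Christoffel symbols in the frame.\<close>

definition conn :: "('a \<Rightarrow> 'a \<Rightarrow> 'a) \<Rightarrow> 'g vfield \<Rightarrow> 'g vfield \<Rightarrow> 'g vfield" where
  "conn \<Gamma> X Y = (if X \<in> vector_fields A \<and> Y \<in> vector_fields A
     then fld (\<lambda>p. dmap X (mc Y) p + \<Gamma> (mc X p) (mc Y p)) else vf_zero)"

lemma mc_conn:
  "X \<in> vector_fields A \<Longrightarrow> Y \<in> vector_fields A \<Longrightarrow>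
    mc (conn \<Gamma> X Y) p = dmap X (mc Y) p + \<Gamma> (mc X p) (mc Y p)"
  by (simp add: conn_def)

lemma conn_vf:
  assumes \<Gamma>: "bilinear \<Gamma>" and X: "X \<in> vector_fields A" and Y: "Y \<in> vector_fields A"
  shows "conn \<Gamma> X Y \<in> vector_fields A"
proof -
  have "smooth_map (\<lambda>p. dmap X (mc Y) p + \<Gamma> (mc X p) (mc Y p))"
    by (rule smooth_map_add[OF smooth_map_dmap[OF X smooth_map_mc[OF Y]]
          smooth_map_bilinear[OF \<Gamma> smooth_map_mc[OF X] smooth_map_mc[OF Y]]])
  from fld_vf[OF this] show ?thesis by (simp only: conn_def X Y simp_thms if_True)
qed

lemma connection_conn:
  assumes \<Gamma>: "bilinear \<Gamma>"
  shows "connection A (conn \<Gamma>)"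
  unfolding connection_def
proof (intro conjI allI impI ballI)
  show "conn \<Gamma> X Y = vf_zero" if "X \<notin> vector_fields A \<or> Y \<notin> vector_fields A" for X Y
    using that by (auto simp: conn_def)
  show "conn \<Gamma> X Y \<in> vector_fields A" if "X \<in> vector_fields A" "Y \<in> vector_fields A" for X Y
    by (rule conn_vf[OF \<Gamma> that])
  fix X Y assume X: "X \<in> vector_fields A" and Y: "Y \<in> vector_fields A"
  note vf = conn_vf[OF \<Gamma>] vf_add_vf vf_mult_vf X Y
  have mc_add: "mc (vf_add V W) = (\<lambda>p. mc V p + mc W p)"
    if "V \<in> vector_fields A" "W \<in> vector_fields A" for V W
    using mc_vf_add[OF that] by (rule ext)
  have mc_mult: "mc (vf_mult f Y) = (\<lambda>p. f p *\<^sub>R mc Y p)" for f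
    using mc_vf_mult[OF Y] by (rule ext)
  show "conn \<Gamma> (vf_add X Y) Z = vf_add (conn \<Gamma> X Z) (conn \<Gamma> Y Z)" if Z: "Z \<in> vector_fields A" for Z
    by (rule vf_eqI) (simp_all add: vf Z mc_conn mc_vf_add dmap_vf_add bilinear_ladd[OF \<Gamma>])
  show "conn \<Gamma> Z (vf_add X Y) = vf_add (conn \<Gamma> Z X) (conn \<Gamma> Z Y)" if Z: "Z \<in> vector_fields A" for Z
    by (rule vf_eqI) (simp_all add: vf Z mc_conn mc_add dmap_add smooth_map_mc bilinear_radd[OF \<Gamma>])
  fix f assume f: "f \<in> smooth_functions A"
  show "conn \<Gamma> (vf_mult f X) Y = vf_mult f (conn \<Gamma> X Y)"
    by (rule vf_eqI) (simp_all add: vf f mc_conn mc_vf_mult dmap_vf_mult bilinear_lmul[OF \<Gamma>] scaleR_add_right)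
  have Xf: "X f \<in> smooth_functions A" by (rule vector_fieldsD(1)[OF X f])
  show "conn \<Gamma> X (vf_mult f Y) = vf_add (vf_mult (X f) Y) (vf_mult f (conn \<Gamma> X Y))"
    by (rule vf_eqI)
      (simp_all add: vf f Xf mc_conn mc_vf_mult mc_mult mc_vf_add dmap_scaleR smooth_map_mc
        bilinear_rmul[OF \<Gamma>] scaleR_add_right)
qed

text \<open>A left invariant metric has constant coefficients in the frame, so d preserves it, and
  \<open>skew\<close> says that each \<open>\<Gamma> x\<close> is a skew endomorphism.\<close>

lemma metric_connection_conn:
  assumes \<Gamma>: "bilinear \<Gamma>" and g: "bilinear g"
    and skew: "\<And>x y z. g (\<Gamma> x y) z + g y (\<Gamma> x z) = 0"
  shows "metric_connection A (left_inv_2tensor A \<iota> g) (conn \<Gamma>)"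
  unfolding metric_connection_def
proof (intro conjI ballI connection_conn[OF \<Gamma>])
  fix X Y Z assume X: "X \<in> vector_fields A" and Y: "Y \<in> vector_fields A" and Z: "Z \<in> vector_fields A"
  show "X (left_inv_2tensor A \<iota> g Y Z) =
      (\<lambda>p. left_inv_2tensor A \<iota> g (conn \<Gamma> X Y) Z p + left_inv_2tensor A \<iota> g Y (conn \<Gamma> X Z) p)"
  proof
    fix p
    show "X (left_inv_2tensor A \<iota> g Y Z) p =
        left_inv_2tensor A \<iota> g (conn \<Gamma> X Y) Z p + left_inv_2tensor A \<iota> g Y (conn \<Gamma> X Z) p"
      using skew[of "mc X p" "mc Y p" "mc Z p"]
      by (simp add: left_inv_2tensor_def mc_conn X Y Z vf_apply_bilinear[OF X g smooth_map_mc smooth_map_mc]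
          bilinear_ladd[OF g] bilinear_radd[OF g])
  qed
qed

lemma mc_torsion:
  assumes "connection A D" "bilinear br" "X \<in> vector_fields A" "Y \<in> vector_fields A"
  shows "mc (torsion D X Y) p = mc (D X Y) p - mc (D Y X) p - mc (vf_bracket X Y) p"
  using assms by (simp add: torsion_def mc_vf_diff vf_diff_vf vf_bracket_vf connection_def)

text \<open>The derivative terms of d + \<open>\<Gamma>\<close> cancel against those of the
  Maurer-Cartan equation, which leaves an algebraic torsion.\<close>

lemma mc_torsion_conn:
  assumes "bilinear \<Gamma>" "bilinear br" "X \<in> vector_fields A" "Y \<in> vector_fields A"
  shows "mc (torsion (conn \<Gamma>) X Y) p =
    \<Gamma> (mc X p) (mc Y p) - \<Gamma> (mc Y p) (mc X p) - br (mc X p) (mc Y p)"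
  by (simp add: mc_torsion[OF connection_conn] assms mc_conn vf_bracket_mc)

lemma mc_torsion_frame:
  assumes "connection A D" "bilinear br"
  shows "mc (torsion D (\<iota> x) (\<iota> y)) p = mc (D (\<iota> x) (\<iota> y)) p - mc (D (\<iota> y) (\<iota> x)) p - br x y"
proof -
  have "mc (\<iota> z) = (\<lambda>_. z)" for z by (rule ext) simp
  then show ?thesis
    by (simp add: mc_torsion[OF assms \<iota>_vf \<iota>_vf] vf_bracket_mc[OF \<iota>_vf \<iota>_vf] dmap_const \<iota>_vf)
qed

text \<open>Only additivity of \<open>P\<close> is assumed, so that the expansion applies to both
  slots of a connection: the tensorial one and the one obeying the Leibniz rule.\<close>

lemma frame_expand:
  fixes P :: "'g vfield \<Rightarrow> 'a"
  assumes add: "\<And>V W. V \<in> vector_fields A \<Longrightarrow> W \<in> vector_fields A \<Longrightarrow> P (vf_add V W) = P V + P W"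
    and Y: "Y \<in> vector_fields A"
  shows "P Y = (\<Sum>b\<in>B. P (vf_mult (\<lambda>p. co b (mc Y p)) (\<iota> b)))"
proof -
  let ?n = "\<lambda>C p. \<Sum>b\<in>C. co b (mc Y p) *\<^sub>R b"
  have co: "(\<lambda>p. co b (mc Y p)) \<in> smooth_functions A" for b
    by (rule smooth_mapD[OF smooth_map_mc[OF Y] linear_co])
  \<comment> \<open>Smoothness of the partial sum is carried along because additivity of
    \<open>P\<close> is available on vector fields only.\<close>
  have "P (fld (?n C)) = (\<Sum>b\<in>C. P (vf_mult (\<lambda>p. co b (mc Y p)) (\<iota> b))) \<and> smooth_map (?n C)"
    if "finite C" for C
    using that
  proof (induction C rule: finite_induct)
    case empty
    have "fld (\<lambda>_. 0) = vf_add (fld (\<lambda>_. 0)) (fld (\<lambda>_. 0))"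
      by (intro ext) (simp add: vf_of_map_def vf_add_def linear_0[OF linear_\<iota>])
    then have "P (fld (\<lambda>_. 0)) = P (fld (\<lambda>_. 0)) + P (fld (\<lambda>_. 0))"
      using add[OF fld_vf[OF smooth_map_const] fld_vf[OF smooth_map_const]] by metis
    then show ?case by (simp add: smooth_map_const)
  next
    case (insert b C)
    then have n: "smooth_map (?n C)" by blast
    have "fld (?n (insert b C)) = vf_add (vf_mult (\<lambda>p. co b (mc Y p)) (\<iota> b)) (fld (?n C))"
      using insert.hyps
      by (intro ext) (simp add: vf_of_map_def vf_add_def vf_mult_def linear_add[OF linear_\<iota>] linear_scale[OF linear_\<iota>])
    then have "P (fld (?n (insert b C))) = P (vf_mult (\<lambda>p. co b (mc Y p)) (\<iota> b)) + P (fld (?n C))"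
      using add[OF vf_mult_vf[OF co \<iota>_vf] fld_vf[OF n]] by simp
    moreover have "smooth_map (\<lambda>p. co b (mc Y p) *\<^sub>R b + ?n C p)"
      by (rule smooth_map_add[OF smooth_map_scaleR[OF co smooth_map_const] n])
    ultimately show ?case using insert by simp
  qed
  from this[OF finite_B] show ?thesis by (simp add: co_expand fld_mc[OF Y])
qed

text \<open>The frame is global, so no localisation argument is involved: the first slot is expanded
  by linearity over functions, the second by the Leibniz rule, whose derivative terms reassemble to
  \<open>dmap\<close>.\<close>

lemma connection_eq_conn:
  assumes D: "connection A D" and \<Gamma>: "bilinear \<Gamma>"
    and eq: "\<And>x y p. mc (D (\<iota> x) (\<iota> y)) p = \<Gamma> x y"
  shows "D = conn \<Gamma>"
proof (intro ext[of D] ext[of "D _"])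
  fix X Y
  show "D X Y = conn \<Gamma> X Y"
  proof (cases "X \<in> vector_fields A \<and> Y \<in> vector_fields A")
    case False
    then show ?thesis using D by (auto simp: connection_def conn_def)
  next
    case True
    then have X: "X \<in> vector_fields A" and Y: "Y \<in> vector_fields A" by auto
    have Dvf: "D V W \<in> vector_fields A" if "V \<in> vector_fields A" "W \<in> vector_fields A" for V W
      using D that by (simp add: connection_def)
    have co: "(\<lambda>p. co b (mc Z p)) \<in> smooth_functions A" if "Z \<in> vector_fields A" for b Z
      by (rule smooth_mapD[OF smooth_map_mc[OF that] linear_co])
    show ?thesis
    proof (rule vf_eqI[OF Dvf[OF X Y] conn_vf[OF \<Gamma> X Y]])
      fix p
      have lin: "linear (\<lambda>x. \<Gamma> x y)" "linear (\<Gamma> x)" for x y using \<Gamma> by (simp_all add: bilinear_def)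
      have left: "mc (D X (\<iota> b)) p = \<Gamma> (mc X p) b" for b
      proof -
        have "mc (D X (\<iota> b)) p = (\<Sum>a\<in>B. mc (D (vf_mult (\<lambda>p. co a (mc X p)) (\<iota> a)) (\<iota> b)) p)"
          by (rule frame_expand[OF _ X]) (use D in \<open>simp add: connection_def mc_vf_add \<iota>_vf\<close>)
        also have "\<dots> = (\<Sum>a\<in>B. co a (mc X p) *\<^sub>R \<Gamma> a b)"
        proof (rule sum.cong[OF refl])
          fix a
          have "D (vf_mult (\<lambda>p. co a (mc X p)) (\<iota> a)) (\<iota> b) = vf_mult (\<lambda>p. co a (mc X p)) (D (\<iota> a) (\<iota> b))"
            using D co[OF X] \<iota>_vf unfolding connection_def by blast
          then show "mc (D (vf_mult (\<lambda>p. co a (mc X p)) (\<iota> a)) (\<iota> b)) p = co a (mc X p) *\<^sub>R \<Gamma> a b"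
            by (simp add: mc_vf_mult Dvf \<iota>_vf eq)
        qed
        also have "\<dots> = \<Gamma> (mc X p) b" by (rule linear_expand[OF lin(1), symmetric])
        finally show ?thesis .
      qed
      have "mc (D X Y) p = (\<Sum>b\<in>B. mc (D X (vf_mult (\<lambda>p. co b (mc Y p)) (\<iota> b))) p)"
        by (rule frame_expand[OF _ Y]) (use D X in \<open>simp add: connection_def mc_vf_add\<close>)
      also have "\<dots> = (\<Sum>b\<in>B. X (\<lambda>p. co b (mc Y p)) p *\<^sub>R b + co b (mc Y p) *\<^sub>R \<Gamma> (mc X p) b)"
      proof (rule sum.cong[OF refl])
        fix b
        have "D X (vf_mult (\<lambda>p. co b (mc Y p)) (\<iota> b)) =
            vf_add (vf_mult (X (\<lambda>p. co b (mc Y p))) (\<iota> b)) (vf_mult (\<lambda>p. co b (mc Y p)) (D X (\<iota> b)))"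
          using D co[OF Y] X \<iota>_vf unfolding connection_def by blast
        then show "mc (D X (vf_mult (\<lambda>p. co b (mc Y p)) (\<iota> b))) p =
            X (\<lambda>p. co b (mc Y p)) p *\<^sub>R b + co b (mc Y p) *\<^sub>R \<Gamma> (mc X p) b"
          by (simp add: mc_vf_add mc_vf_mult vf_mult_vf vector_fieldsD(1)[OF X] co[OF Y] Dvf X \<iota>_vf left)
      qed
      also have "\<dots> = dmap X (mc Y) p + \<Gamma> (mc X p) (mc Y p)"
        by (simp only: sum.distrib dmap_def linear_expand[OF lin(2), symmetric])
      finally show "mc (D X Y) p = mc (conn \<Gamma> X Y) p" by (simp only: mc_conn[OF X Y])
    qed
  qed
qed

text \<open>The metric is constant on pairs of left invariant fields, so the left side of the metric
  condition is 0.\<close>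

lemma metric_connection_frame:
  assumes "metric_connection A (left_inv_2tensor A \<iota> g) D"
  shows "g (mc (D (\<iota> x) (\<iota> y)) p) z + g y (mc (D (\<iota> x) (\<iota> z)) p) = 0"
proof -
  have "left_inv_2tensor A \<iota> g (\<iota> y) (\<iota> z) = (\<lambda>_. g y z)"
    by (rule ext) (simp add: left_inv_2tensor_def)
  moreover have "\<iota> x (left_inv_2tensor A \<iota> g (\<iota> y) (\<iota> z)) p =
      left_inv_2tensor A \<iota> g (D (\<iota> x) (\<iota> y)) (\<iota> z) p + left_inv_2tensor A \<iota> g (\<iota> y) (D (\<iota> x) (\<iota> z)) p"
    using assms \<iota>_vf by (simp add: metric_connection_def)
  ultimately show ?thesis
    by (simp add: vf_apply_const[OF \<iota>_vf] left_inv_2tensor_def)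
qed

lemma mc_left_inv_endo: "mc (left_inv_endo A \<iota> \<phi> X) p = \<phi> (mc X p)"
  by (rule mc_eqI) (simp add: left_inv_endo_def)

lemma left_inv_endo_vf:
  assumes "linear \<phi>" "X \<in> vector_fields A"
  shows "left_inv_endo A \<iota> \<phi> X \<in> vector_fields A"
  using fld_vf[OF smooth_map_linear[OF assms(1) smooth_map_mc[OF assms(2)]]]
  by (simp add: left_inv_endo_def vf_of_map_def)

lemma left_inv_endo_\<iota>: "left_inv_endo A \<iota> \<phi> (\<iota> x) = \<iota> (\<phi> x)"
  by (intro ext) (simp add: left_inv_endo_def)

end

section \<open>The Lie algebra\<close>

lemma alternating_bilinear_on_UNIV:
  assumes "alternating_bilinear_on UNIV UNIV B"
  shows "bilinear B" "B x x = 0" "B x y = - B y x"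
proof -
  show bil: "bilinear B"
    unfolding bilinear_def
  proof (intro conjI allI linearI)
    fix x y z and r :: real
    have "B x (1 *\<^sub>R y + 1 *\<^sub>R z) = 1 *\<^sub>R B x y + 1 *\<^sub>R B x z"
      "B (1 *\<^sub>R y + 1 *\<^sub>R z) x = 1 *\<^sub>R B y x + 1 *\<^sub>R B z x"
      "B x (r *\<^sub>R y + 0 *\<^sub>R y) = r *\<^sub>R B x y + 0 *\<^sub>R B x y"
      "B (r *\<^sub>R y + 0 *\<^sub>R y) x = r *\<^sub>R B y x + 0 *\<^sub>R B y x"
      using assms unfolding alternating_bilinear_on_def linear_on_sub_def by blast+
    then show "B x (y + z) = B x y + B x z" "B (y + z) x = B y x + B z x"
      "B x (r *\<^sub>R y) = r *\<^sub>R B x y" "B (r *\<^sub>R y) x = r *\<^sub>R B y x"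
      by simp_all
  qed
  have alt: "B x x = 0" for x using assms by (simp add: alternating_bilinear_on_def)
  then show "B x x = 0" .
  have "B (x + y) (x + y) = B x x + B y x + (B x y + B y y)"
    by (simp only: bilinear_ladd[OF bil] bilinear_radd[OF bil])
  then show "B x y = - B y x" by (simp add: alt eq_neg_iff_add_eq_0 add.commute)
qed

text \<open>The argument behind uniqueness of the Levi-Civita connection: alternating the two
  symmetries around the six orders of the arguments returns to the start with sign -1.\<close>

lemma metric_symmetric_difference_zero:
  fixes \<omega> :: "'a \<Rightarrow> 'a \<Rightarrow> 'a \<Rightarrow> real"
  assumes skew: "\<And>x y z. \<omega> x y z = - \<omega> x z y" and sym: "\<And>x y z. \<omega> x y z = \<omega> y x z"
  shows "\<omega> x y z = 0"
  using skew[of x y z] sym[of x z y] skew[of z x y] sym[of z y x] skew[of y z x] sym[of y x z]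
  by linarith

text \<open>The difference of two metric connections with skew torsion is totally skew. If it commutes
  with \<open>\<phi>\<close>, then \<open>\<phi>\<close> can be moved between any two arguments at the cost of a sign, and moving it
  from the first to the second argument directly or via the third one gives opposite signs.\<close>

lemma canonical_difference_zero:
  fixes \<omega> :: "'a::real_vector \<Rightarrow> 'a \<Rightarrow> 'a \<Rightarrow> real"
  assumes lin: "\<And>x y. linear (\<omega> x y)"
    and skew: "\<And>x y z. \<omega> x y z = - \<omega> x z y"
    and torsion: "\<And>x y z. \<omega> x y z - \<omega> y x z = - (\<omega> x z y - \<omega> z x y)"
    and \<phi>: "\<And>x y z. \<omega> x (\<phi> y) z = - \<omega> x y (\<phi> z)"
    and \<phi>\<phi>: "\<And>x. \<phi> (\<phi> x) = - x + \<eta> x *\<^sub>R \<xi>"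
  shows "\<omega> x y z = 0"
proof -
  have s23: "\<omega> x y z = - \<omega> x z y" for x y z by (rule skew)
  have s13: "\<omega> x y z = - \<omega> z y x" for x y z
    using torsion[of y x z] skew[of y x z] skew[of x y z] skew[of z y x] by linarith
  have s12: "\<omega> x y z = - \<omega> y x z" for x y z
    using s23[of x y z] s13[of x z y] s23[of y z x] by linarith
  have \<phi>0: "\<omega> (\<phi> x) y z = 0" for x y z
    using s12[of "\<phi> x" y z] \<phi>[of y x z] s12[of y x "\<phi> z"] \<phi>[of x y z]
      s13[of "\<phi> x" y z] \<phi>[of z y x] s13[of z "\<phi> y" x] by linarith
  have \<xi>: "\<omega> x y z = \<eta> x * \<omega> \<xi> y z" for x y z
  proof -
    have "\<omega> (\<phi> (\<phi> x)) y z = - \<omega> z y (- x + \<eta> x *\<^sub>R \<xi>)"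
      by (subst s13) (simp only: \<phi>\<phi>)
    also have "\<dots> = \<omega> z y x - \<eta> x * \<omega> z y \<xi>"
      by (simp only: linear_add[OF lin] linear_neg[OF lin] linear_scale[OF lin] real_scaleR_def)
    finally show ?thesis using \<phi>0[of "\<phi> x" y z] s13[of x y z] s13[of \<xi> y z]
      by (simp add: algebra_simps)
  qed
  \<comment> \<open>Modulo the image of \<open>\<phi>\<close> every argument is a multiple of
    \<open>\<xi>\<close>; what remains has two arguments equal to \<open>\<xi>\<close> and is killed
    by skewness.\<close>
  have "\<omega> \<xi> \<xi> z = 0" for z using s12[of \<xi> \<xi> z] by simp
  then have "\<omega> \<xi> y z = 0" for y z using s12[of \<xi> y z] \<xi>[of y \<xi> z] by simp
  then show ?thesis using \<xi>[of x y z] by simp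
qed

locale parallel_canonical_contact =
  fixes n :: nat and br :: "'a::real_vector \<Rightarrow> 'a \<Rightarrow> 'a" and \<phi> :: "nat \<Rightarrow> 'a \<Rightarrow> 'a"
    and \<xi> :: "nat \<Rightarrow> 'a" and \<eta> :: "nat \<Rightarrow> 'a \<Rightarrow> real" and g :: "'a \<Rightarrow> 'a \<Rightarrow> real"
  assumes contact: "almost_3_contact_metric_lie_algebra n br \<phi> \<xi> \<eta> g"
    and abelian: "abelian_3_contact br \<phi> \<xi> \<eta>"
    and parallel: "parallel_canonical br \<phi> \<xi> \<eta>"
    and delta_0: "contact_delta br \<xi> \<eta> = 0"
begin

section \<open>Consequences of the almost 3-contact axioms\<close>

abbreviation "I3 \<equiv> {1, 2, 3 :: nat}"

lemma lie: "lie_algebra_on UNIV br"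
  using contact by (simp add: almost_3_contact_metric_lie_algebra_def)

lemma bilinear_br: "bilinear br" and br_self [simp]: "br x x = 0" and br_skew: "br x y = - br y x"
  using lie alternating_bilinear_on_UNIV[of br] unfolding lie_algebra_on_def by blast+

lemma jacobi: "br x (br y z) + br y (br z x) + br z (br x y) = 0"
  using lie by (simp add: lie_algebra_on_def)

lemmas br_simps = bilinear_ladd[OF bilinear_br] bilinear_radd[OF bilinear_br] bilinear_lsub[OF bilinear_br]
  bilinear_rsub[OF bilinear_br] bilinear_lmul[OF bilinear_br] bilinear_rmul[OF bilinear_br]
  bilinear_lneg[OF bilinear_br] bilinear_rneg[OF bilinear_br] bilinear_lzero[OF bilinear_br]
  bilinear_rzero[OF bilinear_br]

lemma linear_br: "linear (br x)"
  using bilinear_br by (simp add: bilinear_def)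

lemma almost_contact: "i \<in> I3 \<Longrightarrow> almost_contact (\<phi> i) (\<xi> i) (\<eta> i)"
  using contact unfolding almost_3_contact_metric_lie_algebra_def by blast

lemma linear_\<phi>: "i \<in> I3 \<Longrightarrow> linear (\<phi> i)"
  and linear_\<eta>: "i \<in> I3 \<Longrightarrow> linear (\<eta> i)"
  and \<phi>\<phi>: "i \<in> I3 \<Longrightarrow> \<phi> i (\<phi> i x) = - x + \<eta> i x *\<^sub>R \<xi> i"
  and \<eta>\<xi>_same: "i \<in> I3 \<Longrightarrow> \<eta> i (\<xi> i) = 1"
  using almost_contact unfolding almost_contact_def by blast+

text \<open>For v = \<phi>(\<xi>) the axiom at \<xi> gives \<phi>(v) = 0, and the axiom at v then
  gives v = \<eta>(v) \<xi>. Applying \<phi> once more yields \<eta>(v) v = 0, so v = 0 in either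
  case.\<close>

lemma \<phi>\<xi>_same:
  assumes "i \<in> I3"
  shows "\<phi> i (\<xi> i) = 0"
proof -
  let ?v = "\<phi> i (\<xi> i)"
  have 0: "\<phi> i ?v = 0" using \<phi>\<phi>[OF assms, of "\<xi> i"] \<eta>\<xi>_same[OF assms] by simp
  have v: "?v = \<eta> i ?v *\<^sub>R \<xi> i"
    using \<phi>\<phi>[OF assms, of ?v] linear_0[OF linear_\<phi>[OF assms]] 0 by (simp add: add_eq_0_iff)
  have "\<phi> i ?v = \<eta> i ?v *\<^sub>R ?v"
    using arg_cong[OF v, of "\<phi> i"] linear_scale[OF linear_\<phi>[OF assms]] by simp
  then have "\<eta> i ?v = 0 \<or> ?v = 0" using 0 by simp
  then show ?thesis using v by auto
qed

text \<open>The cube of \<phi> is evaluated in two ways, as \<phi> of the square and as the square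
  at \<phi>(x); the difference is \<eta>(\<phi> x) \<xi>.\<close>

lemma \<eta>\<phi>_same:
  assumes "i \<in> I3"
  shows "\<eta> i (\<phi> i x) = 0"
proof -
  have "\<phi> i (\<phi> i (\<phi> i x)) = - \<phi> i x + \<eta> i x *\<^sub>R \<phi> i (\<xi> i)"
    by (subst (2) \<phi>\<phi>[OF assms])
      (simp add: linear_diff[OF linear_\<phi>[OF assms]] linear_scale[OF linear_\<phi>[OF assms]])
  then have "\<eta> i (\<phi> i x) *\<^sub>R \<xi> i = 0"
    using \<phi>\<phi>[OF assms, of "\<phi> i x"] \<phi>\<xi>_same[OF assms] by simp
  moreover have "\<xi> i \<noteq> 0"
    using \<eta>\<xi>_same[OF assms] linear_0[OF linear_\<eta>[OF assms]] by auto
  ultimately show ?thesis by simp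
qed

lemma even_perm:
  assumes "(i, j, k) \<in> even_perms3"
  shows "\<phi> k x = \<phi> i (\<phi> j x) - \<eta> j x *\<^sub>R \<xi> i" "\<phi> k x = - \<phi> j (\<phi> i x) + \<eta> i x *\<^sub>R \<xi> j"
    "\<xi> k = \<phi> i (\<xi> j)" "\<xi> k = - \<phi> j (\<xi> i)" "\<eta> k x = \<eta> i (\<phi> j x)" "\<eta> k x = - \<eta> j (\<phi> i x)"
    and "i \<in> I3" "j \<in> I3" "k \<in> I3"
proof -
  have "\<forall>(i,j,k)\<in>even_perms3.
        (\<forall>x. \<phi> k x = \<phi> i (\<phi> j x) - \<eta> j x *\<^sub>R \<xi> i \<and> \<phi> k x = - \<phi> j (\<phi> i x) + \<eta> i x *\<^sub>R \<xi> j) \<and>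
        \<xi> k = \<phi> i (\<xi> j) \<and> \<xi> k = - \<phi> j (\<xi> i) \<and>
        (\<forall>x. \<eta> k x = \<eta> i (\<phi> j x) \<and> \<eta> k x = - \<eta> j (\<phi> i x))"
    using contact unfolding almost_3_contact_metric_lie_algebra_def by (elim conjE)
  from bspec[OF this assms] show "\<phi> k x = \<phi> i (\<phi> j x) - \<eta> j x *\<^sub>R \<xi> i"
    "\<phi> k x = - \<phi> j (\<phi> i x) + \<eta> i x *\<^sub>R \<xi> j"
    "\<xi> k = \<phi> i (\<xi> j)" "\<xi> k = - \<phi> j (\<xi> i)" "\<eta> k x = \<eta> i (\<phi> j x)" "\<eta> k x = - \<eta> j (\<phi> i x)"
    by blast+
  show "i \<in> I3" "j \<in> I3" "k \<in> I3" using assms by (auto simp: even_perms3_def)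
qed

lemma perms: "(1, 2, 3) \<in> even_perms3" "(2, 3, 1) \<in> even_perms3" "(3, 1, 2) \<in> even_perms3"
  by (simp_all add: even_perms3_def)

text \<open>Up to sign both \<xi> j and \<xi> k lie in the image of \<phi> i, where \<eta> i
  vanishes.\<close>

lemma \<eta>\<xi>_even:
  assumes "(i, j, k) \<in> even_perms3"
  shows "\<eta> i (\<xi> j) = 0" "\<eta> i (\<xi> k) = 0"
proof -
  note I = even_perm(7,8,9)[OF assms]
  show "\<eta> i (\<xi> k) = 0" using even_perm(3)[OF assms] \<eta>\<phi>_same[OF I(1)] by simp
  have p: "(j, k, i) \<in> even_perms3" "(k, i, j) \<in> even_perms3"
    using assms by (auto simp: even_perms3_def)
  show "\<eta> i (\<xi> j) = 0" using even_perm(4)[OF p(2)] \<eta>\<phi>_same[OF I(1)] linear_neg[OF linear_\<eta>[OF I(1)]] by simp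
qed

lemma \<eta>\<xi>:
  assumes "i \<in> I3" "j \<in> I3"
  shows "\<eta> i (\<xi> j) = (if i = j then 1 else 0)"
  using assms \<eta>\<xi>_same \<eta>\<xi>_even[OF perms(1)] \<eta>\<xi>_even[OF perms(2)] \<eta>\<xi>_even[OF perms(3)] by auto

section \<open>Brackets with the vertical space\<close>

lemma abelianD:
  assumes "i \<in> I3"
  shows "br (\<xi> i) (\<phi> i x) = \<phi> i (br (\<xi> i) x)"
    "\<eta> i x = 0 \<Longrightarrow> \<eta> i y = 0 \<Longrightarrow> br (\<phi> i x) (\<phi> i y) = br x y"
  using abelian assms unfolding abelian_3_contact_def abelian_almost_contact_def by blast+

lemma horizontalD: "x \<in> horizontal \<eta> \<Longrightarrow> i \<in> I3 \<Longrightarrow> \<eta> i x = 0"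
  unfolding horizontal_def by blast

lemma horizontalI: "(\<And>i. i \<in> I3 \<Longrightarrow> \<eta> i x = 0) \<Longrightarrow> x \<in> horizontal \<eta>"
  unfolding horizontal_def by blast

text \<open>The composite of \<eta> j with \<phi> i is 0 for j = i, and otherwise plus or minus the
  third \<eta>.\<close>

lemma horizontal_\<phi>:
  assumes "x \<in> horizontal \<eta>" "i \<in> I3"
  shows "\<phi> i x \<in> horizontal \<eta>"
proof -
  have "\<eta> j (\<phi> i x) = 0" if "j \<in> I3" for j
  proof -
    have "j = i \<or> (\<exists>k. (j, i, k) \<in> even_perms3) \<or> (\<exists>k. (i, j, k) \<in> even_perms3)"
      using assms(2) that by (auto simp: even_perms3_def)
    then show ?thesis
    proof (elim disjE exE)
      show ?thesis if "j = i" using \<eta>\<phi>_same[OF assms(2)] that by simp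
      show ?thesis if "(j, i, k) \<in> even_perms3" for k
        using even_perm(5)[OF that, of x] horizontalD[OF assms(1) even_perm(9)[OF that]] by simp
      show ?thesis if "(i, j, k) \<in> even_perms3" for k
        using even_perm(6)[OF that, of x] horizontalD[OF assms(1) even_perm(9)[OF that]] by simp
    qed
  qed
  then show ?thesis by (rule horizontalI)
qed

text \<open>The condition on Z puts the bracket in the kernel of \<phi> 1, hence on the line of
  \<xi> 1; its coefficient there is 2\<delta> = 0.\<close>

lemma br_\<xi>23: "br (\<xi> 2) (\<xi> 3) = 0"
proof -
  have "\<phi> 1 (\<phi> 1 (br (\<xi> 2) (\<xi> 3))) = 0"
    using parallel linear_0[OF linear_\<phi>[of 1]] by (simp add: parallel_canonical_def contact_Z_def)
  moreover have "\<eta> 1 (br (\<xi> 2) (\<xi> 3)) = 0" using delta_0 by (simp add: contact_delta_def)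
  ultimately show ?thesis using \<phi>\<phi>[of 1 "br (\<xi> 2) (\<xi> 3)"] by simp
qed

text \<open>Since \<xi> 1 = \<phi> 2 (\<xi> 3) and ad \<xi> 2 commutes with \<phi> 2, this bracket
  is the image under \<phi> 2 of the previous one. The next lemma does the same with \<phi>
  3.\<close>

lemma br_\<xi>21: "br (\<xi> 2) (\<xi> 1) = 0"
  using even_perm(3)[OF perms(2)] abelianD(1)[of 2 "\<xi> 3"] br_\<xi>23 linear_0[OF linear_\<phi>[of 2]] by simp

lemma br_\<xi>31: "br (\<xi> 3) (\<xi> 1) = 0"
  using even_perm(4)[OF perms(2)] abelianD(1)[of 3 "\<xi> 2"] br_skew[of "\<xi> 3" "\<xi> 2"] br_\<xi>23
    linear_0[OF linear_\<phi>[of 3]] by (simp add: br_simps)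

text \<open>The vanishing of \<psi> is applied at \<phi> 1 x, because \<phi> 1 squares to -1 on
  horizontal vectors.\<close>

lemma br_\<xi>1_horizontal:
  assumes "x \<in> horizontal \<eta>"
  shows "br (\<xi> 1) x = 0"
proof -
  have "br (\<xi> 1) (\<phi> 1 (\<phi> 1 x)) = 0"
    using parallel horizontal_\<phi>[OF assms, of 1] by (simp add: parallel_canonical_def contact_psi_def)
  then show ?thesis
    using \<phi>\<phi>[of 1 x] horizontalD[OF assms, of 1] by (simp add: br_simps)
qed

text \<open>\<open>contact_psi\<close> speaks of index 1 only. The other indices follow from
  [\<phi> X, \<phi> Y] = [X, Y] on a kernel: \<xi> 2 lies in that of \<eta> 3 and \<phi> 3 sends it
  to -\<xi> 1; \<xi> 3 lies in that of \<eta> 2 and \<phi> 2 sends it to \<xi> 1.\<close>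

lemma br_\<xi>_horizontal:
  assumes x: "x \<in> horizontal \<eta>" and i: "i \<in> I3"
  shows "br (\<xi> i) x = 0"
proof -
  have "br (\<xi> 2) x = br (\<phi> 3 (\<xi> 2)) (\<phi> 3 x)"
    using abelianD(2)[of 3 "\<xi> 2" x] \<eta>\<xi>[of 3 2] horizontalD[OF x, of 3] by simp
  also have "\<phi> 3 (\<xi> 2) = - \<xi> 1" using even_perm(4)[OF perms(2)] by simp
  finally have 2: "br (\<xi> 2) x = 0"
    using br_\<xi>1_horizontal[OF horizontal_\<phi>[OF x, of 3]] by (simp add: br_simps)
  have "br (\<xi> 3) x = br (\<phi> 2 (\<xi> 3)) (\<phi> 2 x)"
    using abelianD(2)[of 2 "\<xi> 3" x] \<eta>\<xi>[of 2 3] horizontalD[OF x, of 2] by simp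
  also have "\<phi> 2 (\<xi> 3) = \<xi> 1" using even_perm(3)[OF perms(2)] by simp
  finally have 3: "br (\<xi> 3) x = 0"
    using br_\<xi>1_horizontal[OF horizontal_\<phi>[OF x, of 2]] by simp
  show ?thesis using i br_\<xi>1_horizontal[OF x] 2 3 by auto
qed

abbreviation "hp \<equiv> hor_proj \<xi> \<eta>"

definition vert :: "'a \<Rightarrow> 'a" where
  "vert x = (\<Sum>i\<in>I3. \<eta> i x *\<^sub>R \<xi> i)"

lemma hp_vert: "hp x = x - vert x"
  by (simp only: hor_proj_def vert_def)

lemma linear_vert: "linear vert"
  by (rule linearI)
    (simp_all only: vert_def linear_add[OF linear_\<eta>] linear_scale[OF linear_\<eta>] scaleR_add_left sum.distrib
      scaleR_sum_right real_scaleR_def scaleR_scaleR cong: sum.cong)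

lemma linear_hp: "linear hp"
  using linear_compose_sub[OF linear_ident linear_vert] by (simp only: hp_vert[abs_def])

lemma \<eta>_vert: "i \<in> I3 \<Longrightarrow> \<eta> i (vert x) = \<eta> i x"
proof -
  assume i: "i \<in> I3"
  have "\<eta> i (vert x) = (\<Sum>j\<in>I3. \<eta> j x * (if i = j then 1 else 0))"
    unfolding vert_def linear_sum[OF linear_\<eta>[OF i]] linear_scale[OF linear_\<eta>[OF i]] real_scaleR_def
    by (intro sum.cong refl) (simp only: \<eta>\<xi>[OF i])
  also have "\<dots> = \<eta> i x" using i by auto
  finally show ?thesis .
qed

lemma hp_horizontal: "hp x \<in> horizontal \<eta>"
  by (rule horizontalI) (simp only: hp_vert linear_diff[OF linear_\<eta>] \<eta>_vert diff_self)

lemma hp_id: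
  assumes "x \<in> horizontal \<eta>"
  shows "hp x = x"
proof -
  have "vert x = (\<Sum>i\<in>I3. 0)"
    unfolding vert_def by (rule sum.cong[OF refl]) (simp only: horizontalD[OF assms] scaleR_zero_left)
  then show ?thesis by (simp add: hp_vert)
qed

lemma vert_vertical: "vert x \<in> vertical \<xi>"
  unfolding vert_def vertical_def by (intro span_sum span_scale span_base) auto

lemma vert_id:
  assumes "u \<in> vertical \<xi>"
  shows "vert u = u"
  using assms unfolding vertical_def
proof (induction rule: span_induct_alt)
  case base
  show ?case by (rule linear_0[OF linear_vert])
next
  case (step c x y)
  then obtain i where i: "i \<in> I3" "x = \<xi> i" by auto
  have "vert (\<xi> i) = (\<Sum>j\<in>I3. (if i = j then \<xi> j else 0))"
    unfolding vert_def by (intro sum.cong refl) (use \<eta>\<xi> i in auto)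
  then have "vert x = x" using i by auto
  then show ?case using step by (simp only: linear_add[OF linear_vert] linear_scale[OF linear_vert])
qed

lemma hp_vertical: "u \<in> vertical \<xi> \<Longrightarrow> hp u = 0"
  by (simp add: hp_vert vert_id)

lemma br_\<xi>_\<xi>: "i \<in> I3 \<Longrightarrow> j \<in> I3 \<Longrightarrow> br (\<xi> i) (\<xi> j) = 0"
  using br_\<xi>23 br_\<xi>21 br_\<xi>31 br_skew[of "\<xi> 3" "\<xi> 2"] br_skew[of "\<xi> 1" "\<xi> 2"] br_skew[of "\<xi> 1" "\<xi> 3"] by auto

lemma br_\<xi>:
  assumes i: "i \<in> I3"
  shows "br (\<xi> i) x = 0" "br x (\<xi> i) = 0"
proof -
  have "br (\<xi> i) (hp x + vert x) = 0"
    unfolding vert_def using i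
    by (simp only: br_simps br_\<xi>_horizontal[OF hp_horizontal i] linear_sum[OF linear_br] br_\<xi>_\<xi>
        scaleR_zero_right sum.neutral_const add_0 cong: sum.cong)
  then show "br (\<xi> i) x = 0" by (simp add: hp_vert)
  then show "br x (\<xi> i) = 0" using br_skew[of x] by simp
qed

lemma vertical_central: "u \<in> vertical \<xi> \<Longrightarrow> br u x = 0"
  unfolding vertical_def
proof (induction rule: span_induct_alt)
  case (step c v w)
  then show ?case using br_\<xi>(1) by (auto simp: br_simps)
qed (simp add: br_simps)

lemma br_vert [simp]: "br (vert x) y = 0" "br x (vert y) = 0"
  using vertical_central[OF vert_vertical] br_skew[of x "vert y"] by simp_all

text \<open>The vertical part is central, so the bracket sees horizontal parts only. This makes the
  Jacobi identity of \<open>hor_bracket\<close> and the closedness of \<open>theta\<close> the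
  horizontal and the vertical component of the Jacobi identity of \<open>br\<close>.\<close>

lemma br_hp [simp]: "br (hp x) y = br x y" "br x (hp y) = br x y"
  by (simp_all add: hp_vert br_simps)

text \<open>Abelianness gives this on the kernel of \<eta> i; the missing \<xi> i components are
  central and are annihilated by \<phi> i.\<close>

lemma br_\<phi>\<phi>:
  assumes i: "i \<in> I3"
  shows "br (\<phi> i x) (\<phi> i y) = br x y"
proof -
  have e: "\<eta> i (x - \<eta> i x *\<^sub>R \<xi> i) = 0" for x
    by (simp add: linear_diff[OF linear_\<eta>[OF i]] linear_scale[OF linear_\<eta>[OF i]] \<eta>\<xi>_same[OF i])
  have p: "\<phi> i (x - \<eta> i x *\<^sub>R \<xi> i) = \<phi> i x" for x
    by (simp add: linear_diff[OF linear_\<phi>[OF i]] linear_scale[OF linear_\<phi>[OF i]] \<phi>\<xi>_same[OF i])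
  show ?thesis using abelianD(2)[OF i e e, of x y] by (simp add: p br_simps br_\<xi>[OF i])
qed

lemma br_\<phi>:
  assumes i: "i \<in> I3"
  shows "br (\<phi> i x) y = - br x (\<phi> i y)"
  using br_\<phi>\<phi>[OF i, of x "\<phi> i y"] \<phi>\<phi>[OF i, of y]
  by (simp add: br_simps br_\<xi>[OF i] minus_equation_iff)

section \<open>The cocycle and the central extension\<close>

lemma theta_vert: "theta br \<xi> \<eta> x y = vert (br x y)"
  unfolding theta_def vert_def lie_d_def by (simp only: scaleR_minus_left sum_negf minus_minus)

lemma hor_bracket_hp: "hor_bracket br \<xi> \<eta> x y = hp (br x y)"
  by (simp only: hor_bracket_def)

lemma subspace_horizontal: "subspace (horizontal \<eta>)"
proof (rule subspaceI)
  show "0 \<in> horizontal \<eta>"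
    by (rule horizontalI) (rule linear_0[OF linear_\<eta>])
  show "x + y \<in> horizontal \<eta>" if "x \<in> horizontal \<eta>" "y \<in> horizontal \<eta>" for x y
    by (rule horizontalI) (simp only: linear_add[OF linear_\<eta>] that[THEN horizontalD] add_0)
  show "c *\<^sub>R x \<in> horizontal \<eta>" if "x \<in> horizontal \<eta>" for c x
    by (rule horizontalI) (simp only: linear_scale[OF linear_\<eta>] that[THEN horizontalD] scaleR_zero_right)
qed

lemma alternating_bilinear_comp:
  assumes "linear l" "\<And>x. l x \<in> W"
  shows "alternating_bilinear_on V W (\<lambda>x y. l (br x y))"
  using assms by (simp add: alternating_bilinear_on_def linear_on_sub_def br_simps linear_add linear_scale linear_0)

lemma hor_lie: "lie_algebra_on (horizontal \<eta>) (hor_bracket br \<xi> \<eta>)"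
  unfolding lie_algebra_on_def
proof (intro conjI ballI subspace_horizontal)
  show "alternating_bilinear_on (horizontal \<eta>) (horizontal \<eta>) (hor_bracket br \<xi> \<eta>)"
    unfolding hor_bracket_hp[abs_def] by (rule alternating_bilinear_comp[OF linear_hp hp_horizontal])
  show "hor_bracket br \<xi> \<eta> x (hor_bracket br \<xi> \<eta> y z) + hor_bracket br \<xi> \<eta> y (hor_bracket br \<xi> \<eta> z x) +
      hor_bracket br \<xi> \<eta> z (hor_bracket br \<xi> \<eta> x y) = 0" for x y z
    by (simp only: hor_bracket_hp br_hp linear_add[OF linear_hp, symmetric] jacobi linear_0[OF linear_hp])
qed

lemma hor_hypercomplex: "abelian_hypercomplex (horizontal \<eta>) (hor_bracket br \<xi> \<eta>) \<phi>"
  unfolding abelian_hypercomplex_def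
proof (intro conjI ballI)
  fix i assume i: "i \<in> I3"
  show "linear_on_sub (horizontal \<eta>) (horizontal \<eta>) (\<phi> i)"
    using horizontal_\<phi>[OF _ i] by (simp add: linear_on_sub_def linear_add[OF linear_\<phi>[OF i]] linear_scale[OF linear_\<phi>[OF i]])
  fix x assume x: "x \<in> horizontal \<eta>"
  show "\<phi> i (\<phi> i x) = - x" by (simp add: \<phi>\<phi>[OF i] horizontalD[OF x i])
  show "hor_bracket br \<xi> \<eta> (\<phi> i x) (\<phi> i y) = hor_bracket br \<xi> \<eta> x y" for y
    by (simp only: hor_bracket_hp br_\<phi>\<phi>[OF i])
next
  fix x assume x: "x \<in> horizontal \<eta>"
  show "\<phi> 1 (\<phi> 2 x) = \<phi> 3 x"
    using even_perm(1)[OF perms(1), of x] horizontalD[OF x, of 2] by simp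
  show "\<phi> 2 (\<phi> 1 x) = - \<phi> 3 x"
    using even_perm(2)[OF perms(1), of x] horizontalD[OF x, of 1] by simp
qed

lemma theta_cocycle: "lie_two_cocycle (horizontal \<eta>) (hor_bracket br \<xi> \<eta>) (vertical \<xi>) (theta br \<xi> \<eta>)"
  unfolding lie_two_cocycle_def
proof (intro conjI ballI)
  show "alternating_bilinear_on (horizontal \<eta>) (vertical \<xi>) (theta br \<xi> \<eta>)"
    unfolding theta_vert[abs_def] by (rule alternating_bilinear_comp[OF linear_vert vert_vertical])
  fix x y z
  have "br (br x y) z + br (br y z) x + br (br z x) y = - (br x (br y z) + br y (br z x) + br z (br x y))"
    using br_skew[of "br x y" z] br_skew[of "br y z" x] br_skew[of "br z x" y] by simp
  then show "theta br \<xi> \<eta> (hor_bracket br \<xi> \<eta> x y) z + theta br \<xi> \<eta> (hor_bracket br \<xi> \<eta> y z) x +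
      theta br \<xi> \<eta> (hor_bracket br \<xi> \<eta> z x) y = 0"
    by (simp only: theta_vert hor_bracket_hp br_hp linear_add[OF linear_vert, symmetric] jacobi
        minus_zero linear_0[OF linear_vert])
qed

lemma central_ext_iso:
  "lie_algebra_iso (vertical \<xi> \<times> horizontal \<eta>)
    (central_ext_bracket (theta br \<xi> \<eta>) (hor_bracket br \<xi> \<eta>)) UNIV br (\<lambda>(u, x). u + x)"
proof -
  let ?V = "vertical \<xi> \<times> horizontal \<eta>"
  let ?b = "central_ext_bracket (theta br \<xi> \<eta>) (hor_bracket br \<xi> \<eta>)"
  have b: "?b p q = (vert (br (snd p) (snd q)), hp (br (snd p) (snd q)))" for p q
    by (simp only: central_ext_bracket_def theta_vert hor_bracket_hp)
  have lin: "?b p (r *\<^sub>R q + s *\<^sub>R q') = r *\<^sub>R ?b p q + s *\<^sub>R ?b p q'"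
    "?b (r *\<^sub>R q + s *\<^sub>R q') p = r *\<^sub>R ?b q p + s *\<^sub>R ?b q' p" for p q q' r s
    by (simp_all add: b br_simps linear_add[OF linear_vert] linear_scale[OF linear_vert]
        linear_add[OF linear_hp] linear_scale[OF linear_hp])
  have inV: "?b p q \<in> ?V" for p q by (simp add: b vert_vertical hp_horizontal)
  have "lie_algebra_on ?V ?b"
    unfolding lie_algebra_on_def
  proof (intro conjI ballI)
    show "subspace ?V"
      using subspace_horizontal subspace_span[of "{\<xi> 1, \<xi> 2, \<xi> 3}"]
      unfolding subspace_def vertical_def by (auto simp: zero_prod_def)
    show "alternating_bilinear_on ?V ?V ?b"
      unfolding alternating_bilinear_on_def linear_on_sub_def
      by (intro conjI ballI allI inV lin) (simp add: b linear_0[OF linear_vert] linear_0[OF linear_hp] zero_prod_def)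
    show "?b p (?b q r) + ?b q (?b r p) + ?b r (?b p q) = 0" for p q r
      by (simp add: b linear_add[OF linear_vert, symmetric] linear_add[OF linear_hp, symmetric] jacobi
        linear_0[OF linear_vert] linear_0[OF linear_hp] zero_prod_def)
  qed
  moreover have "linear_on_sub ?V UNIV (\<lambda>(u, x). u + x)"
    by (auto simp: linear_on_sub_def scaleR_add_right)
  moreover have "bij_betw (\<lambda>(u, x). u + x) ?V UNIV"
  proof (rule bij_betw_byWitness[where f' = "\<lambda>x. (vert x, hp x)"])
    show "\<forall>p\<in>?V. (vert (case p of (u, x) \<Rightarrow> u + x), hp (case p of (u, x) \<Rightarrow> u + x)) = p"
    proof (clarify, intro conjI)
      fix u x assume u: "u \<in> vertical \<xi>" and x: "x \<in> horizontal \<eta>"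
      have "vert x = 0" using hp_id[OF x] by (simp add: hp_vert)
      then show "vert (u + x) = u" by (simp add: linear_add[OF linear_vert] vert_id[OF u])
      show "hp (u + x) = x" by (simp add: linear_add[OF linear_hp] hp_vertical[OF u] hp_id[OF x])
    qed
  qed (auto simp: vert_vertical hp_vert intro: hp_horizontal[unfolded hp_vert])
  moreover have "(case ?b p q of (u, x) \<Rightarrow> u + x) = br (case p of (u, x) \<Rightarrow> u + x) (case q of (u, x) \<Rightarrow> u + x)"
    if "p \<in> ?V" "q \<in> ?V" for p q
  proof -
    obtain u x v y where pq: "p = (u, x)" "q = (v, y)" "u \<in> vertical \<xi>" "v \<in> vertical \<xi>"
      using \<open>p \<in> ?V\<close> \<open>q \<in> ?V\<close> by auto
    have "br z v = 0" for z using vertical_central[OF pq(4)] br_skew[of z v] by simp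
    then show ?thesis by (simp add: pq b hp_vert br_simps vertical_central[OF pq(3)])
  qed
  ultimately show ?thesis using lie unfolding lie_algebra_iso_def by blast
qed

end

section \<open>The canonical connection\<close>

context parallel_canonical_contact begin

lemma inner_product: "inner_product g"
  using contact unfolding almost_3_contact_metric_lie_algebra_def by blast

lemma g_commute: "g x y = g y x"
  using inner_product by (simp add: inner_product_def)

lemma linear_g: "linear (g x)"
  using inner_product by (simp add: inner_product_def)

lemma bilinear_g: "bilinear g"
  unfolding bilinear_def using linear_g by (simp add: g_commute[where y = "_ :: 'a"])

lemma g_eq_0: "g x x = 0 \<Longrightarrow> x = 0"
  using inner_product unfolding inner_product_def by force

lemma g_nondegenerate:
  assumes "\<And>z. g x z = g y z"
  shows "x = y"
proof -
  have "g (x - y) (x - y) = 0"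
    by (simp add: bilinear_lsub[OF bilinear_g] assms)
  then show ?thesis using g_eq_0 by fastforce
qed

lemma g_\<phi>\<phi>: "i \<in> I3 \<Longrightarrow> g (\<phi> i x) (\<phi> i y) = g x y - \<eta> i x * \<eta> i y"
  using contact unfolding almost_3_contact_metric_lie_algebra_def by blast

lemma g_\<xi>: "i \<in> I3 \<Longrightarrow> g x (\<xi> i) = \<eta> i x"
  using g_\<phi>\<phi>[of i x "\<xi> i"] by (simp only: \<phi>\<xi>_same linear_0[OF linear_g] \<eta>\<xi>_same) simp

lemma g_\<phi>:
  assumes i: "i \<in> I3"
  shows "g (\<phi> i x) y = - g x (\<phi> i y)"
proof -
  have "g (\<phi> i x) (\<phi> i (\<phi> i y)) = g x (\<phi> i y)"
    by (simp add: g_\<phi>\<phi>[OF i] \<eta>\<phi>_same[OF i])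
  moreover have "g (\<phi> i x) (\<phi> i (\<phi> i y)) = - g (\<phi> i x) y"
    by (simp add: \<phi>\<phi>[OF i] linear_diff[OF linear_g] linear_scale[OF linear_g] g_\<xi>[OF i] \<eta>\<phi>_same[OF i])
  ultimately show ?thesis by simp
qed

text \<open>The cardinality 4n + 3 of a basis is positive, while \<open>card\<close> is 0 on
  infinite sets.\<close>

lemma finite_basis: obtains B :: "'a set" where "finite B" "independent B" "span B = UNIV"
proof -
  obtain B :: "'a set" where B: "B \<subseteq> UNIV" "independent B" "UNIV \<subseteq> span B" "card B = dim (UNIV :: 'a set)"
    by (rule basis_exists)
  have "dim (UNIV :: 'a set) = 4 * n + 3"
    using contact unfolding almost_3_contact_metric_lie_algebra_def by (elim conjE)
  then have "finite B" using B(4) by (intro card_ge_0_finite) simp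
  then show ?thesis by (rule that[OF _ B(2) top_le[OF B(3)]])
qed

text \<open>The functionals \<open>g x\<close> form a subspace of the dual, and they separate points
  since g x x is nonzero for x nonzero.\<close>

lemma riesz:
  assumes "linear l"
  shows "\<exists>x. \<forall>z. l z = g x z"
proof -
  obtain B :: "'a set" where B: "finite B" "independent B" "span B = UNIV" by (rule finite_basis)
  have "l \<in> range g"
  proof (rule separating_functionals_full[OF _ _ _ _ B assms])
    show "linear e" if "e \<in> range g" for e using that linear_g by auto
    show "(\<lambda>z. r * e z + s * e' z) \<in> range g" if e: "e \<in> range g" "e' \<in> range g" for e e' r s
    proof -
      obtain x y where "e = g x" "e' = g y" using e by auto
      then have "(\<lambda>z. r * e z + s * e' z) = g (r *\<^sub>R x + s *\<^sub>R y)"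
        by (simp add: fun_eq_iff bilinear_ladd[OF bilinear_g] bilinear_lmul[OF bilinear_g])
      then show ?thesis by simp
    qed
    show "\<exists>e\<in>range g. e x \<noteq> 0" if "x \<noteq> 0" for x
      using g_eq_0[of x] that by blast
    show "(\<lambda>_. 0) \<in> range g"
      by (rule range_eqI[of _ _ 0]) (simp add: fun_eq_iff bilinear_lzero[OF bilinear_g])
  qed
  then show ?thesis by auto
qed

definition \<Gamma> :: "'a \<Rightarrow> 'a \<Rightarrow> 'a" where
  "\<Gamma> x y = (SOME v. \<forall>z. - g (br y z) x = g v z)"

lemma g_\<Gamma>: "g (\<Gamma> x y) z = - g (br y z) x"
proof -
  have "linear (\<lambda>z. - g (br y z) x)"
    by (rule linearI)
      (simp_all add: br_simps bilinear_ladd[OF bilinear_g] bilinear_lmul[OF bilinear_g])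
  from riesz[OF this] have "\<forall>z. - g (br y z) x = g (\<Gamma> x y) z"
    unfolding \<Gamma>_def by (rule someI_ex)
  then show ?thesis by simp
qed

lemma bilinear_\<Gamma>: "bilinear \<Gamma>"
  unfolding bilinear_def
  by (intro conjI allI linearI g_nondegenerate;
      simp add: bilinear_ladd[OF bilinear_g] bilinear_lmul[OF bilinear_g] g_\<Gamma> br_simps
        linear_add[OF linear_g] linear_scale[OF linear_g])

lemma \<Gamma>_metric: "g (\<Gamma> x y) z + g y (\<Gamma> x z) = 0"
  using g_\<Gamma>[of x y z] g_\<Gamma>[of x z y] g_commute[of y "\<Gamma> x z"] br_skew[of y z]
  by (simp add: bilinear_lneg[OF bilinear_g])

text \<open>Moving \<open>\<phi> i\<close> across the bracket and moving it across the metric each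
  cost one sign, and the two signs cancel.\<close>

lemma \<Gamma>_\<phi>:
  assumes i: "i \<in> I3"
  shows "\<Gamma> x (\<phi> i y) = \<phi> i (\<Gamma> x y)"
  by (rule g_nondegenerate)
    (simp add: g_\<Gamma> g_\<phi>[OF i] br_\<phi>[OF i] bilinear_lneg[OF bilinear_g])

lemma c_form_skew: "c_form br g y x z = - c_form br g x y z" "c_form br g x z y = - c_form br g x y z"
  using br_skew[of x y] br_skew[of y z] br_skew[of z x]
  by (simp_all add: c_form_def bilinear_lneg[OF bilinear_g])

lemma \<Gamma>_torsion: "g (\<Gamma> x y - \<Gamma> y x - br x y) z = c_form br g x y z"
  using br_skew[of x z]
  by (simp add: bilinear_lsub[OF bilinear_g] g_\<Gamma> c_form_def bilinear_lneg[OF bilinear_g])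

text \<open>In each term of \<open>c_form\<close>, replacing z by \<open>hp z\<close> in g([x,y],z)
  loses exactly the sum of \<eta> i (z) \<eta> i ([x,y]), because \<eta> i is the metric dual of
  \<xi> i. The wedge terms restore it, since d of \<eta> i is -\<eta> i of the bracket.\<close>

lemma skew_torsion_T_c_form: "skew_torsion_T br \<xi> \<eta> g x y z = c_form br g x y z"
proof -
  have v: "g u (vert z) = (\<Sum>i\<in>I3. \<eta> i z * \<eta> i u)" for u z
    unfolding vert_def linear_sum[OF linear_g] linear_scale[OF linear_g] real_scaleR_def
    by (rule sum.cong[OF refl]) (simp only: g_\<xi>)
  have h: "g u (hp z) = g u z - (\<Sum>i\<in>I3. \<eta> i z * \<eta> i u)" for u z
    by (simp only: hp_vert linear_diff[OF linear_g] v)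
  have "(\<Sum>i\<in>I3. wedge12 (\<eta> i) (lie_d br (\<eta> i)) x y z) =
    - (\<Sum>i\<in>I3. \<eta> i z * \<eta> i (br x y)) - (\<Sum>i\<in>I3. \<eta> i x * \<eta> i (br y z)) - (\<Sum>i\<in>I3. \<eta> i y * \<eta> i (br z x))"
    by (simp only: wedge12_def lie_d_def sum.distrib mult_minus_right sum_negf)
  then show ?thesis
    unfolding skew_torsion_T_def by (simp only: c_form_def br_hp h)
qed

text \<open>The witness is d + \<open>\<Gamma>\<close>. It is shown to meet both descriptions, and
  any connection meeting either one is compared with it; so both are uniquely solvable, with the
  same solution.\<close>

lemma canonical_connection_iff:
  fixes A :: "('g::{topological_group_add,t2_space,second_countable_topology} set
      \<times> ('g \<Rightarrow> 'e::euclidean_space)) set"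
  assumes A: "lie_group A" and \<iota>: "lie_algebra_of_group A br \<iota>"
  shows "\<exists>D. \<forall>D'.
    (canonical_connection A (\<lambda>i. left_inv_endo A \<iota> (\<phi> i)) (left_inv_2tensor A \<iota> g) D' \<longleftrightarrow> D' = D) \<and>
    (metric_connection_with_torsion A (left_inv_2tensor A \<iota> g)
       (left_inv_3tensor A \<iota> (skew_torsion_T br \<xi> \<eta> g)) D' \<longleftrightarrow> D' = D)"
proof -
  obtain B :: "'a set" where B: "finite B" "independent B" "span B = UNIV" by (rule finite_basis)
  interpret F: lie_group_frame A br \<iota> B
    by unfold_locales (use A \<iota> B in auto)
  define D where "D = F.conn \<Gamma>"
  let ?\<Phi> = "\<lambda>i. left_inv_endo A \<iota> (\<phi> i)"
  let ?g = "left_inv_2tensor A \<iota> g"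
  let ?mc = "maurer_cartan A \<iota>"
  let ?T = "left_inv_3tensor A \<iota> (skew_torsion_T br \<xi> \<eta> g)"
  have T: "?T X Y Z = (\<lambda>p. c_form br g (?mc X p) (?mc Y p) (?mc Z p))" for X Y Z
    by (simp add: left_inv_3tensor_def skew_torsion_T_c_form)
  have metric: "metric_connection A ?g D"
    unfolding D_def by (rule F.metric_connection_conn) (rule bilinear_\<Gamma> bilinear_g \<Gamma>_metric)+
  then have conn: "connection A D" by (simp add: metric_connection_def)
  have torsion: "torsion_form ?g D X Y Z = ?T X Y Z" if "X \<in> vector_fields A" "Y \<in> vector_fields A" for X Y Z
    unfolding torsion_form_def left_inv_2tensor_def T D_def
    by (simp add: F.mc_torsion_conn[OF bilinear_\<Gamma> bilinear_br that] \<Gamma>_torsion)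
  have with_torsion: "metric_connection_with_torsion A ?g ?T D"
    using metric torsion by (simp add: metric_connection_with_torsion_def)
  have "three_form A (torsion_form ?g D)"
    unfolding three_form_def
  proof (intro ballI conjI)
    fix X Y Z assume X: "X \<in> vector_fields A" and Y: "Y \<in> vector_fields A" and Z: "Z \<in> vector_fields A"
    note eq = torsion[OF X Y] torsion[OF Y X] torsion[OF X Z] T
    have sm: "(\<lambda>p. g (br (?mc U p) (?mc V p)) (?mc W p)) \<in> smooth_functions A"
      if "U \<in> vector_fields A" "V \<in> vector_fields A" "W \<in> vector_fields A" for U V W
      by (rule F.smooth_bilinear[OF bilinear_g F.smooth_map_bilinear[OF bilinear_br]])
        (rule F.smooth_map_mc that)+
    have "(\<lambda>p. - g (br (?mc X p) (?mc Y p)) (?mc Z p) - g (br (?mc Y p) (?mc Z p)) (?mc X p) -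
        g (br (?mc Z p) (?mc X p)) (?mc Y p)) \<in> smooth_functions A"
      by (intro F.smooth_diff F.smooth_minus sm[OF X Y Z] sm[OF Y Z X] sm[OF Z X Y])
    then show "torsion_form ?g D X Y Z \<in> smooth_functions A" by (simp add: eq c_form_def)
    show "torsion_form ?g D Y X Z = (\<lambda>p. - torsion_form ?g D X Y Z p)"
      "torsion_form ?g D X Z Y = (\<lambda>p. - torsion_form ?g D X Y Z p)"
      by (simp_all only: eq c_form_skew(1)[of "?mc Y _"] c_form_skew(2)[of "?mc X _" "?mc Z _"])
    show "torsion_form ?g D (vf_add X X') Y Z = (\<lambda>p. torsion_form ?g D X Y Z p + torsion_form ?g D X' Y Z p)"
      if X': "X' \<in> vector_fields A" for X'
      unfolding eq(1) torsion[OF X' Y] torsion[OF F.vf_add_vf[OF X X'] Y] T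
      by (rule ext) (simp add: F.mc_vf_add[OF X X'] c_form_def br_simps bilinear_ladd[OF bilinear_g] linear_add[OF linear_g])
    show "torsion_form ?g D (vf_mult f X) Y Z = (\<lambda>p. f p * torsion_form ?g D X Y Z p)"
      if f: "f \<in> smooth_functions A" for f
      unfolding eq(1) torsion[OF F.vf_mult_vf[OF f X] Y] T
      by (rule ext) (simp add: F.mc_vf_mult[OF X] c_form_def br_simps bilinear_lmul[OF bilinear_g]
          linear_scale[OF linear_g] right_diff_distrib)
  qed
  \<comment> \<open>The endomorphism is constant in the frame, so it commutes with the derivative
    part; \<open>\<Gamma>_\<phi>\<close> settles the algebraic part.\<close>
  moreover have "D X (?\<Phi> i Y) = ?\<Phi> i (D X Y)"
    if i: "i \<in> I3" and X: "X \<in> vector_fields A" and Y: "Y \<in> vector_fields A" for i X Y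
  proof (rule F.vf_eqI)
    note vf = F.left_inv_endo_vf[OF linear_\<phi>[OF i]]
    show "D X (?\<Phi> i Y) \<in> vector_fields A" "?\<Phi> i (D X Y) \<in> vector_fields A"
      unfolding D_def by (rule F.conn_vf[OF bilinear_\<Gamma>] vf X Y)+
    fix p
    have "?mc (?\<Phi> i Y) = (\<lambda>p. \<phi> i (?mc Y p))"
      by (rule ext) (rule F.mc_left_inv_endo)
    then show "?mc (D X (?\<Phi> i Y)) p = ?mc (?\<Phi> i (D X Y)) p"
      unfolding D_def F.mc_left_inv_endo F.mc_conn[OF X Y] F.mc_conn[OF X vf[OF Y]]
      by (simp add: F.dmap_linear[OF X F.smooth_map_mc[OF Y] linear_\<phi>[OF i]] \<Gamma>_\<phi>[OF i]
          linear_add[OF linear_\<phi>[OF i]])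
  qed
  ultimately have canonical: "canonical_connection A ?\<Phi> ?g D"
    using metric unfolding canonical_connection_def by blast
  \<comment> \<open>The common half of both uniqueness proofs: the difference from
    \<open>\<Gamma>\<close> on left invariant fields at a point is skew in its last two arguments by
    metricity, and it remains to deduce that it vanishes.\<close>
  have uniq: "D' = D"
    if m: "metric_connection A ?g D'"
      and \<omega>: "\<And>p. (\<And>x y z. g (?mc (D' (\<iota> x) (\<iota> y)) p - \<Gamma> x y) z =
           - g (?mc (D' (\<iota> x) (\<iota> z)) p - \<Gamma> x z) y) \<Longrightarrow>
         (\<And>x y z. g (?mc (D' (\<iota> x) (\<iota> y)) p - \<Gamma> x y) z = 0)" for D'
  proof -
    have c: "connection A D'" using m by (simp add: metric_connection_def)
    have "?mc (D' (\<iota> x) (\<iota> y)) p = \<Gamma> x y" for x y p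
    proof (rule g_nondegenerate)
      fix z
      have "g (?mc (D' (\<iota> x) (\<iota> y)) p - \<Gamma> x y) z = 0"
      proof (rule \<omega>)
        show "g (?mc (D' (\<iota> x) (\<iota> y)) p - \<Gamma> x y) z = - g (?mc (D' (\<iota> x) (\<iota> z)) p - \<Gamma> x z) y" for x y z
          using F.metric_connection_frame[OF m, of x y p z] \<Gamma>_metric[of x y z]
            g_commute[of y "\<Gamma> x z"] g_commute[of y "?mc (D' (\<iota> x) (\<iota> z)) p"]
          by (simp add: bilinear_lsub[OF bilinear_g])
      qed
      then show "g (?mc (D' (\<iota> x) (\<iota> y)) p) z = g (\<Gamma> x y) z"
        by (simp add: bilinear_lsub[OF bilinear_g])
    qed
    then show ?thesis unfolding D_def by (rule F.connection_eq_conn[OF c bilinear_\<Gamma>])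
  qed
  \<comment> \<open>The bracket terms of the two torsions cancel, so their difference is the
    antisymmetrisation of the difference form in its first two arguments.\<close>
  have torsion': "torsion_form ?g D' (\<iota> x) (\<iota> y) (\<iota> z) p - c_form br g x y z =
      g (?mc (D' (\<iota> x) (\<iota> y)) p - \<Gamma> x y) z - g (?mc (D' (\<iota> y) (\<iota> x)) p - \<Gamma> y x) z"
    if "metric_connection A ?g D'" for D' x y z p
  proof -
    have "connection A D'" using that by (simp add: metric_connection_def)
    then show ?thesis
      by (simp add: torsion_form_def left_inv_2tensor_def F.mc_torsion_frame[OF _ bilinear_br]
          \<Gamma>_torsion[symmetric] bilinear_lsub[OF bilinear_g])
  qed
  have "D' = D" if D': "metric_connection_with_torsion A ?g ?T D'" for D'
  proof -
    have m: "metric_connection A ?g D'" using D' by (simp add: metric_connection_with_torsion_def)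
    show ?thesis
    proof (rule uniq[OF m])
      fix p x y z
      let ?\<omega> = "\<lambda>x y z. g (?mc (D' (\<iota> x) (\<iota> y)) p - \<Gamma> x y) z"
      assume skew: "\<And>x y z. ?\<omega> x y z = - ?\<omega> x z y"
      have "torsion_form ?g D' (\<iota> x) (\<iota> y) (\<iota> z) p = c_form br g x y z" for x y z
        using D' F.\<iota>_vf by (simp add: metric_connection_with_torsion_def T)
      then have "?\<omega> x y z = ?\<omega> y x z" for x y z using torsion'[OF m, of x y z p] by simp
      with skew show "?\<omega> x y z = 0" by (rule metric_symmetric_difference_zero)
    qed
  qed
  moreover have "D' = D" if D': "canonical_connection A ?\<Phi> ?g D'" for D'
  proof -
    have m: "metric_connection A ?g D'" using D' by (simp add: canonical_connection_def)
    show ?thesis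
    proof (rule uniq[OF m])
      fix p x y z
      let ?\<omega> = "\<lambda>x y z. g (?mc (D' (\<iota> x) (\<iota> y)) p - \<Gamma> x y) z"
      assume skew: "\<And>x y z. ?\<omega> x y z = - ?\<omega> x z y"
      show "?\<omega> x y z = 0"
      proof (rule canonical_difference_zero[where \<omega> = ?\<omega>, OF linear_g skew])
        show "\<phi> 1 (\<phi> 1 x) = - x + \<eta> 1 x *\<^sub>R \<xi> 1" for x by (rule \<phi>\<phi>) simp
        \<comment> \<open>The torsion of \<open>D'\<close> is unknown here; what is used is that it
          is skew in its last two arguments, as \<open>c_form\<close> is.\<close>
        show "?\<omega> x y z - ?\<omega> y x z = - (?\<omega> x z y - ?\<omega> z x y)" for x y z
        proof -
          have "torsion_form ?g D' (\<iota> x) (\<iota> z) (\<iota> y) = (\<lambda>p. - torsion_form ?g D' (\<iota> x) (\<iota> y) (\<iota> z) p)"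
            using D' F.\<iota>_vf unfolding canonical_connection_def three_form_def by blast
          then show ?thesis
            using torsion'[OF m, of x y z p] torsion'[OF m, of x z y p] c_form_skew(2)[of x z y] by simp
        qed
        show "?\<omega> x (\<phi> 1 y) z = - ?\<omega> x y (\<phi> 1 z)" for x y z
        proof -
          have i: "1 \<in> I3" by simp
          have "D' (\<iota> x) (?\<Phi> 1 (\<iota> y)) = ?\<Phi> 1 (D' (\<iota> x) (\<iota> y))"
            using D' F.\<iota>_vf i unfolding canonical_connection_def by blast
          then have "?mc (D' (\<iota> x) (\<iota> (\<phi> 1 y))) p = \<phi> 1 (?mc (D' (\<iota> x) (\<iota> y)) p)"
            by (simp only: F.left_inv_endo_\<iota> F.mc_left_inv_endo)
          then show ?thesis
            by (simp only: \<Gamma>_\<phi>[OF i] linear_diff[OF linear_\<phi>[OF i], symmetric] g_\<phi>[OF i])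
        qed
      qed
    qed
  qed
  ultimately show ?thesis using canonical with_torsion by blast
qed

end

theorem proposition6p11:
  fixes n :: nat
    and br :: "'a::real_vector \<Rightarrow> 'a \<Rightarrow> 'a"
    and \<phi> :: "nat \<Rightarrow> 'a \<Rightarrow> 'a" and \<xi> :: "nat \<Rightarrow> 'a" and \<eta> :: "nat \<Rightarrow> 'a \<Rightarrow> real"
    and g :: "'a \<Rightarrow> 'a \<Rightarrow> real"
  assumes "almost_3_contact_metric_lie_algebra n br \<phi> \<xi> \<eta> g"
    and "abelian_3_contact br \<phi> \<xi> \<eta>"
    and "parallel_canonical br \<phi> \<xi> \<eta>"
    and "contact_delta br \<xi> \<eta> = 0"
  shows "vertical \<xi> \<subseteq> lie_center br \<and>
    lie_algebra_on (horizontal \<eta>) (hor_bracket br \<xi> \<eta>) \<and>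
    abelian_hypercomplex (horizontal \<eta>) (hor_bracket br \<xi> \<eta>) \<phi> \<and>
    lie_two_cocycle (horizontal \<eta>) (hor_bracket br \<xi> \<eta>) (vertical \<xi>) (theta br \<xi> \<eta>) \<and>
    (\<forall>i\<in>{1,2,3}. \<forall>x\<in>horizontal \<eta>. \<forall>y\<in>horizontal \<eta>.
       theta br \<xi> \<eta> (\<phi> i x) (\<phi> i y) = theta br \<xi> \<eta> x y) \<and>
    lie_algebra_iso (vertical \<xi> \<times> horizontal \<eta>)
      (central_ext_bracket (theta br \<xi> \<eta>) (hor_bracket br \<xi> \<eta>)) UNIV br (\<lambda>(u, x). u + x) \<and>
    (\<forall>(A :: ('g::{topological_group_add,t2_space,second_countable_topology} set
              \<times> ('g \<Rightarrow> 'e::euclidean_space)) set) \<iota>.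
       lie_group A \<and> lie_algebra_of_group A br \<iota> \<longrightarrow>
       (\<exists>D. \<forall>D'.
          (canonical_connection A (\<lambda>i. left_inv_endo A \<iota> (\<phi> i)) (left_inv_2tensor A \<iota> g) D'
             \<longleftrightarrow> D' = D) \<and>
          (metric_connection_with_torsion A (left_inv_2tensor A \<iota> g)
             (left_inv_3tensor A \<iota> (skew_torsion_T br \<xi> \<eta> g)) D'
             \<longleftrightarrow> D' = D)))"
proof -
  interpret parallel_canonical_contact n br \<phi> \<xi> \<eta> g
    by (rule parallel_canonical_contact.intro) (rule assms)+
  have "vertical \<xi> \<subseteq> lie_center br"
    using vertical_central by (auto simp: lie_center_def)
  moreover have "\<forall>i\<in>{1,2,3}. \<forall>x\<in>horizontal \<eta>. \<forall>y\<in>horizontal \<eta>.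
      theta br \<xi> \<eta> (\<phi> i x) (\<phi> i y) = theta br \<xi> \<eta> x y"
    by (intro ballI) (simp only: theta_vert br_\<phi>\<phi>)
  ultimately show ?thesis
    by (intro conjI allI impI hor_lie hor_hypercomplex theta_cocycle central_ext_iso
        canonical_connection_iff) (simp_all only:)
qed

end
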